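(* The following hold. (1) For every fixed integer $c\ge5$ there is a constant $C=C(c)>0$, depending only on $c$, such that for every sequence $\{G_n\}_{n\ge1}$ of finite simple graphs with $N(K_3,G_n)\ge1$ for all $n$, $$\sup_{x\in\mathbb{R}}\left|\mathbb{P}(Z_3(G_n)\le x)-\Phi(x)\right|\le C\left(\mathbb{E}(Z_3(G_n)^4)-3\right)^{1/20}$$ for all $n$ large enough. (2) For every integer $c$ with $2\le c\le4$, there exists a sequence of finite simple graphs $\{G_n\}_{n\ge1}$ with $N(K_3,G_n)\ge 1$ for all $n$ and $N(K_3,G_n)\to\infty$ for which $\mathbb{E}(Z_3(G_n)^4)\to3$ as $n\to\infty$, but $Z_3(G_n)$ does not converge in distribution to $N(0,1)$.
   Context: $G_n=(V(G_n),E(G_n))$ is a deterministic finite simple graph with vertex set $\{1,2,\dots,|V(G_n)|\}$ and adjacency matrix $(a_{ij}(G_n))$. In a uniformly random $c$-coloring, the colors $X_v$, $v\in V(G_n)$, are independent and uniform on $\{1,\dots,c\}$. The number of monochromatic triangles is $$T_3(G_n)=\sum_{1\le s_1<s_2<s_3\le |V(G_n)|}a_{s_1s_2}(G_n)a_{s_2s_3}(G_n)a_{s_1s_3}(G_n)\mathbf 1\{X_{s_1}=X_{s_2}=X_{s_3}\},$$ and $Z_3(G_n)=\dfrac{T_3(G_n)-\mathbb{E}(T_3(G_n))}{\sqrt{\mathrm{Var}(T_3(G_n))}}$. $N(K_3,G_n)$ is the number of triangles in $G_n$. $\Phi$ is the standard normal distribution function. *)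

theory Defs
  imports "HOL-Probability.Probability" "Graph_Theory.Pair_Digraph"
begin

text \<open>
  A finite simple graph is the locale \<open>pair_graph\<close>: a finite loop-free digraph without
  parallel arcs whose arc relation is symmetric, so an edge is a pair of opposite arcs.
\<close>

definition labelled_graph :: "nat pair_pre_digraph \<Rightarrow> bool" where
  "labelled_graph G \<longleftrightarrow> pair_graph G \<and> pverts G = {1..card (pverts G)}"

definition adj :: "nat pair_pre_digraph \<Rightarrow> nat \<Rightarrow> nat \<Rightarrow> real" where
  "adj G i j = of_bool ((i, j) \<in> parcs G)"

definition num_triangles :: "nat pair_pre_digraph \<Rightarrow> nat" where
  "num_triangles G =
     card {S. S \<subseteq> pverts G \<and> card S = 3 \<and> (\<forall>u\<in>S. \<forall>v\<in>S. u \<noteq> v \<longrightarrow> (u, v) \<in> parcs G)}"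

text \<open>
  The joint law of the colours: independent over the vertices, each uniform on \<open>{1..c}\<close> for
  \<open>c \<ge> 1\<close>. The value 0 is only the value of a colouring outside the vertex set.
\<close>

definition coloring_pmf :: "nat \<Rightarrow> nat pair_pre_digraph \<Rightarrow> (nat \<Rightarrow> nat) pmf" where
  "coloring_pmf c G = Pi_pmf (pverts G) 0 (\<lambda>_. pmf_of_set {1..c})"

definition T3 :: "nat pair_pre_digraph \<Rightarrow> (nat \<Rightarrow> nat) \<Rightarrow> real" where
  "T3 G X =
     (\<Sum>(s1, s2, s3) \<in> {(s1, s2, s3). 1 \<le> s1 \<and> s1 < s2 \<and> s2 < s3 \<and> s3 \<le> card (pverts G)}.
        adj G s1 s2 * adj G s2 s3 * adj G s1 s3 * of_bool (X s1 = X s2 \<and> X s2 = X s3))"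

definition Z3 :: "nat \<Rightarrow> nat pair_pre_digraph \<Rightarrow> (nat \<Rightarrow> nat) \<Rightarrow> real" where
  "Z3 c G X =
     (T3 G X - measure_pmf.expectation (coloring_pmf c G) (T3 G)) /
     sqrt (measure_pmf.variance (coloring_pmf c G) (T3 G))"

definition Z3_fourth_moment :: "nat \<Rightarrow> nat pair_pre_digraph \<Rightarrow> real" where
  "Z3_fourth_moment c G = measure_pmf.expectation (coloring_pmf c G) (\<lambda>X. (Z3 c G X) ^ 4)"

definition Z3_distr :: "nat \<Rightarrow> nat pair_pre_digraph \<Rightarrow> real measure" where
  "Z3_distr c G = distr (measure_pmf (coloring_pmf c G)) borel (Z3 c G)"

definition std_normal_cdf :: "real \<Rightarrow> real" ("\<Phi>") where
  "\<Phi> = cdf std_normal_distribution"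

text \<open>
  The power 1/20 in the main bound is \<open>root 20\<close>, which is negative at negative arguments:
  a bound of the nonnegative Kolmogorov distance by \<open>C * root 20 (Z3_fourth_moment c G - 3)\<close>
  with \<open>C > 0\<close> therefore includes the claim that the fourth moment is at least 3. With
  \<open>powr\<close> it would not, since \<open>x powr a\<close> is a positive number for negative \<open>x\<close>.
\<close>

definition kolmogorov_dist :: "nat \<Rightarrow> nat pair_pre_digraph \<Rightarrow> real" where
  "kolmogorov_dist c G =
     (SUP x. \<bar>measure_pmf.prob (coloring_pmf c G) {X. Z3 c G X \<le> x} - \<Phi> x\<bar>)"

end

theory Submission
  imports Defs
begin

text \<open>
  Positive part. Centre the triangle indicators; the fourth cumulant of their sum is the sum of the
  joint cumulants over quadruples of triangles. Joint moments are powers of \<open>1/c\<close> with the graphic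
  rank as exponent, so by submodularity of the rank a joint cumulant vanishes when the rank splits
  additively over a bipartition of the quadruple, and for \<open>c \<ge> 5\<close> it is at least \<open>c^-8\<close> otherwise.
  Hence the excess kurtosis controls the number of connected quadruples. Stein's method for the
  characteristic function, with the martingale increments of an ordering that puts vertices of large
  weight first, leaves an error governed by these quadruples and by the weight \<open>Q v\<close> that a vertex
  sends to its predecessors. A vertex with large \<open>Q v\<close> has few, heavy predecessors, which forces
  heavy edges and thus again connected quadruples. Levy inversion after Gaussian smoothing turns the
  bound on the characteristic function into one on the distribution function.

  Negative part. Join a fixed triangle-free graph with many independent vertices. After scaling,
  the number of monochromatic triangles is asymptotically the number of monochromatic edges of the
  fixed graph, which is bounded. The fixed graph is a 4-cycle with pendant edges: for \<open>c \<le> 4\<close> each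
  edge has negative fourth cumulant, the cycle contributes a positive one, and they cancel.
\<close>

section \<open>From characteristic functions to distribution functions\<close>

text \<open>The threshold 5 is already visible in four triangles on a common edge with distinct
  third vertices: their joint cumulant is \<open>c^-8\<close> times
  \<open>(c - 1) * (c^2 - 6c + 6)\<close>, which for \<open>c >= 2\<close> is positive exactly from
  \<open>c = 5\<close> on. The counterexample is built from such books of triangles. The exponent 20
  records the losses on the way. If the excess kurtosis is \<open>s^20\<close>, the number
  \<open>nconn\<close> of connected quadruples is of order \<open>s^20 * F^2\<close>, where
  \<open>F\<close> is comparable to the variance. Passing from heavy edges to \<open>Q v\<close>
  takes a cube root, and \<open>s^(20/3)\<close> is rounded to \<open>s^6\<close>. Thus the
  fluctuation of the Stein kernel \<open>\<Gamma>\<close> has relative variance of order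
  \<open>s^6\<close>, hence relative mean size of order \<open>s^3\<close>; the Taylor remainder has
  the same order after normalisation. Smoothing at scale \<open>s^2\<close> divides this by
  \<open>s^2\<close>, and an error of order \<open>s\<close> remains.\<close>

definition gauss_smooth :: "real \<Rightarrow> real measure \<Rightarrow> real measure" where
  "gauss_smooth \<epsilon> M = distr (M \<Otimes>\<^sub>M std_normal_distribution) borel (\<lambda>(z, y). z + \<epsilon> * y)"

lemma std_normal_tail: 
  assumes "h > 0"
  shows "measure std_normal_distribution {y. \<bar>y\<bar> \<ge> h} \<le> 1 / h\<^sup>2"
proof -
  interpret N: real_distribution std_normal_distribution by (rule real_dist_normal_dist)
  have i: "integrable std_normal_distribution (\<lambda>x. x ^ 2)"
    by (rule integrable_std_normal_distribution_moment)
  have e: "(LINT x|std_normal_distribution. x ^ 2) = 1"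
    using std_normal_distribution_even_moments(1)[of 1] by simp
  have "measure std_normal_distribution {y\<in>space std_normal_distribution. h\<^sup>2 \<le> y\<^sup>2} \<le> 1 / h\<^sup>2"
    using integral_Markov_inequality_measure[OF i, of "{}" "h^2"] assms e by auto
  moreover have "{y\<in>space std_normal_distribution. h\<^sup>2 \<le> y\<^sup>2} = {y. \<bar>y\<bar> \<ge> h}"
    using assms by (auto simp: abs_le_square_iff[symmetric])
  ultimately show ?thesis by simp
qed

context real_distribution
begin

lemma pair_std_normal: "pair_prob_space M std_normal_distribution"
proof -
  interpret N: real_distribution std_normal_distribution by (rule real_dist_normal_dist)
  show ?thesis ..
qed

lemma gauss_smooth_measurable [measurable]:
  "(\<lambda>(z, y). z + \<epsilon> * y) \<in> borel_measurable (M \<Otimes>\<^sub>M std_normal_distribution)"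
  by measurable

lemma real_distribution_gauss_smooth: "real_distribution (gauss_smooth \<epsilon> M)"
proof -
  interpret P: pair_prob_space M std_normal_distribution by (rule pair_std_normal)
  show ?thesis unfolding gauss_smooth_def
    by (intro P.real_distribution_distr gauss_smooth_measurable)
qed

lemma char_gauss_smooth: "char (gauss_smooth \<epsilon> M) t = char M t * exp (- (\<epsilon> * t)\<^sup>2 / 2)"
proof -
  interpret P: pair_prob_space M std_normal_distribution by (rule pair_std_normal)
  have "char (gauss_smooth \<epsilon> M) t = (CLINT p|(M \<Otimes>\<^sub>M std_normal_distribution). iexp (t * (fst p + \<epsilon> * snd p)))"
    unfolding gauss_smooth_def char_def
    by (subst integral_distr) (auto simp: split_beta)
  also have "\<dots> = (CLINT p|(M \<Otimes>\<^sub>M std_normal_distribution). (\<lambda>(z,y). iexp (t * z) * iexp (\<epsilon> * t * y)) p)"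
    by (intro Bochner_Integration.integral_cong) (auto simp: exp_add[symmetric] algebra_simps)
  also have "\<dots> = (CLINT z|M. (CLINT y|std_normal_distribution. iexp (t * z) * iexp (\<epsilon> * t * y)))"
  proof (rule P.integral_fst[symmetric])
    show "integrable (M \<Otimes>\<^sub>M std_normal_distribution) (\<lambda>(z,y). iexp (t * z) * iexp (\<epsilon> * t * y))"
    by (intro P.integrable_const_bound[where B=1]) (auto simp: norm_mult split_beta)
  qed
  also have "\<dots> = (CLINT z|M. iexp (t * z) * char std_normal_distribution (\<epsilon> * t))"
    by (simp add: char_def)
  also have "\<dots> = char M t * char std_normal_distribution (\<epsilon> * t)"
    unfolding char_def by simp
  finally show ?thesis by (simp add: char_std_normal_distribution)
qed

text \<open>Each fibre over \<open>z\<close> is at most one point, a null set of the Gaussian. Levy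
  inversion wants endpoints that are not atoms, and the law of \<open>Z3\<close> is
  discrete.\<close>

lemma gauss_smooth_atomless:
  assumes "\<epsilon> > 0"
  shows "measure (gauss_smooth \<epsilon> M) {a} = 0"
proof -
  interpret P: pair_prob_space M std_normal_distribution by (rule pair_std_normal)
  let ?S = "(\<lambda>(z, y). z + \<epsilon> * y) -` {a} \<inter> space (M \<Otimes>\<^sub>M std_normal_distribution)"
  have S: "?S \<in> sets (M \<Otimes>\<^sub>M std_normal_distribution)"
    by (rule measurable_sets[OF gauss_smooth_measurable]) auto
  have *: "emeasure std_normal_distribution (Pair x -` ?S) = 0" for x
  proof -
    have "Pair x -` ?S \<subseteq> {(a - x) / \<epsilon>}"
      using assms by (auto simp: field_simps)
    moreover have "emeasure std_normal_distribution {(a - x) / \<epsilon>} = 0"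
      by (subst emeasure_density) (auto simp: nn_integral_indicator_singleton)
    ultimately show ?thesis
      by (metis emeasure_mono[of "Pair x -` ?S" "{(a - x) / \<epsilon>}" std_normal_distribution] le_zero_eq
        sets_density sets_lborel borel_singleton sets.empty_sets)
  qed
  have "emeasure (M \<Otimes>\<^sub>M std_normal_distribution) ?S = 0"
    using * by (subst P.M2.emeasure_pair_measure_alt[OF S]) simp
  then show ?thesis unfolding gauss_smooth_def
    by (subst measure_distr) (auto simp: measure_def)
qed

text \<open>Off the event that the Gaussian displacement reaches \<open>\<delta>\<close>, which by
  Chebyshev has probability at most \<open>\<epsilon>^2 / \<delta>^2\<close>, the two variables
  differ by less than \<open>\<delta>\<close>.\<close>

lemma cdf_gauss_smooth:
  assumes "\<epsilon> > 0" "\<delta> > 0"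
  shows "cdf M x \<le> cdf (gauss_smooth \<epsilon> M) (x + \<delta>) + \<epsilon>\<^sup>2 / \<delta>\<^sup>2"
    and "cdf (gauss_smooth \<epsilon> M) x \<le> cdf M (x + \<delta>) + \<epsilon>\<^sup>2 / \<delta>\<^sup>2"
proof -
  interpret P: pair_prob_space M std_normal_distribution by (rule pair_std_normal)
  interpret N: real_distribution std_normal_distribution by (rule real_dist_normal_dist)
  let ?P = "M \<Otimes>\<^sub>M std_normal_distribution"
  have sp: "space ?P = UNIV" by (simp add: space_pair_measure)
  have times: "measure ?P (A \<times> B) = measure M A * measure std_normal_distribution B"
    if "A \<in> sets borel" "B \<in> sets borel" for A B
    unfolding measure_def using that
    by (subst P.M2.emeasure_pair_measure_Times) (auto simp: enn2real_mult)
  let ?B = "UNIV \<times> {y. \<bar>y\<bar> \<ge> \<delta> / \<epsilon>}"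
  have B: "?B \<in> sets ?P" by (intro pair_measureI) auto
  have mB: "measure ?P ?B \<le> \<epsilon>\<^sup>2 / \<delta>\<^sup>2"
  proof -
    have "measure ?P ?B = measure M UNIV * measure std_normal_distribution {y. \<bar>y\<bar> \<ge> \<delta> / \<epsilon>}"
      by (rule times) auto
    also have "\<dots> = measure std_normal_distribution {y. \<bar>y\<bar> \<ge> \<delta> / \<epsilon>}"
      using prob_space by simp
    also have "\<dots> \<le> 1 / (\<delta> / \<epsilon>)\<^sup>2" using assms by (intro std_normal_tail) auto
    finally show ?thesis by (simp add: power_divide)
  qed
  have cM: "cdf M x = measure ?P ({..x} \<times> UNIV)" for x
  proof -
    have "measure ?P ({..x} \<times> UNIV) = measure M {..x} * measure std_normal_distribution UNIV"
      by (rule times) auto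
    then show ?thesis using P.M2.prob_space by (simp add: cdf_def2)
  qed
  have Sx: "{p. fst p + \<epsilon> * snd p \<le> x} \<in> sets ?P" for x
  proof -
    have "(\<lambda>(z, y). z + \<epsilon> * y) -` {..x} \<inter> space ?P \<in> sets ?P"
      by (rule measurable_sets[OF gauss_smooth_measurable]) auto
    moreover have "(\<lambda>(z, y). z + \<epsilon> * y) -` {..x} \<inter> space ?P = {p. fst p + \<epsilon> * snd p \<le> x}"
      by (auto simp: sp)
    ultimately show ?thesis by simp
  qed
  have cS: "cdf (gauss_smooth \<epsilon> M) x = measure ?P {p. fst p + \<epsilon> * snd p \<le> x}" for x
  proof -
    have "cdf (gauss_smooth \<epsilon> M) x = measure ?P ((\<lambda>(z, y). z + \<epsilon> * y) -` {..x} \<inter> space ?P)"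
      unfolding gauss_smooth_def cdf_def2 by (subst measure_distr) auto
    also have "(\<lambda>(z, y). z + \<epsilon> * y) -` {..x} \<inter> space ?P = {p. fst p + \<epsilon> * snd p \<le> x}"
      by (auto simp: sp)
    finally show ?thesis .
  qed
  have C: "{..x} \<times> (UNIV::real set) \<in> sets ?P" for x by (intro pair_measureI) auto
  have B': "\<epsilon> * y \<le> \<delta> \<and> - \<delta> \<le> \<epsilon> * y" if "\<not> \<bar>y\<bar> \<ge> \<delta> / \<epsilon>" for y
  proof -
    have "\<bar>\<epsilon> * y\<bar> < \<delta>" using that assms by (simp add: abs_mult field_simps)
    then show ?thesis by linarith
  qed
  have "{..x} \<times> (UNIV::real set) \<subseteq> {p. fst p + \<epsilon> * snd p \<le> x + \<delta>} \<union> ?B"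
    using B' by fastforce
  then have "measure ?P ({..x} \<times> UNIV) \<le> measure ?P ({p. fst p + \<epsilon> * snd p \<le> x + \<delta>} \<union> ?B)"
    using Sx B by (intro P.finite_measure_mono) auto
  also have "\<dots> \<le> measure ?P {p. fst p + \<epsilon> * snd p \<le> x + \<delta>} + measure ?P ?B"
    using Sx B by (rule measure_Un_le)
  finally show "cdf M x \<le> cdf (gauss_smooth \<epsilon> M) (x + \<delta>) + \<epsilon>\<^sup>2 / \<delta>\<^sup>2"
    using mB unfolding cM cS by simp
  have "{p. fst p + \<epsilon> * snd p \<le> x} \<subseteq> {..x+\<delta>} \<times> (UNIV::real set) \<union> ?B"
    using B' by fastforce
  then have "measure ?P {p. fst p + \<epsilon> * snd p \<le> x} \<le> measure ?P ({..x+\<delta>} \<times> (UNIV::real set) \<union> ?B)"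
    using C B by (intro P.finite_measure_mono) auto
  also have "\<dots> \<le> measure ?P ({..x+\<delta>} \<times> UNIV) + measure ?P ?B"
    using C B by (rule measure_Un_le)
  finally show "cdf (gauss_smooth \<epsilon> M) x \<le> cdf M (x + \<delta>) + \<epsilon>\<^sup>2 / \<delta>\<^sup>2"
    using mB unfolding cM cS by simp
qed

end

text \<open>The kernel \<open>F\<close> of Levy inversion is at most \<open>2 / |t|\<close>, so the
  factor \<open>|t|\<close> in the hypothesis absorbs its singularity and the bound is uniform in
  \<open>a\<close> and \<open>b\<close>. The other bound \<open>b - a\<close> on the kernel gives
  integrability on bounded intervals.\<close>

lemma measure_Ioc_diff_le:
  fixes g :: "real \<Rightarrow> real"
  assumes M: "real_distribution M" and M': "real_distribution M'"
    and am: "\<And>a. measure M {a} = 0" and am': "\<And>a. measure M' {a} = 0"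
    and ab: "a \<le> b"
    and g: "integrable lborel g" and g0: "\<And>t. g t \<ge> 0" and B: "\<And>t. cmod (char M t - char M' t) \<le> \<bar>t\<bar> * g t"
  shows "\<bar>measure M {a<..b} - measure M' {a<..b}\<bar> \<le> (LINT t|lborel. g t) / pi"
proof -
  interpret M: real_distribution M by fact
  interpret M': real_distribution M' by fact
  define F where "F = (\<lambda>t. (iexp (-(t * a)) - iexp (-(t * b))) / (\<i> * t))"
  have F1: "cmod (F t) \<le> b - a" for t
  proof (cases "t = 0")
    case False
    have "F t = (iexp (t * (-a)) - iexp (t * (-b))) / (\<i> * t)" by (simp add: F_def)
    then show ?thesis using Levy_Inversion_aux2[of "-b" "-a" t] ab False by simp
  qed (use ab in \<open>simp add: F_def\<close>)
  have F2: "cmod (F t) * \<bar>t\<bar> \<le> 2" for t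
  proof (cases "t = 0")
    case False
    have "cmod (F t) * \<bar>t\<bar> = cmod (iexp (-(t * a)) - iexp (-(t * b)))"
      using False by (simp add: F_def norm_divide norm_mult)
    also have "\<dots> \<le> cmod (iexp (-(t * a))) + cmod (iexp (-(t * b)))" by (rule norm_triangle_ineq4)
    also have "\<dots> = 2" by simp
    finally show ?thesis .
  qed auto
  have Fm: "F \<in> borel_measurable borel" unfolding F_def by measurable
  have int: "integrable lborel (\<lambda>t. indicator {-T<..<T} t *\<^sub>R (F t * char K t))" 
    if K: "real_distribution K" for K and T :: real
  proof -
    interpret K: real_distribution K by fact
    have *: "set_integrable lborel {-T<..<T} (\<lambda>t. F t * char K t)"
      unfolding set_integrable_def
    proof (rule integrableI_bounded_set_indicator[where B="b-a"])
      show "(\<lambda>t. F t * char K t) \<in> borel_measurable lborel" using Fm by measurable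
      show "emeasure lborel {- T<..<T} < \<infinity>" by (cases "T \<ge> 0") auto
      show "AE x in lborel. x \<in> {- T<..<T} \<longrightarrow> norm (F x * char K x) \<le> b - a"
        using F1 K.cmod_char_le_1 ab
        by (auto simp: norm_mult intro!: AE_I2 mult_mono[of _ "b-a" _ 1, simplified])
    qed auto
    then show ?thesis by (simp add: set_integrable_def)
  qed
  have lim: "(\<lambda>T. 1 / (2 * pi) * (CLBINT t=-real T..real T. F t * char K t)) \<longlonglongrightarrow> measure K {a<..b}"
    if K: "real_distribution K" "\<And>a. measure K {a} = 0" for K
    using real_distribution.Levy_Inversion[OF K(1) ab K(2) K(2)]
    unfolding F_def by (simp only: of_int_minus of_int_of_nat_eq)
  have eq: "(CLBINT t=-real T..real T. F t * char K t) = (LINT t|lborel. indicator {-real T<..<real T} t *\<^sub>R (F t * char K t))" for K T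
    by (simp add: interval_lebesgue_integral_def set_lebesgue_integral_def einterval_eq)
  have "(\<lambda>T. 1 / (2 * pi) * (CLBINT t=-real T..real T. F t * char M t) - 1 / (2 * pi) * (CLBINT t=-real T..real T. F t * char M' t))
     \<longlonglongrightarrow> complex_of_real (measure M {a<..b}) - complex_of_real (measure M' {a<..b})"
    using lim[OF M am] lim[OF M' am'] by (intro tendsto_diff)
  then have L: "(\<lambda>T. cmod (1 / (2 * pi) * (CLBINT t=-real T..real T. F t * char M t) - 1 / (2 * pi) * (CLBINT t=-real T..real T. F t * char M' t)))
     \<longlonglongrightarrow> cmod (complex_of_real (measure M {a<..b}) - complex_of_real (measure M' {a<..b}))"
    by (rule tendsto_norm)
  have "cmod (1 / (2 * pi) * (CLBINT t=-real T..real T. F t * char M t) - 1 / (2 * pi) * (CLBINT t=-real T..real T. F t * char M' t))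
      \<le> (LINT t|lborel. g t) / pi" for T
  proof -
    have "(CLBINT t=-real T..real T. F t * char M t) - (CLBINT t=-real T..real T. F t * char M' t)
       = (LINT t|lborel. indicator {-real T<..<real T} t *\<^sub>R (F t * char M t) - indicator {-real T<..<real T} t *\<^sub>R (F t * char M' t))"
      unfolding eq by (rule Bochner_Integration.integral_diff[symmetric]; intro int M M')
    also have "cmod \<dots> \<le> (LINT t|lborel. 2 * g t)"
    proof (rule Bochner_Integration.integral_norm_bound_integral)
      show "integrable lborel (\<lambda>t. indicator {-real T<..<real T} t *\<^sub>R (F t * char M t) - indicator {-real T<..<real T} t *\<^sub>R (F t * char M' t))"
        by (intro Bochner_Integration.integrable_diff int M M')
      show "integrable lborel (\<lambda>t. 2 * g t)" using g by auto
      fix t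
      have "cmod (indicator {-real T<..<real T} t *\<^sub>R (F t * char M t) - indicator {-real T<..<real T} t *\<^sub>R (F t * char M' t))
         \<le> cmod (F t * (char M t - char M' t))" by (auto simp: indicator_def algebra_simps)
      also have "\<dots> \<le> cmod (F t) * (\<bar>t\<bar> * g t)" unfolding norm_mult by (intro mult_left_mono B) auto
      also have "\<dots> \<le> 2 * g t" using mult_right_mono[OF F2 g0, of t] by (simp add: ac_simps)
      finally show "cmod (indicator {-real T<..<real T} t *\<^sub>R (F t * char M t) - indicator {-real T<..<real T} t *\<^sub>R (F t * char M' t)) \<le> 2 * g t" .
    qed
    finally have *: "cmod ((CLBINT t=-real T..real T. F t * char M t) - (CLBINT t=-real T..real T. F t * char M' t))
       \<le> 2 * (LINT t|lborel. g t)" by simp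
    have "cmod (1 / (2 * pi) * (CLBINT t=-real T..real T. F t * char M t) - 1 / (2 * pi) * (CLBINT t=-real T..real T. F t * char M' t))
      = cmod ((CLBINT t=-real T..real T. F t * char M t) - (CLBINT t=-real T..real T. F t * char M' t)) / (2 * pi)"
      by (subst right_diff_distrib[symmetric]) (simp add: norm_mult norm_divide)
    also have "\<dots> \<le> (2 * (LINT t|lborel. g t)) / (2 * pi)" by (intro divide_right_mono *) auto
    finally show ?thesis by simp
  qed
  then have "cmod (complex_of_real (measure M {a<..b}) - complex_of_real (measure M' {a<..b})) \<le> (LINT t|lborel. g t) / pi"
    by (intro LIMSEQ_le_const2[OF L]) auto
  then show ?thesis by (simp flip: of_real_diff)
qed

lemma std_normal_Ioc_le:
  assumes "h \<ge> 0"
  shows "cdf std_normal_distribution (x + h) - cdf std_normal_distribution x \<le> h"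
proof -
  interpret N: real_distribution std_normal_distribution by (rule real_dist_normal_dist)
  have "normal_density 0 1 y \<le> 1" for y
  proof -
    have "sqrt (2 * pi) \<ge> 1" using pi_gt3 by (simp add: real_le_rsqrt)
    then show ?thesis unfolding std_normal_density_def
      by (intro mult_le_one) (auto simp: divide_le_eq_1)
  qed
  then have "emeasure std_normal_distribution {x<..x+h} \<le> (\<integral>\<^sup>+y. indicator {x<..x+h} y \<partial>lborel)"
    by (subst emeasure_density)
      (auto intro!: nn_integral_mono simp: indicator_def simp del: nn_integral_indicator)
  also have "\<dots> = ennreal h" using assms by simp
  finally have "measure std_normal_distribution {x<..x+h} \<le> h"
    using assms by (simp add: N.emeasure_eq_measure)
  then show ?thesis using N.cdf_diff_eq[of x "x+h"] assms by (cases "h = 0") auto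
qed

text \<open>Smoothing both laws by the same Gaussian multiplies the difference of their
  characteristic functions by an integrable factor. Each law pays a shift by \<open>\<delta>\<close>
  and a tail \<open>\<epsilon>^2 / \<delta>^2\<close>; the two shifts cost
  \<open>2 * \<delta>\<close> because the normal density is at most 1.\<close>

theorem (in real_distribution) cdf_normal_approx:
  assumes D: "D \<ge> 0" "\<And>t. cmod (char M t - of_real (exp (- t\<^sup>2 / 2))) \<le> D * \<bar>t\<bar>"
    and "\<epsilon> > 0" "\<delta> > 0"
  shows "\<bar>cdf M x - cdf std_normal_distribution x\<bar> \<le> 2 * \<delta> + 2 * (\<epsilon>\<^sup>2 / \<delta>\<^sup>2) + D / \<epsilon>"
proof -
  interpret N: real_distribution std_normal_distribution by (rule real_dist_normal_dist)
  interpret A: real_distribution "gauss_smooth \<epsilon> M" by (rule real_distribution_gauss_smooth)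
  interpret B: real_distribution "gauss_smooth \<epsilon> std_normal_distribution" by (rule N.real_distribution_gauss_smooth)
  \<comment> \<open>Written as a multiple of the normal density with standard deviation
    \<open>1 / \<epsilon>\<close>, so that its integral is known.\<close>
  define g where "g = (\<lambda>t. D * (sqrt (2 * pi) / \<epsilon>) * normal_density 0 (1/\<epsilon>) t)"
  have g: "g t = D * exp (- (\<epsilon> * t)\<^sup>2 / 2)" for t
    using \<open>\<epsilon> > 0\<close> by (simp add: g_def normal_density_def real_sqrt_divide power_divide power_mult_distrib field_simps)
  have gi: "(LINT t|lborel. g t) = D * (sqrt (2 * pi) / \<epsilon>)" using \<open>\<epsilon> > 0\<close> by (simp add: g_def)
  have "cmod (char (gauss_smooth \<epsilon> M) t - char (gauss_smooth \<epsilon> std_normal_distribution) t) \<le> \<bar>t\<bar> * g t" for t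
  proof -
    have "char (gauss_smooth \<epsilon> M) t - char (gauss_smooth \<epsilon> std_normal_distribution) t =
      (char M t - of_real (exp (- t\<^sup>2 / 2))) * complex_of_real (exp (- (\<epsilon> * t)\<^sup>2 / 2))"
      by (simp add: char_gauss_smooth N.char_gauss_smooth char_std_normal_distribution left_diff_distrib flip: exp_of_real)
    then have "cmod (char (gauss_smooth \<epsilon> M) t - char (gauss_smooth \<epsilon> std_normal_distribution) t) 
       = cmod (char M t - of_real (exp (- t\<^sup>2 / 2))) * exp (- (\<epsilon> * t)\<^sup>2 / 2)"
      by (simp add: norm_mult)
    also have "\<dots> \<le> (D * \<bar>t\<bar>) * exp (- (\<epsilon> * t)\<^sup>2 / 2)" by (intro mult_right_mono D) auto
    finally show ?thesis by (simp add: g ac_simps)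
  qed
  note cg = this
  have I: "\<bar>measure (gauss_smooth \<epsilon> M) {a<..b} - measure (gauss_smooth \<epsilon> std_normal_distribution) {a<..b}\<bar>
     \<le> D / \<epsilon>" if "a \<le> b" for a b
  proof -
    have "\<bar>measure (gauss_smooth \<epsilon> M) {a<..b} - measure (gauss_smooth \<epsilon> std_normal_distribution) {a<..b}\<bar>
       \<le> (LINT t|lborel. g t) / pi"
      using \<open>\<epsilon> > 0\<close> D(1)
      by (intro measure_Ioc_diff_le that gauss_smooth_atomless N.gauss_smooth_atomless A.real_distribution_axioms
         B.real_distribution_axioms cg) (auto simp: g_def)
    also have "\<dots> = (sqrt (2 * pi) / pi) * (D / \<epsilon>)" by (simp add: gi ac_simps)
    also have "\<dots> \<le> 1 * (D / \<epsilon>)"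
    proof (rule mult_right_mono)
      have "2 * pi \<le> pi\<^sup>2" using pi_gt3 by (simp add: power2_eq_square)
      then have "sqrt (2 * pi) \<le> pi" by (simp add: real_le_lsqrt)
      then show "sqrt (2 * pi) / pi \<le> 1" by simp
    qed (use D \<open>\<epsilon> > 0\<close> in auto)
    finally show ?thesis by simp
  qed
  \<comment> \<open>Half-lines are reached from intervals by letting \<open>a\<close> tend to minus
    infinity.\<close>
  have sm: "\<bar>cdf (gauss_smooth \<epsilon> M) b - cdf (gauss_smooth \<epsilon> std_normal_distribution) b\<bar> \<le> D / \<epsilon>" for b
  proof -
    have "((\<lambda>a. \<bar>(cdf (gauss_smooth \<epsilon> M) b - cdf (gauss_smooth \<epsilon> M) a) -
       (cdf (gauss_smooth \<epsilon> std_normal_distribution) b - cdf (gauss_smooth \<epsilon> std_normal_distribution) a)\<bar>) \<longlongrightarrow>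
       \<bar>(cdf (gauss_smooth \<epsilon> M) b - 0) - (cdf (gauss_smooth \<epsilon> std_normal_distribution) b - 0)\<bar>) at_bot"
      by (intro tendsto_intros A.cdf_lim_at_bot B.cdf_lim_at_bot)
    moreover have "\<forall>\<^sub>F a in at_bot. \<bar>(cdf (gauss_smooth \<epsilon> M) b - cdf (gauss_smooth \<epsilon> M) a) -
       (cdf (gauss_smooth \<epsilon> std_normal_distribution) b - cdf (gauss_smooth \<epsilon> std_normal_distribution) a)\<bar> \<le> D / \<epsilon>"
      unfolding eventually_at_bot_linorder
      by (intro exI[of _ "b - 1"] allI impI) (use I in \<open>simp add: A.cdf_diff_eq B.cdf_diff_eq\<close>)
    ultimately show ?thesis by (intro tendsto_upperbound) auto
  qed
  note c = cdf_gauss_smooth[OF \<open>\<epsilon> > 0\<close> \<open>\<delta> > 0\<close>] N.cdf_gauss_smooth[OF \<open>\<epsilon> > 0\<close> \<open>\<delta> > 0\<close>]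
  have "cdf M x \<le> cdf std_normal_distribution x + (2 * \<delta> + 2 * (\<epsilon>\<^sup>2 / \<delta>\<^sup>2) + D / \<epsilon>)"
    using c(1)[of x] c(4)[of "x + \<delta>"] sm[of "x + \<delta>"] std_normal_Ioc_le[of "2 * \<delta>" x] \<open>\<delta> > 0\<close>
    unfolding abs_le_iff by (simp add: algebra_simps)
  moreover have "cdf std_normal_distribution x \<le> cdf M x + (2 * \<delta> + 2 * (\<epsilon>\<^sup>2 / \<delta>\<^sup>2) + D / \<epsilon>)"
    using c(2)[of "x - \<delta>"] c(3)[of "x - 2 * \<delta>"] sm[of "x - \<delta>"] std_normal_Ioc_le[of "2 * \<delta>" "x - 2 * \<delta>"] \<open>\<delta> > 0\<close>
    unfolding abs_le_iff by (simp add: algebra_simps)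
  ultimately show ?thesis unfolding abs_le_iff by linarith
qed

section \<open>The differential equation of the Gaussian characteristic function\<close>

text \<open>The integrating factor \<open>exp (s^2 / 2)\<close> turns
  \<open>\<phi>' + s * \<phi>\<close> into the derivative of \<open>\<psi>\<close>. The final bound
  is linear in \<open>t\<close>, as required against the \<open>1 / |t|\<close> of the inversion
  kernel.\<close>

lemma char_ode_bound_pos:
  fixes \<phi> \<phi>' :: "real \<Rightarrow> complex"
  assumes \<phi>: "\<And>t. (\<phi> has_vector_derivative \<phi>' t) (at t)" and "\<phi> 0 = 1" and ab: "a \<ge> 0" "b \<ge> 0"
    and B: "\<And>t. cmod (\<phi>' t + t * \<phi> t) \<le> a * \<bar>t\<bar> + b * t\<^sup>2" and "t > 0"
  shows "cmod (\<phi> t - of_real (exp (- t\<^sup>2 / 2))) \<le> (a + b) * t"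
proof -
  define \<psi> where "\<psi> = (\<lambda>s. exp (s\<^sup>2 / 2) *\<^sub>R \<phi> s)"
  have D: "(\<psi> has_vector_derivative exp (s\<^sup>2 / 2) *\<^sub>R (\<phi>' s + s * \<phi> s)) (at s)" for s
    unfolding \<psi>_def
    by (rule derivative_eq_intros \<phi> refl | simp add: scaleR_conv_of_real algebra_simps)+
  \<comment> \<open>Between 0 and \<open>t\<close> the bound \<open>a * s + b * s^2\<close> is at
    most \<open>(a + b * t) * s\<close>, which times the integrating factor is an exact
    derivative.\<close>
  have E: "((\<lambda>s. (a + b * t) * exp (s\<^sup>2 / 2)) has_vector_derivative (a + b * t) * (s * exp (s\<^sup>2 / 2))) (at s)" for s
    unfolding has_real_derivative_iff_has_vector_derivative[symmetric]
    by (rule derivative_eq_intros refl | simp add: algebra_simps)+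
  have "norm (\<psi> t - \<psi> 0) \<le> (a + b * t) * exp (t\<^sup>2 / 2) - (a + b * t) * exp (0\<^sup>2 / 2)"
  proof (rule differentiable_bound_general[OF \<open>t > 0\<close> _ _ D E])
    show "continuous_on {0..t} \<psi>"
      using D has_vector_derivative_continuous continuous_at_imp_continuous_on by blast
    show "continuous_on {0..t} (\<lambda>s. (a + b * t) * exp (s\<^sup>2 / 2))" by (intro continuous_intros) auto
    fix s assume s: "0 < s" "s < t"
    have "norm (exp (s\<^sup>2 / 2) *\<^sub>R (\<phi>' s + s * \<phi> s)) \<le> exp (s\<^sup>2 / 2) * (a * \<bar>s\<bar> + b * s\<^sup>2)"
      using B[of s] by simp
    also have "\<dots> = exp (s\<^sup>2 / 2) * ((a + b * s) * s)" using s by (simp add: power2_eq_square algebra_simps)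
    also have "\<dots> \<le> exp (s\<^sup>2 / 2) * ((a + b * t) * s)"
      using s ab by (intro mult_left_mono mult_right_mono add_left_mono) auto
    finally show "norm (exp (s\<^sup>2 / 2) *\<^sub>R (\<phi>' s + s * \<phi> s)) \<le> (a + b * t) * (s * exp (s\<^sup>2 / 2))"
      by (simp add: ac_simps)
  qed
  then have *: "norm (\<psi> t - 1) \<le> (a + b * t) * (exp (t\<^sup>2 / 2) - 1)"
    using \<open>\<phi> 0 = 1\<close> by (simp add: \<psi>_def algebra_simps)
  have "\<phi> t - of_real (exp (- t\<^sup>2 / 2)) = exp (- t\<^sup>2 / 2) *\<^sub>R (\<psi> t - 1)"
    by (simp add: \<psi>_def scaleR_diff_right exp_minus) (simp add: scaleR_conv_of_real exp_minus flip: exp_of_real)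
  then have "cmod (\<phi> t - of_real (exp (- t\<^sup>2 / 2))) = exp (- t\<^sup>2 / 2) * norm (\<psi> t - 1)" by simp
  also have "\<dots> \<le> exp (- t\<^sup>2 / 2) * ((a + b * t) * (exp (t\<^sup>2 / 2) - 1))" by (intro mult_left_mono *) auto
  also have "\<dots> = (a + b * t) * (1 - exp (- t\<^sup>2 / 2))" by (simp add: exp_minus field_simps)
  also have "\<dots> = a * (1 - exp (- t\<^sup>2 / 2)) + b * t * (1 - exp (- t\<^sup>2 / 2))" by (simp add: algebra_simps)
  \<comment> \<open>One factor \<open>t\<close> must survive: the term with \<open>a\<close> gains
    it from \<open>1 - exp (- t^2 / 2) <= t\<close>, the term with \<open>b\<close> has it
    already.\<close>
  also have "\<dots> \<le> a * t + b * t * 1"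
  proof (intro add_mono mult_left_mono)
    show "1 - exp (- t\<^sup>2 / 2) \<le> t"
    proof (cases "t \<le> 1")
      case True
      then have "t\<^sup>2 \<le> t" using \<open>t > 0\<close> by (simp add: power2_eq_square mult_left_le_one_le)
      then show ?thesis using exp_ge_add_one_self[of "- t\<^sup>2 / 2"] \<open>t > 0\<close> by linarith
    next
      case False then show ?thesis using exp_gt_zero[of "- t\<^sup>2 / 2"] by linarith
    qed
  qed (use ab \<open>t > 0\<close> in auto)
  finally show ?thesis by (simp add: algebra_simps)
qed

lemma char_ode_bound:
  fixes \<phi> \<phi>' :: "real \<Rightarrow> complex"
  assumes \<phi>: "\<And>t. (\<phi> has_vector_derivative \<phi>' t) (at t)" and "\<phi> 0 = 1" and ab: "a \<ge> 0" "b \<ge> 0"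
    and B: "\<And>t. cmod (\<phi>' t + t * \<phi> t) \<le> a * \<bar>t\<bar> + b * t\<^sup>2"
  shows "cmod (\<phi> t - of_real (exp (- t\<^sup>2 / 2))) \<le> (a + b) * \<bar>t\<bar>"
proof -
  consider "t > 0" | "t = 0" | "t < 0" by linarith
  then show ?thesis
  proof cases
    case 1 then show ?thesis using char_ode_bound_pos[OF assms, of t] by simp
  next
    case 2 then show ?thesis using \<open>\<phi> 0 = 1\<close> by simp
  next
    case 3
    have "cmod (\<phi> (- (-t)) - of_real (exp (- (-t)\<^sup>2 / 2))) \<le> (a + b) * (- t)"
    proof (rule char_ode_bound_pos[where t = "-t" and \<phi> = "\<lambda>s. \<phi> (- s)" and \<phi>' = "\<lambda>s. - \<phi>' (- s)"])
      fix s
      show "((\<lambda>s. \<phi> (- s)) has_vector_derivative - \<phi>' (- s)) (at s)"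
      proof -
        have "(uminus has_vector_derivative (-1::real)) (at s)"
          unfolding has_real_derivative_iff_has_vector_derivative[symmetric]
          by (auto intro!: derivative_eq_intros)
        from vector_diff_chain_at[OF this \<phi>] show ?thesis by (simp add: o_def)
      qed
      have "cmod (- \<phi>' (- s) + s * \<phi> (- s)) = cmod (- (\<phi>' (- s) + complex_of_real (- s) * \<phi> (- s)))" 
        by (simp add: algebra_simps)
      then show "cmod (- \<phi>' (- s) + s * \<phi> (- s)) \<le> a * \<bar>s\<bar> + b * s\<^sup>2"
        using B[of "-s"] unfolding norm_minus_cancel by simp
    qed (use 3 ab \<open>\<phi> 0 = 1\<close> in auto)
    then show ?thesis using 3 by simp
  qed
qed

section \<open>Uniform colourings and the rank of a set of edges\<close>

locale colouring =
  fixes V :: "'v set" and c :: nat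
  assumes finite_V: "finite V" and c_ge_2: "c \<ge> 2"
begin

text \<open>The value 0 outside \<open>V\<close> makes this a finite set on which the law of the
  colours is uniform, so that all expectations become the finite averages
  \<open>avg\<close>.\<close>

definition colourings :: "('v \<Rightarrow> nat) set" where
  "colourings = PiE_dflt V 0 (\<lambda>_. {1..c})"

text \<open>Vector-valued, because characteristic functions are averages of complex
  exponentials.\<close>

definition avg :: "(('v \<Rightarrow> nat) \<Rightarrow> 'b) \<Rightarrow> 'b::real_vector" where
  "avg f = (1 / real (card colourings)) *\<^sub>R (\<Sum>X\<in>colourings. f X)"

lemma finite_colourings [simp]: "finite colourings"
  unfolding colourings_def using finite_V by (intro finite_PiE_dflt) auto

lemma colourings_D: "X \<in> colourings \<Longrightarrow> v \<in> V \<Longrightarrow> X v \<in> {1..c}"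
  unfolding colourings_def PiE_dflt_def by auto

lemma colourings_upd: "X \<in> colourings \<Longrightarrow> v \<in> V \<Longrightarrow> a \<in> {1..c} \<Longrightarrow> X(v := a) \<in> colourings"
  unfolding colourings_def PiE_dflt_def by auto

lemma colourings_nonempty: "colourings \<noteq> {}"
  unfolding colourings_def using c_ge_2 by (auto simp: finite_V)

lemma avg_add: "avg (\<lambda>X. f X + g X) = avg f + avg g"
  by (simp add: avg_def sum.distrib scaleR_add_right)

lemma avg_diff: "avg (\<lambda>X. f X - g X) = avg f - avg g"
  by (simp add: avg_def sum_subtractf scaleR_diff_right)

lemma avg_sum: "avg (\<lambda>X. \<Sum>i\<in>I. f i X) = (\<Sum>i\<in>I. avg (f i))"
  unfolding avg_def by (subst sum.swap) (simp add: scaleR_sum_right)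

lemma avg_const [simp]: "avg (\<lambda>X. k) = k"
  using colourings_nonempty by (simp add: avg_def sum_constant_scaleR)

lemma avg_scaleR: "avg (\<lambda>X. k *\<^sub>R f X) = k *\<^sub>R avg f"
  by (simp add: avg_def scaleR_sum_right ac_simps)

lemma avg_cmult: "avg (\<lambda>X. k * f X) = k * (avg f :: real)"
  using avg_scaleR[of k f] by simp

lemma avg_cmult_right: "avg (\<lambda>X. f X * k) = (avg f :: real) * k"
  using avg_cmult[of k f] by (simp add: ac_simps)

lemma avg_cdiv: "avg (\<lambda>X. f X / k) = (avg f :: real) / k"
  using avg_cmult[of "1/k" f] by simp

lemma avg_cong: "(\<And>X. X \<in> colourings \<Longrightarrow> f X = g X) \<Longrightarrow> avg f = avg g"
  unfolding avg_def by (metis sum.cong)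

lemma avg_mono: 
  fixes f g :: "_ \<Rightarrow> real"
  shows "(\<And>X. X \<in> colourings \<Longrightarrow> f X \<le> g X) \<Longrightarrow> avg f \<le> avg g"
  by (auto simp: avg_def intro!: divide_right_mono sum_mono)

lemma avg_nonneg: "(\<And>X. X \<in> colourings \<Longrightarrow> (0::real) \<le> f X) \<Longrightarrow> 0 \<le> avg f"
  using avg_mono[of "\<lambda>_. 0" f] by simp

lemma norm_avg_le: "norm (avg f :: 'b::real_normed_vector) \<le> avg (\<lambda>X. norm (f X))"
  by (auto simp: avg_def intro!: divide_right_mono norm_sum)

lemma avg_square_le: "(avg (\<lambda>X. \<bar>f X * g X\<bar>))\<^sup>2 \<le> avg (\<lambda>X. (f X)\<^sup>2) * avg (\<lambda>X. (g X :: real)\<^sup>2)"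
proof -
  have "(\<Sum>X\<in>colourings. \<bar>f X\<bar> * \<bar>g X\<bar>)\<^sup>2 \<le> (\<Sum>X\<in>colourings. \<bar>f X\<bar>\<^sup>2) * (\<Sum>X\<in>colourings. \<bar>g X\<bar>\<^sup>2)"
    by (rule Cauchy_Schwarz_ineq_sum)
  then show ?thesis
    by (auto simp: avg_def abs_mult power_divide power2_eq_square[of "real (card colourings)"] 
       intro!: divide_right_mono)
qed

text \<open>Exchanging the old colour of \<open>v\<close> with the fresh one is an involution on
  pairs of a colouring and a colour.\<close>

lemma avg_resample:
  fixes f :: "_ \<Rightarrow> 'b::real_vector"
  assumes "v \<in> V"
  shows "avg (\<lambda>X. (1 / c) *\<^sub>R (\<Sum>a\<in>{1..c}. f (X(v := a)))) = avg f"
proof -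
  have "(\<Sum>X\<in>colourings. \<Sum>a\<in>{1..c}. f (X(v := a))) = (\<Sum>(X, a)\<in>colourings \<times> {1..c}. f (X(v := a)))"
    by (simp add: sum.cartesian_product)
  also have "\<dots> = (\<Sum>(X, a)\<in>colourings \<times> {1..c}. f X)"
    using assms colourings_D colourings_upd
    by (intro sum.reindex_bij_witness[where i="\<lambda>(X, a). (X(v := a), X v)" and j="\<lambda>(X, a). (X(v := a), X v)"])
       (force split: prod.splits)+
  also have "\<dots> = real c *\<^sub>R (\<Sum>X\<in>colourings. f X)"
    by (simp add: sum.cartesian_product[symmetric] sum_constant_scaleR scaleR_sum_right)
  finally show ?thesis using c_ge_2 by (simp add: avg_def scaleR_sum_right[symmetric])
qed

text \<open>Integrating out the colour of a single vertex; the martingale orthogonality relations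
  and the summation by parts below rest on this.\<close>

lemma avg_zero:
  fixes f :: "_ \<Rightarrow> 'b::real_vector"
  assumes "v \<in> V" and "\<And>X. X \<in> colourings \<Longrightarrow> (\<Sum>a\<in>{1..c}. f (X(v := a))) = 0"
  shows "avg f = 0"
proof -
  have "avg f = avg (\<lambda>X. (1 / c) *\<^sub>R (\<Sum>a\<in>{1..c}. f (X(v := a))))" using avg_resample[OF assms(1), of f] by simp
  also have "\<dots> = avg (\<lambda>X. 0)" by (intro avg_cong) (use assms(2) in simp)
  finally show ?thesis by simp
qed

definition Mon :: "('v \<times> 'v) set \<Rightarrow> ('v \<Rightarrow> nat) \<Rightarrow> bool" where
  "Mon A X \<longleftrightarrow> (\<forall>(u, w)\<in>A. X u = X w)"

definition prb :: "('v \<times> 'v) set \<Rightarrow> real" where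
  "prb A = avg (\<lambda>X. of_bool (Mon A X))"

text \<open>Connectedness in the graph with edge set \<open>A\<close>: edges are stored as ordered
  pairs, hence the symmetrisation.\<close>

abbreviation con :: "('v \<times> 'v) set \<Rightarrow> ('v \<times> 'v) set" where
  "con A \<equiv> (A \<union> A\<inverse>)\<^sup>*"

lemma Mon_Un: "Mon (A \<union> B) X \<longleftrightarrow> Mon A X \<and> Mon B X"
  by (auto simp: Mon_def)

lemma Mon_con: "(u, w) \<in> con A \<Longrightarrow> Mon A X \<Longrightarrow> X u = X w"
  by (induction rule: rtrancl_induct) (auto simp: Mon_def)

lemma con_sym: "(u, w) \<in> con A \<Longrightarrow> (w, u) \<in> con A"
  by (metis converse_Un converse_converse rtrancl_converseD sup_commute)

lemma con_mono: "A \<subseteq> B \<Longrightarrow> con A \<subseteq> con B"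
  by (intro rtrancl_mono) auto

lemma prb_insert_con: "(u, w) \<in> con A \<Longrightarrow> prb (insert (u, w) A) = prb A"
  unfolding prb_def using Mon_con[of u w A] by (intro avg_cong) (auto simp: Mon_def)

lemma mod_add_left_inj:
  fixes a b s :: nat
  assumes "(s + a) mod c = (s + b) mod c" "a < c" "b < c"
  shows "a = b"
proof -
  have *: "a = b" if "(s + a) mod c = (s + b) mod c" "a < c" "b < c" "a \<le> b" for a b :: nat
  proof -
    have "c dvd (s + b) - (s + a)" using that by (subst mod_eq_dvd_iff_nat[symmetric]) auto
    then have "c dvd b - a" by simp
    then show ?thesis using that by (auto dest!: dvd_imp_le)
  qed
  show ?thesis
  proof (cases "a \<le> b")
    case True then show ?thesis by (intro *[OF assms])
  next
    case False then show ?thesis using *[OF assms(1)[symmetric] assms(3,2)] by simp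
  qed
qed

lemma bij_rotate: "bij_betw (\<lambda>s. (x - 1 + s) mod c + 1) {..<c} {1..c}"
proof -
  have inj: "inj_on (\<lambda>s. (x - 1 + s) mod c + 1) {..<c}"
    by (rule inj_onI, rule mod_add_left_inj[of "x - 1"]) auto
  have "(\<lambda>s. (x - 1 + s) mod c + 1) ` {..<c} \<subseteq> {1..c}"
    using c_ge_2 by (auto simp: Suc_le_eq)
  then have "(\<lambda>s. (x - 1 + s) mod c + 1) ` {..<c} = {1..c}"
    using card_image[OF inj] by (intro card_subset_eq) auto
  with inj show ?thesis by (simp add: bij_betw_def)
qed

lemma rotate_eq_iff:
  fixes x y :: nat
  assumes "x \<in> {1..c}" "y \<in> {1..c}"
  shows "(x - 1 + s) mod c + 1 = (y - 1 + s) mod c + 1 \<longleftrightarrow> x = y"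
proof
  assume "(x - 1 + s) mod c + 1 = (y - 1 + s) mod c + 1"
  then have "(s + (x - 1)) mod c = (s + (y - 1)) mod c"
    unfolding add.commute[of s] add_right_cancel .
  then have "x - 1 = y - 1" by (rule mod_add_left_inj) (use assms in auto)
  moreover have "x \<ge> 1" "y \<ge> 1" using assms by auto
  ultimately show "x = y" by linarith
qed simp

text \<open>Rotating the colours of the component of \<open>w\<close> preserves the law and the event \<open>Mon A\<close>, and
  makes the colour of \<open>w\<close> uniform relative to the colour of \<open>u\<close>.\<close>

lemma prb_insert_new:
  assumes "(u, w) \<notin> con A" and "u \<in> V" "w \<in> V" and A: "A \<subseteq> V \<times> V"
  shows "prb (insert (u, w) A) = prb A / c"
proof -
  define C where "C = {x\<in>V. (w, x) \<in> con A}"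
  define \<rho> where "\<rho> = (\<lambda>s (X :: 'v \<Rightarrow> nat) x. if x \<in> C then (X x - 1 + s) mod c + 1 else X x)"
  have wC: "w \<in> C" and uC: "u \<notin> C" using assms con_sym[of w u A] by (auto simp: C_def)
  have "C \<subseteq> V" by (auto simp: C_def)
  have \<rho>_in: "\<rho> s X \<in> colourings" if "X \<in> colourings" for s X
    using that \<open>C \<subseteq> V\<close> c_ge_2 unfolding colourings_def PiE_dflt_def \<rho>_def by (auto simp: Suc_le_eq)
  have inj: "inj_on (\<rho> s) colourings" for s
  proof (rule inj_onI)
    fix X Y assume X: "X \<in> colourings" and Y: "Y \<in> colourings" and e: "\<rho> s X = \<rho> s Y"
    show "X = Y"
    proof
      fix x
      show "X x = Y x"
      proof (cases "x \<in> C")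
        case True
        then have "x \<in> V" using \<open>C \<subseteq> V\<close> by auto
        then show ?thesis
          using rotate_eq_iff[OF colourings_D[OF X] colourings_D[OF Y], of x x s] fun_cong[OF e, of x] True
          by (simp add: \<rho>_def)
      next
        case False then show ?thesis using fun_cong[OF e, of x] by (simp add: \<rho>_def)
      qed
    qed
  qed
  have im: "\<rho> s ` colourings = colourings" for s
    using \<rho>_in inj by (intro endo_inj_surj) auto
  have avg_rot: "avg (\<lambda>X. f (\<rho> s X)) = avg f" for f :: "_ \<Rightarrow> real" and s
  proof -
    have "(\<Sum>X\<in>colourings. f X) = (\<Sum>X\<in>\<rho> s ` colourings. f X)" unfolding im ..
    also have "\<dots> = (\<Sum>X\<in>colourings. f (\<rho> s X))" by (subst sum.reindex[OF inj]) simp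
    finally show ?thesis by (simp add: avg_def)
  qed
  have Mon_rot: "Mon A (\<rho> s X) \<longleftrightarrow> Mon A X" if X: "X \<in> colourings" for s X
  proof -
    have "\<rho> s X x = \<rho> s X y \<longleftrightarrow> X x = X y" if xy: "(x, y) \<in> A" for x y
    proof -
      have V: "x \<in> V" "y \<in> V" using xy A by auto
      have "x \<in> C \<longleftrightarrow> y \<in> C"
        using V xy by (auto simp: C_def intro: rtrancl_into_rtrancl)
      moreover have "(X x - 1 + s) mod c + 1 = (X y - 1 + s) mod c + 1 \<longleftrightarrow> X x = X y"
        using V by (intro rotate_eq_iff colourings_D[OF X])
      ultimately show ?thesis by (simp add: \<rho>_def)
    qed
    then show ?thesis unfolding Mon_def by auto
  qed
  \<comment> \<open>Exactly one of the \<open>c\<close> rotations gives \<open>w\<close> the colour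
    of \<open>u\<close>.\<close>
  have one: "(\<Sum>s<c. of_bool (X u = (X w - 1 + s) mod c + 1)) = (1::real)" if X: "X \<in> colourings" for X
  proof -
    have "(\<Sum>s<c. of_bool (X u = (X w - 1 + s) mod c + 1)) = (\<Sum>k\<in>{1..c}. of_bool (X u = k) :: real)"
      by (rule sum.reindex_bij_betw[OF bij_rotate])
    then show ?thesis using colourings_D[OF X \<open>u \<in> V\<close>] by (simp add: of_bool_def)
  qed
  have "real c * prb (insert (u, w) A) = (\<Sum>s<c. avg (\<lambda>X. of_bool (Mon (insert (u, w) A) (\<rho> s X))))"
    using avg_rot[of "\<lambda>X. of_bool (Mon (insert (u, w) A) X)"] by (simp add: prb_def)
  also have "\<dots> = avg (\<lambda>X. \<Sum>s<c. of_bool (Mon (insert (u, w) A) (\<rho> s X)))" by (rule avg_sum[symmetric])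
  also have "\<dots> = avg (\<lambda>X. of_bool (Mon A X))"
  proof (rule avg_cong)
    fix X assume X: "X \<in> colourings"
    have "(\<Sum>s<c. of_bool (Mon (insert (u, w) A) (\<rho> s X)) :: real) 
       = (\<Sum>s<c. of_bool (Mon A X) * of_bool (X u = (X w - 1 + s) mod c + 1))"
      using Mon_rot[OF X] wC uC by (intro sum.cong) (auto simp: Mon_def \<rho>_def)
    also have "\<dots> = of_bool (Mon A X)" by (simp only: sum_distrib_left[symmetric] one[OF X] mult_1_right)
    finally show "(\<Sum>s<c. of_bool (Mon (insert (u, w) A) (\<rho> s X)) :: real) = of_bool (Mon A X)" .
  qed
  also have "\<dots> = prb A" by (simp add: prb_def)
  finally show ?thesis using c_ge_2 by (simp add: field_simps)
qed

lemma prb_empty [simp]: "prb {} = 1"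
  by (simp add: prb_def Mon_def)

text \<open>This is the rank of the graphic matroid, the size of a spanning forest of
  \<open>A\<close>. Reading it off from the probability spares the theory of forests: inserting one
  edge at a time yields the rank axioms.\<close>

definition rk :: "('v \<times> 'v) set \<Rightarrow> nat" where
  "rk A = (THE k. prb A = (1 / c) ^ k)"

lemma inverse_c_power_inject: "(1 / real c) ^ k = (1 / real c) ^ l \<longleftrightarrow> k = l"
  using c_ge_2 by (intro power_inject_exp') auto

lemma rk_unique: "prb A = (1 / c) ^ k \<Longrightarrow> rk A = k"
  unfolding rk_def by (simp only: inverse_c_power_inject) simp

lemma prb_eq_rk:
  assumes "A \<subseteq> V \<times> V"
  shows "prb A = (1 / c) ^ rk A"
proof -
  have "finite A" using assms finite_V finite_subset by blast
  then have "\<exists>k. prb A = (1 / c) ^ k" using assms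
  proof induction
    case empty then show ?case by (intro exI[of _ 0]) simp
  next
    case (insert e A)
    have "\<exists>k. prb A = (1 / c) ^ k" by (rule insert.IH) (use insert.prems in simp)
    then obtain k where k: "prb A = (1 / c) ^ k" ..
    obtain u w where e: "e = (u, w)" by (cases e)
    show ?case
    proof (cases "e \<in> con A")
      case True
      then show ?thesis using k prb_insert_con[of u w A] unfolding e by auto
    next
      case False
      then have "prb (insert e A) = (1 / c) ^ Suc k"
        using k prb_insert_new[of u w A] insert.prems unfolding e by simp
      then show ?thesis by blast
    qed
  qed
  then show ?thesis using rk_unique by metis
qed

lemma rk_empty [simp]: "rk {} = 0"
  by (rule rk_unique) simp

lemma rk_insert:
  assumes "e \<in> V \<times> V" "A \<subseteq> V \<times> V"
  shows "rk (insert e A) = rk A + (if e \<in> con A then 0 else 1)"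
proof (rule rk_unique)
  obtain u w where e: "e = (u, w)" by (cases e)
  show "prb (insert e A) = (1 / c) ^ (rk A + (if e \<in> con A then 0 else 1))"
    using assms prb_insert_con[of u w A] prb_insert_new[of u w A] prb_eq_rk[OF assms(2)] unfolding e by simp
qed

text \<open>Diminishing returns: an edge whose ends are connected over \<open>A \<union> C\<close>
  has connected ends over the larger \<open>B \<union> C\<close>, so each inserted edge raises the
  rank over \<open>B\<close> at most as much as over \<open>A\<close>.\<close>

lemma rk_submod:
  assumes "A \<subseteq> B" "B \<subseteq> V \<times> V" "C \<subseteq> V \<times> V"
  shows "rk (B \<union> C) + rk A \<le> rk (A \<union> C) + rk B"
proof -
  have "finite C" using assms finite_V finite_subset by blast
  then show ?thesis using assms(3)
  proof induction
    case (insert e C)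
    have "con (A \<union> C) \<subseteq> con (B \<union> C)" using assms by (intro con_mono) auto
    then show ?case using insert assms(1,2) rk_insert[of e "A \<union> C"] rk_insert[of e "B \<union> C"] by auto
  qed simp
qed

lemma rk_mono:
  assumes "A \<subseteq> B" "B \<subseteq> V \<times> V"
  shows "rk A \<le> rk B"
proof -
  have "finite B" using assms finite_V finite_subset by blast
  then have "rk A \<le> rk (A \<union> B)" using assms(2)
  proof induction
    case (insert e B)
    then show ?case using rk_insert[of e "A \<union> B"] assms by auto
  qed simp
  then show ?thesis using assms by (simp add: Un_absorb1)
qed

lemma rk_Un_le: "A \<subseteq> V \<times> V \<Longrightarrow> B \<subseteq> V \<times> V \<Longrightarrow> rk (A \<union> B) \<le> rk A + rk B"
  using rk_submod[of "{}" A B] by simp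

lemma rk_Un_Int_le:
  assumes "A \<subseteq> V \<times> V" "B \<subseteq> V \<times> V" "C \<subseteq> A" "C \<subseteq> B"
  shows "rk (A \<union> B) + rk C \<le> rk A + rk B"
  using rk_submod[of C A B] assms by (simp add: Un_absorb1 add.commute)

text \<open>By submodularity this additivity is inherited by subsets, and so it yields genuine
  independence of the colour coincidences on both sides (\<open>avg_indep\<close>).\<close>

definition indep :: "('v \<times> 'v) set \<Rightarrow> ('v \<times> 'v) set \<Rightarrow> bool" where
  "indep A B \<longleftrightarrow> rk (A \<union> B) = rk A + rk B"

lemma indep_sym: "indep A B \<longleftrightarrow> indep B A"
  by (simp add: indep_def Un_commute add.commute)

text \<open>By submodularity, a rank deficit of \<open>A \<union> B\<close> against the sum of the
  ranks would persist in \<open>U \<union> B\<close>.\<close>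

lemma indep_subset_left:
  assumes "indep U B" "A \<subseteq> U" "U \<subseteq> V \<times> V" "B \<subseteq> V \<times> V"
  shows "indep A B"
proof -
  have "rk (A \<union> B \<union> U) + rk A \<le> rk (A \<union> U) + rk (A \<union> B)"
    using rk_submod[of A "A \<union> B" U] assms by auto
  moreover have "A \<union> B \<union> U = U \<union> B" "A \<union> U = U" using assms by auto
  moreover have "rk (A \<union> B) \<le> rk A + rk B" using assms by (intro rk_Un_le) auto
  ultimately show ?thesis using assms(1) by (simp add: indep_def)
qed

lemma indep_subset:
  assumes "indep U W" "A \<subseteq> U" "B \<subseteq> W" "U \<subseteq> V \<times> V" "W \<subseteq> V \<times> V"
  shows "indep A B"
  using assms indep_subset_left[of U W A] indep_subset_left[of W A B] indep_sym by (metis subset_trans)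

text \<open>Linear combinations of indicators of monochromatic edge sets inside \<open>U\<close>.
  Averages are linear, so independence proved for these indicators passes to everything in the
  span.\<close>

inductive Span :: "('v \<times> 'v) set \<Rightarrow> (('v \<Rightarrow> nat) \<Rightarrow> real) \<Rightarrow> bool" for U where
  Span_Mon: "A \<subseteq> U \<Longrightarrow> Span U (\<lambda>X. of_bool (Mon A X))"
| Span_cmult: "Span U f \<Longrightarrow> Span U (\<lambda>X. k * f X)"
| Span_add: "Span U f \<Longrightarrow> Span U g \<Longrightarrow> Span U (\<lambda>X. f X + g X)"

lemma Span_mono: "Span U f \<Longrightarrow> U \<subseteq> W \<Longrightarrow> Span W f"
  by (induction rule: Span.induct) (auto intro: Span.intros)

lemma Span_const: "Span U (\<lambda>X. k)"
  using Span_cmult[OF Span_Mon[of "{}" U], of k] by (simp add: Mon_def)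

lemma Span_diff: "Span U f \<Longrightarrow> Span U g \<Longrightarrow> Span U (\<lambda>X. f X - g X)"
  using Span_add[of U f "\<lambda>X. (-1) * g X"] Span_cmult[of U g "-1"] by simp

lemma Span_mult: 
  assumes "Span U f" "Span W g"
  shows "Span (U \<union> W) (\<lambda>X. f X * g X)"
  using assms(1)
proof induction
  case (Span_Mon A)
  show ?case using assms(2)
  proof induction
    case (Span_Mon B)
    have "Span (U \<union> W) (\<lambda>X. of_bool (Mon (A \<union> B) X))"
      using \<open>A \<subseteq> U\<close> Span_Mon by (intro Span.Span_Mon) auto
    then show ?case by (simp add: Mon_Un of_bool_conj)
  next
    case (Span_cmult f k)
    then show ?case using Span.Span_cmult[of "U \<union> W" _ k] by (simp add: ac_simps)
  next
    case (Span_add f g)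
    then show ?case using Span.Span_add by (simp add: algebra_simps)
  qed
next
  case (Span_cmult f k)
  then show ?case using Span.Span_cmult[of "U \<union> W" _ k] by (simp add: ac_simps)
next
  case (Span_add f g)
  then show ?case using Span.Span_add by (simp add: algebra_simps)
qed

lemma avg_indep:
  assumes "Span U f" "Span W g" and I: "indep U W" "U \<subseteq> V \<times> V" "W \<subseteq> V \<times> V"
  shows "avg (\<lambda>X. f X * g X) = avg f * avg g"
  using assms(1)
proof induction
  case (Span_Mon A)
  show ?case using assms(2)
  proof induction
    case (Span_Mon B)
    have "indep A B" using indep_subset[OF I(1) \<open>A \<subseteq> U\<close> Span_Mon I(2,3)] .
    moreover have "A \<subseteq> V \<times> V" "B \<subseteq> V \<times> V" using \<open>A \<subseteq> U\<close> Span_Mon I by auto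
    ultimately have "prb (A \<union> B) = prb A * prb B"
      by (simp add: prb_eq_rk indep_def power_add)
    then show ?case by (simp add: prb_def Mon_Un of_bool_conj)
  next
    case (Span_cmult f k)
    then show ?case by (simp add: mult.left_commute[of _ k] avg_cmult)
  next
    case (Span_add f g)
    then show ?case by (simp add: distrib_left avg_add)
  qed
next
  case (Span_cmult f k)
  then show ?case by (simp add: mult.assoc avg_cmult)
next
  case (Span_add f g)
  then show ?case by (simp add: distrib_right avg_add)
qed

text \<open>Edge sets that meet in at most one vertex close no new cycle together: the map
  \<open>\<rho>\<close> collapses \<open>S\<close> to \<open>v\<close>, fixes \<open>T\<close>, and
  sends a path in \<open>A \<union> B\<close> to a path in \<open>B\<close>. So no edge of
  \<open>B\<close> becomes redundant through \<open>A\<close>.\<close>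

lemma indep_meet_le_1:
  assumes "finite B" and V: "A \<subseteq> V \<times> V" "B \<subseteq> V \<times> V" and A: "A \<subseteq> S \<times> S" and B: "B \<subseteq> T \<times> T" and v: "S \<inter> T \<subseteq> {v}"
  shows "indep A B"
  using assms(1) V(2) B
proof (induction B)
  case (insert e B)
  define \<rho> where "\<rho> = (\<lambda>x. if x \<in> T then x else v)"
  have path: "(\<rho> x, \<rho> y) \<in> con B" if "(x, y) \<in> con (A \<union> B)" for x y
    using that
  proof induction
    case (step y z)
    have "(\<rho> y, \<rho> z) \<in> con B"
    proof (cases "(y, z) \<in> A \<union> A\<inverse>")
      case True
      then have "\<rho> y = v" "\<rho> z = v" using A v by (auto simp: \<rho>_def)
      then show ?thesis by simp
    next
      case False
      then have "(y, z) \<in> B \<union> B\<inverse>" using step by auto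
      moreover then have "y \<in> T" "z \<in> T" using insert.prems by auto
      ultimately show ?thesis by (auto simp: \<rho>_def)
    qed
    then show ?case using step.IH by (rule rtrancl_trans[rotated])
  qed simp
  have eT: "fst e \<in> T" "snd e \<in> T" using insert.prems by auto
  have "e \<in> con (A \<union> B) \<longleftrightarrow> e \<in> con B"
    using path[of "fst e" "snd e"] con_mono[of B "A \<union> B"] eT by (auto simp: \<rho>_def)
  moreover have "indep A B" using insert by auto
  ultimately show ?case
    using rk_insert[of e "A \<union> B"] rk_insert[of e B] insert.prems V(1) by (auto simp: indep_def)
qed (simp add: indep_def)

end

section \<open>Fourth cumulants\<close>

text \<open>Four events of probability \<open>c^-2\<close> have joint moments \<open>c^-(2|S| - d(S))\<close>; the exponents below are
  the values of the supermodular function \<open>d\<close> on pairs, triples and the whole quadruple. For \<open>c \<ge> 7\<close>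
  the first term dominates the seven negative ones, each of which is at most \<open>C ^ (m - 1)\<close>; for
  \<open>c = 5, 6\<close> supermodularity excludes that too many of them are of that size at once.\<close>

lemma cumulant_exponents_pos:
  fixes C :: int and d12 d13 d14 d23 d24 d34 t1 t2 t3 t4 m :: nat
  assumes C: "C \<ge> 5"
    and d: "d12 \<le> 2" "d13 \<le> 2" "d14 \<le> 2" "d23 \<le> 2" "d24 \<le> 2" "d34 \<le> 2"
    and t: "t1 + 1 \<le> m" "t2 + 1 \<le> m" "t3 + 1 \<le> m" "t4 + 1 \<le> m"
    and dd: "d12 + d34 + 1 \<le> m" "d13 + d24 + 1 \<le> m" "d14 + d23 + 1 \<le> m"
    and tt: "t1 + t2 \<le> m + d34" "t1 + t3 \<le> m + d24" "t1 + t4 \<le> m + d23"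
      "t2 + t3 \<le> m + d14" "t2 + t4 \<le> m + d13" "t3 + t4 \<le> m + d12"
  shows "C ^ m - (C ^ t1 + C ^ t2 + C ^ t3 + C ^ t4) - (C ^ (d12 + d34) + C ^ (d13 + d24) + C ^ (d14 + d23))
    + 2 * (C ^ d12 + C ^ d13 + C ^ d14 + C ^ d23 + C ^ d24 + C ^ d34) - 6 \<ge> 1"
proof -
  \<comment> \<open>One pairing of the quadruple: the product of its two pair moments, less the
    linear terms of the same two pairs. The three pairings use up all six pairs.\<close>
  define f where "f = (\<lambda>x y. C ^ (x + y) - 2 * C ^ x - 2 * C ^ y)"
  let ?F = "C ^ m - (C ^ t1 + C ^ t2 + C ^ t3 + C ^ t4) - (f d12 d34 + f d13 d24 + f d14 d23) - 6"
  have m1: "m \<ge> 1" using t by simp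
  have pw: "C ^ s \<le> C ^ k" if "s \<le> k" for s k using that C by (intro power_increasing) auto
  have T: "C ^ t1 \<le> C ^ (m - 1)" "C ^ t2 \<le> C ^ (m - 1)" "C ^ t3 \<le> C ^ (m - 1)" "C ^ t4 \<le> C ^ (m - 1)"
    using t by (auto intro!: pw)
  have Cm: "C ^ m = C * C ^ (m - 1)" using m1 by (cases m) auto
  have v: "x = 0 \<or> x = 1 \<or> x = 2" if "x \<le> 2" for x :: nat using that by linarith
  have fB: "f d12 d34 + f d13 d24 + f d14 d23 \<le> 3 * B"
    if "\<And>x y. x \<le> 2 \<Longrightarrow> y \<le> 2 \<Longrightarrow> x + y + 1 \<le> m \<Longrightarrow> f x y \<le> B" for B
    using that[of d12 d34] that[of d13 d24] that[of d14 d23] d dd by linarith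
  have "?F \<ge> 1"
  proof -
    consider "C \<ge> 7" | "C = 5 \<or> C = 6" using C by linarith
    then show ?thesis
    proof cases
      case 1
      have f: "f x y \<le> C ^ (m - 1) - 4" if "x + y + 1 \<le> m" for x y
      proof -
        have "C ^ (x + y) \<le> C ^ (m - 1)" using that by (intro pw) auto
        moreover have "C ^ x \<ge> 1" "C ^ y \<ge> 1" using C by auto
        ultimately show ?thesis by (simp add: f_def)
      qed
      have "7 * C ^ (m - 1) \<le> C * C ^ (m - 1)" using 1 by (intro mult_right_mono) auto
      then show ?thesis using T f[OF dd(1)] f[OF dd(2)] f[OF dd(3)] Cm by linarith
    next
      case C56: 2
      have f4: "f x y \<le> C ^ 4 - 4 * C ^ 2" if "x \<le> 2" "y \<le> 2" for x y
        using v[OF that(1)] v[OF that(2)] C56 by (auto simp: f_def)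
      consider "m \<le> 2" | "m = 3" | "m = 4" | "m = 5" | "m \<ge> 6" by linarith
      then show ?thesis
      proof cases
        case 1
        have "f x y \<le> -3" if "x \<le> 2" "y \<le> 2" "x + y + 1 \<le> m" for x y
          using v[OF that(1)] v[OF that(2)] that(3) 1 C56 by (auto simp: f_def)
        moreover have "m = 1 \<or> m = 2" using 1 m1 by linarith
        ultimately show ?thesis using fB[of "-3"] T C56 by auto
      next
        case 2
        \<comment> \<open>The extreme case is four triangles on a common edge with distinct third
          vertices. The value is \<open>(C - 1) * (C^2 - 6 * C + 6)\<close>, which is 4 at
          \<open>C = 5\<close> and negative at \<open>C = 4\<close>.\<close>
        have "f x y \<le> C ^ 2 - 4 * C" if "x \<le> 2" "y \<le> 2" "x + y + 1 \<le> m" for x y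
          using v[OF that(1)] v[OF that(2)] that(3) 2 C56 by (auto simp: f_def)
        from fB[OF this] T show ?thesis using C56 unfolding 2 by auto
      next
        case 3
        have f: "f x y \<le> C ^ 3 - 2 * C ^ 2 - 2 * C" if "x \<le> 2" "y \<le> 2" "x + y + 1 \<le> m" for x y
          using v[OF that(1)] v[OF that(2)] that(3) 3 C56 by (auto simp: f_def)
        \<comment> \<open>Four triples of exponent 3 would force exponent 2 on every pair, against
          the bounds on the pairings.\<close>
        have "t1 \<le> 2 \<or> t2 \<le> 2 \<or> t3 \<le> 2 \<or> t4 \<le> 2" using tt dd 3 by linarith
        then have "C ^ t1 \<le> C ^ 2 \<or> C ^ t2 \<le> C ^ 2 \<or> C ^ t3 \<le> C ^ 2 \<or> C ^ t4 \<le> C ^ 2" by (auto intro: pw)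
        with fB[OF f] T show ?thesis using C56 unfolding 3 by auto
      next
        case 4
        \<comment> \<open>As \<open>t1 + t2 <= m + d34 <= 7\<close>, the two are not both 4;
          likewise for \<open>t3\<close> and \<open>t4\<close>.\<close>
        have "t1 \<le> 3 \<or> t2 \<le> 3" "t3 \<le> 3 \<or> t4 \<le> 3" using tt d 4 by linarith+
        then have "C ^ t1 \<le> C ^ 3 \<or> C ^ t2 \<le> C ^ 3" "C ^ t3 \<le> C ^ 3 \<or> C ^ t4 \<le> C ^ 3" by (auto intro: pw)
        with fB[OF f4] T show ?thesis using C56 unfolding 4 by auto
      next
        case 5
        \<comment> \<open>The pairings are bounded independently of \<open>m\<close>. Only the four
          triples compete with \<open>C ^ m\<close>, and the spare \<open>C ^ (m - 1)\<close> covers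
          the rest.\<close>
        have "C ^ 5 \<le> C ^ (m - 1)" using 5 by (intro pw) auto
        moreover have "5 * C ^ (m - 1) \<le> C * C ^ (m - 1)" using C by (intro mult_right_mono) auto
        moreover have "3 * (C ^ 4 - 4 * C ^ 2) + 7 \<le> C ^ 5" using C56 by auto
        ultimately show ?thesis using fB[OF f4] T Cm by linarith
      qed
    qed
  qed
  then show ?thesis by (simp add: f_def)
qed

lemma cumulant_scale:
  fixes q :: real
  shows "q ^ 8 * M - q\<^sup>2 * (q ^ 6 * t4 + q ^ 6 * t3 + q ^ 6 * t2 + q ^ 6 * t1)
    + (q\<^sup>2)\<^sup>2 * (q ^ 4 * a + q ^ 4 * b + q ^ 4 * d + q ^ 4 * e + q ^ 4 * f + q ^ 4 * g) - 3 * (q\<^sup>2) ^ 4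
    - (q ^ 4 * a - (q\<^sup>2)\<^sup>2) * (q ^ 4 * g - (q\<^sup>2)\<^sup>2)
    - (q ^ 4 * b - (q\<^sup>2)\<^sup>2) * (q ^ 4 * f - (q\<^sup>2)\<^sup>2)
    - (q ^ 4 * d - (q\<^sup>2)\<^sup>2) * (q ^ 4 * e - (q\<^sup>2)\<^sup>2)
   = q ^ 8 * (M - (t1 + t2 + t3 + t4) - (a * g + b * f + d * e) + 2 * (a + b + d + e + f + g) - 6)"
  by algebra

context colouring
begin

text \<open>For centred functions this is the joint fourth cumulant, as all terms containing a mean
  vanish.\<close>

definition cum4 :: "(('v \<Rightarrow> nat) \<Rightarrow> real) \<Rightarrow> (('v \<Rightarrow> nat) \<Rightarrow> real) \<Rightarrow> (('v \<Rightarrow> nat) \<Rightarrow> real) \<Rightarrow> (('v \<Rightarrow> nat) \<Rightarrow> real) \<Rightarrow> real" where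
  "cum4 f g h k = avg (\<lambda>X. f X * g X * h X * k X) - avg (\<lambda>X. f X * g X) * avg (\<lambda>X. h X * k X)
     - avg (\<lambda>X. f X * h X) * avg (\<lambda>X. g X * k X) - avg (\<lambda>X. f X * k X) * avg (\<lambda>X. g X * h X)"

text \<open>Connectedness in the sense of the rank, over the seven splittings into two nonempty
  groups. It is stronger than connectedness of the graph: a triangle that meets the union of the
  others in a single vertex splits off.\<close>

definition conn4 :: "('v \<times> 'v) set \<Rightarrow> ('v \<times> 'v) set \<Rightarrow> ('v \<times> 'v) set \<Rightarrow> ('v \<times> 'v) set \<Rightarrow> bool" where
  "conn4 A B C D \<longleftrightarrow> \<not> indep A (B \<union> C \<union> D) \<and> \<not> indep B (A \<union> C \<union> D) \<and> \<not> indep C (A \<union> B \<union> D)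
     \<and> \<not> indep D (A \<union> B \<union> C) \<and> \<not> indep (A \<union> B) (C \<union> D) \<and> \<not> indep (A \<union> C) (B \<union> D) \<and> \<not> indep (A \<union> D) (B \<union> C)"

lemma cum4_swap: "cum4 f g h k = cum4 g f h k" "cum4 f g h k = cum4 h g f k" "cum4 f g h k = cum4 k g h f"
  "cum4 f g h k = cum4 f h g k" "cum4 f g h k = cum4 f k h g"
  by (simp_all add: cum4_def ac_simps)

lemma cum4_eq_0_single:
  assumes f: "Span A f" "avg f = 0" and ghk: "Span B g" "Span C h" "Span D k"
    and V: "A \<subseteq> V \<times> V" "B \<subseteq> V \<times> V" "C \<subseteq> V \<times> V" "D \<subseteq> V \<times> V" and I: "indep A (B \<union> C \<union> D)"
  shows "cum4 f g h k = 0"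
proof -
  have z: "avg (\<lambda>X. f X * q X) = 0" if "Span (B \<union> C \<union> D) q" for q
    using avg_indep[OF f(1) that I] V f(2) by auto
  have "Span (B \<union> C \<union> D) (\<lambda>X. g X * h X * k X)" by (intro Span_mult ghk)
  moreover have "Span (B \<union> C \<union> D) g" "Span (B \<union> C \<union> D) h" "Span (B \<union> C \<union> D) k"
    by (rule Span_mono[OF ghk(1)] Span_mono[OF ghk(2)] Span_mono[OF ghk(3)]; blast)+
  ultimately show ?thesis using z by (simp add: cum4_def mult.assoc)
qed

text \<open>The full moment factors and cancels the first product, while the averages in the crossed
  products factor into means that vanish.\<close>

lemma cum4_eq_0_pair:
  assumes f: "Span A f" "avg f = 0" and g: "Span B g" "avg g = 0" and hk: "Span C h" "Span D k"
    and V: "A \<subseteq> V \<times> V" "B \<subseteq> V \<times> V" "C \<subseteq> V \<times> V" "D \<subseteq> V \<times> V" and I: "indep (A \<union> B) (C \<union> D)"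
  shows "cum4 f g h k = 0"
proof -
  have z: "avg (\<lambda>X. p X * q X) = avg p * avg q" if "Span (A \<union> B) p" "Span (C \<union> D) q" for p q
    using avg_indep[OF that I] V by auto
  have "avg (\<lambda>X. (f X * g X) * (h X * k X)) = avg (\<lambda>X. f X * g X) * avg (\<lambda>X. h X * k X)"
    by (intro z Span_mult f g hk)
  moreover have "avg (\<lambda>X. f X * h X) = 0" "avg (\<lambda>X. f X * k X) = 0"
    using z[of f h] z[of f k] f(2) Span_mono[OF f(1)] Span_mono[OF hk(1)] Span_mono[OF hk(2)] by auto
  ultimately show ?thesis by (simp add: cum4_def ac_simps)
qed

lemma cum4_eq_0:
  assumes S: "Span A f" "Span B g" "Span C h" "Span D k" and z: "avg f = 0" "avg g = 0" "avg h = 0" "avg k = 0"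
    and V: "A \<subseteq> V \<times> V" "B \<subseteq> V \<times> V" "C \<subseteq> V \<times> V" "D \<subseteq> V \<times> V" and nc: "\<not> conn4 A B C D"
  shows "cum4 f g h k = 0"
proof -
  consider "indep A (B \<union> C \<union> D)" | "indep B (A \<union> C \<union> D)" | "indep C (B \<union> A \<union> D)" | "indep D (B \<union> C \<union> A)"
    | "indep (A \<union> B) (C \<union> D)" | "indep (A \<union> C) (B \<union> D)" | "indep (A \<union> D) (C \<union> B)"
    using nc unfolding conn4_def by (auto simp: Un_ac)
  then show ?thesis
  proof cases
    case 1 then show ?thesis by (rule cum4_eq_0_single[OF S(1) z(1) S(2,3,4) V])
  next
    case 2 then show ?thesis unfolding cum4_swap(1)[of f] by (rule cum4_eq_0_single[OF S(2) z(2) S(1,3,4) V(2,1,3,4)])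
  next
    case 3 then show ?thesis unfolding cum4_swap(2)[of f] by (rule cum4_eq_0_single[OF S(3) z(3) S(2,1,4) V(3,2,1,4)])
  next
    case 4 then show ?thesis unfolding cum4_swap(3)[of f] by (rule cum4_eq_0_single[OF S(4) z(4) S(2,3,1) V(4,2,3,1)])
  next
    case 5 then show ?thesis by (rule cum4_eq_0_pair[OF S(1) z(1) S(2) z(2) S(3,4) V])
  next
    case 6 then show ?thesis unfolding cum4_swap(4)[of f g] by (rule cum4_eq_0_pair[OF S(1) z(1) S(3) z(3) S(2,4) V(1,3,2,4)])
  next
    case 7 then show ?thesis unfolding cum4_swap(5)[of f g] by (rule cum4_eq_0_pair[OF S(1) z(1) S(4) z(4) S(3,2) V(1,4,3,2)])
  qed
qed

lemma abs_avg_le_1: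
  assumes "\<And>X. X \<in> colourings \<Longrightarrow> \<bar>f X\<bar> \<le> (1::real)"
  shows "\<bar>avg f\<bar> \<le> 1"
  using norm_avg_le[of f] avg_mono[of "\<lambda>X. \<bar>f X\<bar>" "\<lambda>_. 1"] assms by (auto intro: order_trans)

text \<open>A covariance estimate for \<open>f * g\<close> against \<open>h * k\<close>: it is
  trivial for a connected quadruple, and otherwise the cumulant vanishes and only the two crossed
  pairings remain.\<close>

lemma abs_avg_mult4_le:
  assumes S: "Span A f" "Span B g" "Span C h" "Span D k" and z: "avg f = 0" "avg g = 0" "avg h = 0" "avg k = 0"
    and V: "A \<subseteq> V \<times> V" "B \<subseteq> V \<times> V" "C \<subseteq> V \<times> V" "D \<subseteq> V \<times> V"
    and le: "\<And>X. X \<in> colourings \<Longrightarrow> \<bar>f X\<bar> \<le> 1" "\<And>X. X \<in> colourings \<Longrightarrow> \<bar>g X\<bar> \<le> 1" "\<And>X. X \<in> colourings \<Longrightarrow> \<bar>h X\<bar> \<le> 1" "\<And>X. X \<in> colourings \<Longrightarrow> \<bar>k X\<bar> \<le> 1"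
  shows "\<bar>avg (\<lambda>X. f X * g X * h X * k X) - avg (\<lambda>X. f X * g X) * avg (\<lambda>X. h X * k X)\<bar>
    \<le> 2 * of_bool (conn4 A B C D) + \<bar>avg (\<lambda>X. f X * h X)\<bar> * \<bar>avg (\<lambda>X. g X * k X)\<bar> 
      + \<bar>avg (\<lambda>X. f X * k X)\<bar> * \<bar>avg (\<lambda>X. g X * h X)\<bar>"
proof (cases "conn4 A B C D")
  case True
  have "\<bar>avg (\<lambda>X. f X * g X * h X * k X)\<bar> \<le> 1" "\<bar>avg (\<lambda>X. f X * g X)\<bar> \<le> 1" "\<bar>avg (\<lambda>X. h X * k X)\<bar> \<le> 1"
    using le by (auto intro!: abs_avg_le_1 mult_le_one simp: abs_mult)
  moreover from this(2,3) have "\<bar>avg (\<lambda>X. f X * g X) * avg (\<lambda>X. h X * k X)\<bar> \<le> 1"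
    by (auto intro!: mult_le_one simp: abs_mult)
  ultimately have "\<bar>avg (\<lambda>X. f X * g X * h X * k X) - avg (\<lambda>X. f X * g X) * avg (\<lambda>X. h X * k X)\<bar> \<le> 2" by linarith
  then show ?thesis using True by (simp add: add_increasing2)
next
  case False
  have "avg (\<lambda>X. f X * g X * h X * k X) - avg (\<lambda>X. f X * g X) * avg (\<lambda>X. h X * k X) =
     avg (\<lambda>X. f X * h X) * avg (\<lambda>X. g X * k X) + avg (\<lambda>X. f X * k X) * avg (\<lambda>X. g X * h X)"
    using cum4_eq_0[OF S z V False] by (simp add: cum4_def)
  then show ?thesis using False by (simp add: abs_mult[symmetric])
qed

lemma cum4_eq_prb:
  assumes p: "p = prb A" "p = prb B" "p = prb C" "p = prb D"
  shows "cum4 (\<lambda>X. of_bool (Mon A X) - p) (\<lambda>X. of_bool (Mon B X) - p) (\<lambda>X. of_bool (Mon C X) - p) (\<lambda>X. of_bool (Mon D X) - p)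
   = prb (A \<union> B \<union> C \<union> D) - p * (prb (A \<union> B \<union> C) + prb (A \<union> B \<union> D) + prb (A \<union> C \<union> D) + prb (B \<union> C \<union> D))
     + p\<^sup>2 * (prb (A \<union> B) + prb (A \<union> C) + prb (A \<union> D) + prb (B \<union> C) + prb (B \<union> D) + prb (C \<union> D)) - 3 * p ^ 4
     - (prb (A \<union> B) - p\<^sup>2) * (prb (C \<union> D) - p\<^sup>2) - (prb (A \<union> C) - p\<^sup>2) * (prb (B \<union> D) - p\<^sup>2)
     - (prb (A \<union> D) - p\<^sup>2) * (prb (B \<union> C) - p\<^sup>2)"
proof -
  let ?I = "\<lambda>A X. of_bool (Mon A X) :: real"
  have two: "avg (\<lambda>X. (?I A X - p) * (?I B X - p)) = prb (A \<union> B) - p\<^sup>2" if "p = prb A" "p = prb B" for A B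
  proof -
    have "(\<lambda>X. (?I A X - p) * (?I B X - p)) = (\<lambda>X. ?I (A \<union> B) X - p * ?I A X - p * ?I B X + p\<^sup>2)"
      by (simp add: Mon_Un of_bool_conj algebra_simps power2_eq_square)
    then have "avg (\<lambda>X. (?I A X - p) * (?I B X - p)) = prb (A \<union> B) - p * prb A - p * prb B + p\<^sup>2"
      by (simp only: avg_add avg_diff avg_cmult avg_const prb_def)
    then show ?thesis using that by (simp add: power2_eq_square)
  qed
  have "(\<lambda>X. (?I A X - p) * (?I B X - p) * (?I C X - p) * (?I D X - p)) = (\<lambda>X. ?I (A \<union> B \<union> C \<union> D) X
     - p * (?I (A \<union> B \<union> C) X + ?I (A \<union> B \<union> D) X + ?I (A \<union> C \<union> D) X + ?I (B \<union> C \<union> D) X)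
     + p\<^sup>2 * (?I (A \<union> B) X + ?I (A \<union> C) X + ?I (A \<union> D) X + ?I (B \<union> C) X + ?I (B \<union> D) X + ?I (C \<union> D) X)
     - p ^ 3 * (?I A X + ?I B X + ?I C X + ?I D X) + p ^ 4)"
    by (rule ext) (simp only: Mon_Un of_bool_conj, algebra)
  then have "avg (\<lambda>X. (?I A X - p) * (?I B X - p) * (?I C X - p) * (?I D X - p)) = prb (A \<union> B \<union> C \<union> D)
     - p * (prb (A \<union> B \<union> C) + prb (A \<union> B \<union> D) + prb (A \<union> C \<union> D) + prb (B \<union> C \<union> D))
     + p\<^sup>2 * (prb (A \<union> B) + prb (A \<union> C) + prb (A \<union> D) + prb (B \<union> C) + prb (B \<union> D) + prb (C \<union> D))
     - p ^ 3 * (prb A + prb B + prb C + prb D) + p ^ 4"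
    by (simp only: avg_add avg_diff avg_cmult avg_const prb_def)
  also have "p ^ 3 * (prb A + prb B + prb C + prb D) = 4 * p ^ 4" using p by (simp add: power_numeral_reduce)
  finally show ?thesis unfolding cum4_def two[OF p(1,2)] two[OF p(1,3)] two[OF p(1,4)] two[OF p(2,3)] two[OF p(2,4)] two[OF p(3,4)]
    by (simp add: algebra_simps)
qed

lemma cum4_ge:
  assumes c5: "c \<ge> 5" and V: "A \<subseteq> V \<times> V" "B \<subseteq> V \<times> V" "C \<subseteq> V \<times> V" "D \<subseteq> V \<times> V"
    and r: "rk A = 2" "rk B = 2" "rk C = 2" "rk D = 2" and cn: "conn4 A B C D"
    and p: "p = (1 / real c)\<^sup>2"
  shows "cum4 (\<lambda>X. of_bool (Mon A X) - p) (\<lambda>X. of_bool (Mon B X) - p) (\<lambda>X. of_bool (Mon C X) - p) (\<lambda>X. of_bool (Mon D X) - p)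
   \<ge> (1 / c) ^ 8"
proof -
  define q where "q = 1 / real c"
  have q: "q * real c = 1" using c5 by (simp add: q_def)
  have prb_q: "prb U = q ^ rk U" if "U \<subseteq> V \<times> V" for U using prb_eq_rk[OF that] by (simp add: q_def)
  have scale: "q ^ k = q ^ n * real c ^ (n - k)" if "k \<le> n" for k n
  proof -
    have "q ^ n * real c ^ (n - k) = q ^ k * (q ^ (n - k) * real c ^ (n - k))"
      using that by (simp add: power_add[symmetric])
    then show ?thesis using q by (simp add: power_mult_distrib[symmetric])
  qed
  have prb_scale: "prb U = q ^ n * real c ^ (n - rk U)" if "U \<subseteq> V \<times> V" "rk U \<le> n" for U n
    using scale[OF that(2)] prb_q[OF that(1)] by simp
  have pA: "p = prb A" "p = prb B" "p = prb C" "p = prb D" using V r p by (simp_all add: prb_eq_rk)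
  \<comment> \<open>The excesses of \<open>2 * |S|\<close> over the rank, supermodular because the
    rank is submodular. All are nonnegative, so the truncated subtractions are exact.\<close>
  define m where "m = 8 - rk (A \<union> B \<union> C \<union> D)"
  define t4 t3 t2 t1 where "t4 = 6 - rk (A \<union> B \<union> C)" and "t3 = 6 - rk (A \<union> B \<union> D)" and "t2 = 6 - rk (A \<union> C \<union> D)" and "t1 = 6 - rk (B \<union> C \<union> D)"
  define d12 d13 d14 d23 d24 d34 where "d12 = 4 - rk (A \<union> B)" and "d13 = 4 - rk (A \<union> C)" and "d14 = 4 - rk (A \<union> D)"
    and "d23 = 4 - rk (B \<union> C)" and "d24 = 4 - rk (B \<union> D)" and "d34 = 4 - rk (C \<union> D)"
  note ds = t1_def t2_def t3_def t4_def d12_def d13_def d14_def d23_def d24_def d34_def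
  have sub: "A \<union> B \<subseteq> V \<times> V" "A \<union> C \<subseteq> V \<times> V" "A \<union> D \<subseteq> V \<times> V" "B \<union> C \<subseteq> V \<times> V" "B \<union> D \<subseteq> V \<times> V" "C \<union> D \<subseteq> V \<times> V"
    "A \<union> B \<union> C \<subseteq> V \<times> V" "A \<union> B \<union> D \<subseteq> V \<times> V" "A \<union> C \<union> D \<subseteq> V \<times> V" "B \<union> C \<union> D \<subseteq> V \<times> V" "A \<union> B \<union> C \<union> D \<subseteq> V \<times> V"
    using V by auto
  have two: "rk (A \<union> B) \<le> 4 \<and> 2 \<le> rk (A \<union> B)" "rk (A \<union> C) \<le> 4 \<and> 2 \<le> rk (A \<union> C)" "rk (A \<union> D) \<le> 4 \<and> 2 \<le> rk (A \<union> D)"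
    "rk (B \<union> C) \<le> 4 \<and> 2 \<le> rk (B \<union> C)" "rk (B \<union> D) \<le> 4 \<and> 2 \<le> rk (B \<union> D)" "rk (C \<union> D) \<le> 4 \<and> 2 \<le> rk (C \<union> D)"
    using rk_Un_le[OF V(1,2)] rk_Un_le[OF V(1,3)] rk_Un_le[OF V(1,4)] rk_Un_le[OF V(2,3)] rk_Un_le[OF V(2,4)] rk_Un_le[OF V(3,4)]
      rk_mono[OF _ sub(1), of A] rk_mono[OF _ sub(2), of A] rk_mono[OF _ sub(3), of A] rk_mono[OF _ sub(4), of B] rk_mono[OF _ sub(5), of B] rk_mono[OF _ sub(6), of C] r
    by auto
  have three: "rk (A \<union> B \<union> C) \<le> 6" "rk (A \<union> B \<union> D) \<le> 6" "rk (A \<union> C \<union> D) \<le> 6" "rk (B \<union> C \<union> D) \<le> 6"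
    using rk_Un_le[OF sub(1) V(3)] rk_Un_le[OF sub(1) V(4)] rk_Un_le[OF sub(2) V(4)] rk_Un_le[OF sub(4) V(4)] two r by auto
  have nI: "rk (U \<union> W) < rk U + rk W" if "\<not> indep U W" "U \<subseteq> V \<times> V" "W \<subseteq> V \<times> V" for U W
    using that rk_Un_le[of U W] by (auto simp: indep_def)
  \<comment> \<open>Ranks are integers, so each failed splitting leaves a slack of one; this is the
    \<open>+ 1\<close> in the hypotheses of \<open>cumulant_exponents_pos\<close>.\<close>
  have cs: "rk (A \<union> B \<union> C \<union> D) < rk A + rk (B \<union> C \<union> D)" "rk (A \<union> B \<union> C \<union> D) < rk B + rk (A \<union> C \<union> D)"
     "rk (A \<union> B \<union> C \<union> D) < rk C + rk (A \<union> B \<union> D)" "rk (A \<union> B \<union> C \<union> D) < rk D + rk (A \<union> B \<union> C)"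
     "rk (A \<union> B \<union> C \<union> D) < rk (A \<union> B) + rk (C \<union> D)" "rk (A \<union> B \<union> C \<union> D) < rk (A \<union> C) + rk (B \<union> D)"
     "rk (A \<union> B \<union> C \<union> D) < rk (A \<union> D) + rk (B \<union> C)"
    using cn nI[of A "B \<union> C \<union> D"] nI[of B "A \<union> C \<union> D"] nI[of C "A \<union> B \<union> D"] nI[of D "A \<union> B \<union> C"]
      nI[of "A \<union> B" "C \<union> D"] nI[of "A \<union> C" "B \<union> D"] nI[of "A \<union> D" "B \<union> C"] V
    unfolding conn4_def by (simp_all add: Un_ac)
  have four: "rk (A \<union> B \<union> C \<union> D) \<le> 8" using cs(5) two by linarith
  have sm: "rk (A \<union> B \<union> C \<union> D) + rk W \<le> rk S + rk T" if "S \<union> T = A \<union> B \<union> C \<union> D" "W \<subseteq> S" "W \<subseteq> T" for S T W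
    using rk_Un_Int_le[of S T W] sub(11) that unfolding that(1)[symmetric] by simp
  have tt: "rk (A \<union> B \<union> C \<union> D) + rk (A \<union> B) \<le> rk (A \<union> B \<union> C) + rk (A \<union> B \<union> D)"
    "rk (A \<union> B \<union> C \<union> D) + rk (A \<union> C) \<le> rk (A \<union> B \<union> C) + rk (A \<union> C \<union> D)"
    "rk (A \<union> B \<union> C \<union> D) + rk (B \<union> C) \<le> rk (A \<union> B \<union> C) + rk (B \<union> C \<union> D)"
    "rk (A \<union> B \<union> C \<union> D) + rk (A \<union> D) \<le> rk (A \<union> B \<union> D) + rk (A \<union> C \<union> D)"
    "rk (A \<union> B \<union> C \<union> D) + rk (B \<union> D) \<le> rk (A \<union> B \<union> D) + rk (B \<union> C \<union> D)"
    "rk (A \<union> B \<union> C \<union> D) + rk (C \<union> D) \<le> rk (A \<union> C \<union> D) + rk (B \<union> C \<union> D)"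
    by (intro sm; auto)+
  have es: "d12 + rk (A \<union> B) = 4" "d13 + rk (A \<union> C) = 4" "d14 + rk (A \<union> D) = 4" "d23 + rk (B \<union> C) = 4"
    "d24 + rk (B \<union> D) = 4" "d34 + rk (C \<union> D) = 4" "t4 + rk (A \<union> B \<union> C) = 6" "t3 + rk (A \<union> B \<union> D) = 6"
    "t2 + rk (A \<union> C \<union> D) = 6" "t1 + rk (B \<union> C \<union> D) = 6" "m + rk (A \<union> B \<union> C \<union> D) = 8"
    using two three four by (simp_all add: ds m_def)
  let ?C = "int c"
  have "?C ^ m - (?C ^ t1 + ?C ^ t2 + ?C ^ t3 + ?C ^ t4) - (?C ^ (d12 + d34) + ?C ^ (d13 + d24) + ?C ^ (d14 + d23))
    + 2 * (?C ^ d12 + ?C ^ d13 + ?C ^ d14 + ?C ^ d23 + ?C ^ d24 + ?C ^ d34) - 6 \<ge> 1"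
    using two cs tt r c5 es by (intro cumulant_exponents_pos) linarith+
  then have "real_of_int (?C ^ m - (?C ^ t1 + ?C ^ t2 + ?C ^ t3 + ?C ^ t4) - (?C ^ (d12 + d34) + ?C ^ (d13 + d24) + ?C ^ (d14 + d23))
    + 2 * (?C ^ d12 + ?C ^ d13 + ?C ^ d14 + ?C ^ d23 + ?C ^ d24 + ?C ^ d34) - 6) \<ge> 1"
    by (simp only: of_int_1_le_iff)
  then have main: "real c ^ m - (real c ^ t1 + real c ^ t2 + real c ^ t3 + real c ^ t4) - (real c ^ (d12 + d34) + real c ^ (d13 + d24) + real c ^ (d14 + d23))
    + 2 * (real c ^ d12 + real c ^ d13 + real c ^ d14 + real c ^ d23 + real c ^ d24 + real c ^ d34) - 6 \<ge> 1"
    by simp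
  have P2: "prb (A \<union> B) = q ^ 4 * real c ^ d12" "prb (A \<union> C) = q ^ 4 * real c ^ d13" "prb (A \<union> D) = q ^ 4 * real c ^ d14"
     "prb (B \<union> C) = q ^ 4 * real c ^ d23" "prb (B \<union> D) = q ^ 4 * real c ^ d24" "prb (C \<union> D) = q ^ 4 * real c ^ d34"
    unfolding ds by (intro prb_scale sub; use two in blast)+
  have P3: "prb (B \<union> C \<union> D) = q ^ 6 * real c ^ t1" "prb (A \<union> C \<union> D) = q ^ 6 * real c ^ t2" 
     "prb (A \<union> B \<union> D) = q ^ 6 * real c ^ t3" "prb (A \<union> B \<union> C) = q ^ 6 * real c ^ t4"
    unfolding ds by (intro prb_scale sub three)+
  have P4: "prb (A \<union> B \<union> C \<union> D) = q ^ 8 * real c ^ m" unfolding m_def by (intro prb_scale sub four)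
  have pq: "p = q ^ 2" using p by (simp add: q_def)
  have "cum4 (\<lambda>X. of_bool (Mon A X) - p) (\<lambda>X. of_bool (Mon B X) - p) (\<lambda>X. of_bool (Mon C X) - p) (\<lambda>X. of_bool (Mon D X) - p)
     = q ^ 8 * (real c ^ m - (real c ^ t1 + real c ^ t2 + real c ^ t3 + real c ^ t4) - (real c ^ (d12 + d34) + real c ^ (d13 + d24) + real c ^ (d14 + d23))
    + 2 * (real c ^ d12 + real c ^ d13 + real c ^ d14 + real c ^ d23 + real c ^ d24 + real c ^ d34) - 6)"
    unfolding cum4_eq_prb[OF pA] P2 P3 P4 power_add unfolding pq
    by (rule cumulant_scale)
  also have "\<dots> \<ge> q ^ 8 * 1" using main by (intro mult_left_mono) (auto simp: q_def)
  finally show ?thesis by (simp add: q_def)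
qed

end

section \<open>Martingale increments along the weight ordering\<close>

text \<open>The three pairings of four summation variables, as in Wick's formula.\<close>

lemma sum_mult_cross:
  fixes f g :: "'a \<Rightarrow> 'a \<Rightarrow> real"
  shows "(\<Sum>a\<in>A. \<Sum>b\<in>B. \<Sum>d\<in>C. \<Sum>e\<in>D. f a d * g b e) = (\<Sum>a\<in>A. \<Sum>d\<in>C. f a d) * (\<Sum>b\<in>B. \<Sum>e\<in>D. g b e)"
    and "(\<Sum>a\<in>A. \<Sum>b\<in>B. \<Sum>d\<in>C. \<Sum>e\<in>D. f a e * g b d) = (\<Sum>a\<in>A. \<Sum>e\<in>D. f a e) * (\<Sum>b\<in>B. \<Sum>d\<in>C. g b d)"
    and "(\<Sum>a\<in>A. \<Sum>b\<in>B. \<Sum>d\<in>C. \<Sum>e\<in>D. f a b * g d e) = (\<Sum>a\<in>A. \<Sum>b\<in>B. f a b) * (\<Sum>d\<in>C. \<Sum>e\<in>D. g d e)"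
proof -
  show "(\<Sum>a\<in>A. \<Sum>b\<in>B. \<Sum>d\<in>C. \<Sum>e\<in>D. f a d * g b e) = (\<Sum>a\<in>A. \<Sum>d\<in>C. f a d) * (\<Sum>b\<in>B. \<Sum>e\<in>D. g b e)"
    by (simp add: sum_product)
  have "(\<Sum>a\<in>A. \<Sum>b\<in>B. \<Sum>d\<in>C. \<Sum>e\<in>D. f a e * g b d) = (\<Sum>a\<in>A. \<Sum>b\<in>B. (\<Sum>e\<in>D. f a e) * (\<Sum>d\<in>C. g b d))"
    by (intro sum.cong refl) (subst sum.swap, simp add: sum_product)
  then show "(\<Sum>a\<in>A. \<Sum>b\<in>B. \<Sum>d\<in>C. \<Sum>e\<in>D. f a e * g b d) = (\<Sum>a\<in>A. \<Sum>e\<in>D. f a e) * (\<Sum>b\<in>B. \<Sum>d\<in>C. g b d)"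
    by (simp add: sum_product)
  show "(\<Sum>a\<in>A. \<Sum>b\<in>B. \<Sum>d\<in>C. \<Sum>e\<in>D. f a b * g d e) = (\<Sum>a\<in>A. \<Sum>b\<in>B. f a b) * (\<Sum>d\<in>C. \<Sum>e\<in>D. g d e)"
  proof -
    have *: "(\<Sum>a\<in>A. \<Sum>b\<in>B. f a b) * S = (\<Sum>a\<in>A. \<Sum>b\<in>B. f a b * S)" for S by (simp only: sum_distrib_right)
    show ?thesis unfolding * by (simp only: sum_distrib_left)
  qed
qed

lemma sum_mult4:
  fixes f g h k :: "'a \<Rightarrow> real"
  shows "sum f A * sum g B * sum h C * sum k D = (\<Sum>a\<in>A. \<Sum>b\<in>B. \<Sum>d\<in>C. \<Sum>e\<in>D. f a * g b * h d * k e)"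
proof -
  have "sum f A * sum g B * sum h C * sum k D = (\<Sum>a\<in>A. \<Sum>b\<in>B. f a * g b) * (\<Sum>d\<in>C. \<Sum>e\<in>D. h d * k e)"
    unfolding mult.assoc[of "sum f A * sum g B"] by (simp only: sum_product)
  also have "\<dots> = (\<Sum>a\<in>A. \<Sum>b\<in>B. \<Sum>d\<in>C. \<Sum>e\<in>D. f a * g b * h d * k e)"
    by (rule trans[OF sum_mult_cross(3)[symmetric]]) (simp add: mult.assoc)
  finally show ?thesis .
qed

context colouring
begin

lemma avg_mult4:
  fixes f g h k :: "'i \<Rightarrow> ('v \<Rightarrow> nat) \<Rightarrow> real"
  shows "avg (\<lambda>X. (\<Sum>a\<in>A. f a X) * (\<Sum>b\<in>B. g b X) * (\<Sum>d\<in>C. h d X) * (\<Sum>e\<in>D. k e X))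
   = (\<Sum>a\<in>A. \<Sum>b\<in>B. \<Sum>d\<in>C. \<Sum>e\<in>D. avg (\<lambda>X. f a X * g b X * h d X * k e X))"
  unfolding sum_mult4 by (simp add: avg_sum)

lemma avg_mult2:
  "avg (\<lambda>X. (\<Sum>a\<in>A. f a X) * (\<Sum>b\<in>B. g b X)) = (\<Sum>a\<in>A. \<Sum>b\<in>B. avg (\<lambda>X. f a X * g b X :: real))"
  by (simp add: sum_product avg_sum)

definition mon :: "'v set \<Rightarrow> ('v \<Rightarrow> nat) \<Rightarrow> real" where
  "mon L X = of_bool (Mon (L \<times> L) X)"

lemma Mon_D: "Mon A X \<Longrightarrow> (u, w) \<in> A \<Longrightarrow> X u = X w"
  by (auto simp: Mon_def)

lemma Mon_I: "(\<And>u w. (u, w) \<in> A \<Longrightarrow> X u = X w) \<Longrightarrow> Mon A X"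
  by (auto simp: Mon_def)

lemma mono_upd_notin:
  assumes "v \<notin> L"
  shows "mon L (X(v := a)) = mon L X"
proof -
  have "(case e of (u, w) \<Rightarrow> (X(v := a)) u = (X(v := a)) w) \<longleftrightarrow> (case e of (u, w) \<Rightarrow> X u = X w)" if "e \<in> L \<times> L" for e
    using that assms by (cases e) auto
  then show ?thesis unfolding mon_def Mon_def by (simp only: cong: ball_cong)
qed

text \<open>Once the rest of \<open>L\<close> is monochromatic, exactly one colour of
  \<open>v\<close> completes it, namely that of any other vertex \<open>w\<close>. A vertex alone
  would be completed by every colour.\<close>

lemma sum_mono_upd:
  assumes "X \<in> colourings" "L \<subseteq> V" "v \<in> L" "L - {v} \<noteq> {}"
  shows "(\<Sum>a\<in>{1..c}. mon L (X(v := a))) = mon (L - {v}) X"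
proof -
  obtain w where w: "w \<in> L" "w \<noteq> v" using assms(4) by blast
  have iff: "Mon (L \<times> L) (X(v := a)) \<longleftrightarrow> Mon ((L - {v}) \<times> (L - {v})) X \<and> X w = a" for a
  proof
    assume "Mon (L \<times> L) (X(v := a))"
    then have m: "(X(v := a)) u = (X(v := a)) u'" if "u \<in> L" "u' \<in> L" for u u'
      by (rule Mon_D) (use that in simp)
    have "Mon ((L - {v}) \<times> (L - {v})) X"
    proof (rule Mon_I)
      fix u u' assume "(u, u') \<in> (L - {v}) \<times> (L - {v})"
      then have "u \<in> L" "u' \<in> L" "u \<noteq> v" "u' \<noteq> v" by auto
      then show "X u = X u'" using m[OF \<open>u \<in> L\<close> \<open>u' \<in> L\<close>] by simp
    qed
    moreover have "X w = a" using m[OF w(1) assms(3)] w(2) by simp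
    ultimately show "Mon ((L - {v}) \<times> (L - {v})) X \<and> X w = a" ..
  next
    assume M: "Mon ((L - {v}) \<times> (L - {v})) X \<and> X w = a"
    have E: "(X(v := a)) u = a" if "u \<in> L" for u
    proof (cases "u = v")
      case True then show ?thesis by (simp only: fun_upd_same)
    next
      case False
      have "X u = X w" by (rule Mon_D[OF conjunct1[OF M]]) (use that w False in simp)
      then show ?thesis using conjunct2[OF M] by (simp only: fun_upd_other[OF False])
    qed
    show "Mon (L \<times> L) (X(v := a))"
    proof (rule Mon_I)
      fix u u' assume "(u, u') \<in> L \<times> L"
      then have "u \<in> L" "u' \<in> L" by auto
      then show "(X(v := a)) u = (X(v := a)) u'" by (simp only: E)
    qed
  qed
  have "mon L (X(v := a)) = mon (L - {v}) X * (if X w = a then 1 else 0)" for a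
    by (simp only: mon_def iff of_bool_conj) simp
  then have "(\<Sum>a\<in>{1..c}. mon L (X(v := a))) = mon (L - {v}) X * (\<Sum>a\<in>{1..c}. if X w = a then 1 else 0)"
    by (simp only: sum_distrib_left)
  also have "(\<Sum>a\<in>{1..c}. if X w = a then 1 else 0 :: real) = 1"
    using colourings_D[OF assms(1), of w] w assms(2) by (subst sum.delta') auto
  finally show ?thesis by (simp only: mult_1_right)
qed

lemma mon_singleton: "mon {x} X = 1"
  by (simp add: mon_def Mon_def)

lemma mono_antimono: "L \<subseteq> L' \<Longrightarrow> mon L' X \<le> mon L X"
  by (auto simp: Mon_def mon_def)

lemma abs_mono_diff_le: "L' \<subseteq> L \<Longrightarrow> \<bar>mon L X - mon L' X / c\<bar> \<le> 1"
  using mono_antimono[of L' L X] c_ge_2 by (auto simp: mon_def of_bool_def field_simps split: if_splits)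

lemma Span_mono_set: "L \<subseteq> K \<Longrightarrow> Span (K \<times> K) (mon L)"
  unfolding mon_def by (intro Span_Mon) auto

lemma rk_singleton: "u \<in> V \<Longrightarrow> w \<in> V \<Longrightarrow> u \<noteq> w \<Longrightarrow> rk {(u, w)} = 1"
  using rk_insert[of "(u, w)" "{}"] by simp

lemma con_Field: "(x, y) \<in> con A \<Longrightarrow> x \<noteq> y \<Longrightarrow> x \<in> Field A"
  by (erule converse_rtranclE) (auto simp: Field_def)

text \<open>Two sides of a triangle form a forest and force the third.\<close>

lemma rk_triple:
  assumes "L \<subseteq> V" "card L = 3"
  shows "rk (L \<times> L) = 2"
proof -
  obtain x y z where L: "L = {x, y, z}" "x \<noteq> y" "x \<noteq> z" "y \<noteq> z" using assms(2) card_3_iff by metis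
  have "(x, y) \<notin> con {(y, z)}" using con_Field[of x y "{(y, z)}"] L by (auto simp: Field_def)
  then have "rk {(x, y), (y, z)} = 2"
    using rk_insert[of "(x, y)" "{(y, z)}"] rk_singleton[of y z] assms L by auto
  moreover have "Mon {(x, y), (y, z)} X = Mon (L \<times> L) X" for X
  proof
    assume M: "Mon {(x, y), (y, z)} X"
    have "X x = X y" "X y = X z" using Mon_D[OF M, of x y] Mon_D[OF M, of y z] by simp_all
    then have "X u = X z" if "u \<in> L" for u using that L by auto
    then show "Mon (L \<times> L) X" by (intro Mon_I) (metis mem_Sigma_iff)
  next
    assume M: "Mon (L \<times> L) X"
    then show "Mon {(x, y), (y, z)} X" using Mon_D[OF M] L(1) by (intro Mon_I) blast
  qed
  then have "prb {(x, y), (y, z)} = prb (L \<times> L)" by (simp add: prb_def)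
  ultimately have "prb (L \<times> L) = (1 / c) ^ 2" using prb_eq_rk[of "{(x, y), (y, z)}"] assms L by auto
  then show ?thesis by (rule rk_unique)
qed

end

section \<open>Families of triples: weights, vertex order and increments\<close>

text \<open>The estimates depend only on the family of triangles, so the graph is dropped. The
  linear order on the vertices breaks ties in the weight ordering.\<close>

locale triple_system = colouring V c for V :: "'v::linorder set" and c +
  fixes TS :: "'v set set"
  assumes TS: "\<And>\<Delta>. \<Delta> \<in> TS \<Longrightarrow> \<Delta> \<subseteq> V \<and> card \<Delta> = 3"
begin

lemma finite_TS [simp]: "finite TS"
  using TS finite_V by (intro finite_subset[of TS "Pow V"]) auto

lemma sq_subset: "\<Delta> \<in> TS \<Longrightarrow> \<Delta> \<times> \<Delta> \<subseteq> V \<times> V"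
  using TS[of \<Delta>] by auto

definition p :: real where "p = (1 / c) ^ 2"

definition J :: "'v set \<Rightarrow> ('v \<Rightarrow> nat) \<Rightarrow> real" where
  "J \<Delta> X = mon \<Delta> X - p"

definition U :: "('v \<Rightarrow> nat) \<Rightarrow> real" where
  "U X = (\<Sum>\<Delta>\<in>TS. J \<Delta> X)"

definition var :: real where "var = avg (\<lambda>X. (U X)\<^sup>2)"

definition deg :: "'v \<Rightarrow> 'v \<Rightarrow> nat" where
  "deg u v = card {\<Delta>\<in>TS. u \<in> \<Delta> \<and> v \<in> \<Delta>}"

definition R :: "'v \<Rightarrow> real" where "R v = (\<Sum>u\<in>V - {v}. (real (deg u v))\<^sup>2)"

text \<open>Comparable to the variance: \<open>var <= F <= 6 * c^4 * var\<close> by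
  \<open>var_le\<close> and \<open>var_ge\<close>.\<close>

definition F :: real where "F = (\<Sum>v\<in>V. R v)"

text \<open>Heavy vertices come first. A single vertex may carry most of the variance without
  contributing to the fourth cumulant, as the centre of a windmill does; revealing its colour early
  keeps its martingale increment small.\<close>

definition prec :: "'v \<Rightarrow> 'v \<Rightarrow> bool" where
  "prec u v \<longleftrightarrow> R u > R v \<or> R u = R v \<and> u < v"

definition Q :: "'v \<Rightarrow> real" where "Q v = (\<Sum>u\<in>{u\<in>V. prec u v}. (real (deg u v))\<^sup>2)"

text \<open>Counts quadruples of triangles through a common ordered pair of vertices; such
  quadruples are connected (\<open>S4_le\<close>).\<close>

definition S4 :: real where "S4 = (\<Sum>v\<in>V. \<Sum>u\<in>V - {v}. (real (deg u v)) ^ 4)"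

definition nconn :: real where
  "nconn = (\<Sum>a\<in>TS. \<Sum>b\<in>TS. \<Sum>d\<in>TS. \<Sum>e\<in>TS. of_bool (conn4 (a \<times> a) (b \<times> b) (d \<times> d) (e \<times> e)))"

definition below :: "'v set \<Rightarrow> 'v \<Rightarrow> 'v set" where
  "below \<Delta> v = {u\<in>\<Delta>. prec u v}"

text \<open>The difference of the conditional expectations of the indicator of \<open>\<Delta>\<close> given the colours up to
  \<open>v\<close> and strictly before \<open>v\<close>: each vertex still to be revealed costs a factor \<open>1/c\<close>, and the first
  vertex of \<open>\<Delta>\<close> reveals nothing.\<close>

definition mart :: "'v set \<Rightarrow> 'v \<Rightarrow> ('v \<Rightarrow> nat) \<Rightarrow> real" where
  "mart \<Delta> v X = (if v \<in> \<Delta> \<and> below \<Delta> v \<noteq> {} then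
     (1 / c) ^ (2 - card (below \<Delta> v)) * (mon (insert v (below \<Delta> v)) X - mon (below \<Delta> v) X / c) else 0)"

text \<open>The indicator minus its conditional expectation given all colours but that of
  \<open>v\<close>. Unlike \<open>mart\<close> it sees the whole triangle, so subtracting all of
  them from \<open>U\<close> leaves a function that ignores the colour of \<open>v\<close>.\<close>

definition dev :: "'v set \<Rightarrow> 'v \<Rightarrow> ('v \<Rightarrow> nat) \<Rightarrow> real" where
  "dev \<Delta> v X = (if v \<in> \<Delta> then mon \<Delta> X - mon (\<Delta> - {v}) X / c else 0)"

lemma prec_irrefl: "\<not> prec v v" by (simp add: prec_def)
lemma prec_asym: "prec u v \<Longrightarrow> \<not> prec v u" by (auto simp: prec_def)
lemma prec_total: "u \<noteq> v \<Longrightarrow> prec u v \<or> prec v u" by (auto simp: prec_def)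
lemma prec_trans: "prec u v \<Longrightarrow> prec v w \<Longrightarrow> prec u w" by (auto simp: prec_def)

lemma below_subset: "below \<Delta> v \<subseteq> \<Delta>" by (auto simp: below_def)
lemma notin_below: "v \<notin> below \<Delta> v" by (simp add: below_def prec_irrefl)

lemma mart_upd_notin:
  assumes "w \<noteq> v" "\<not> prec w v"
  shows "mart \<Delta> v (X(w := k)) = mart \<Delta> v X"
proof -
  have "w \<notin> insert v (below \<Delta> v)" using assms by (auto simp: below_def)
  then have "mon (insert v (below \<Delta> v)) (X(w := k)) = mon (insert v (below \<Delta> v)) X"
    "mon (below \<Delta> v) (X(w := k)) = mon (below \<Delta> v) X"
    by (intro mono_upd_notin; blast)+
  then show ?thesis unfolding mart_def by (simp only:)
qed

lemma sum_mart_upd: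
  assumes "\<Delta> \<in> TS" "X \<in> colourings"
  shows "(\<Sum>a\<in>{1..c}. mart \<Delta> v (X(v := a))) = 0"
proof (cases "v \<in> \<Delta> \<and> below \<Delta> v \<noteq> {}")
  case True
  have "\<Delta> \<subseteq> V" using TS[OF assms(1)] ..
  then have sub: "insert v (below \<Delta> v) \<subseteq> V" using True below_subset[of \<Delta> v] by blast
  have rm: "insert v (below \<Delta> v) - {v} = below \<Delta> v" using notin_below[of v \<Delta>] by (rule Diff_insert_absorb)
  have "(\<Sum>a\<in>{1..c}. mart \<Delta> v (X(v := a))) = (1 / c) ^ (2 - card (below \<Delta> v)) *
     ((\<Sum>a\<in>{1..c}. mon (insert v (below \<Delta> v)) (X(v := a))) - (\<Sum>a\<in>{1..c}. mon (below \<Delta> v) (X(v := a)) / c))"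
  proof -
    have "mart \<Delta> v (X(v := a)) = (1 / c) ^ (2 - card (below \<Delta> v)) *
      (mon (insert v (below \<Delta> v)) (X(v := a)) - mon (below \<Delta> v) (X(v := a)) / c)" for a
      unfolding mart_def by (rule if_P[OF True])
    then show ?thesis by (simp only: sum_distrib_left[symmetric] sum_subtractf)
  qed
  also have "(\<Sum>a\<in>{1..c}. mon (insert v (below \<Delta> v)) (X(v := a))) = mon (below \<Delta> v) X"
    using sum_mono_upd[OF assms(2) sub insertI1] True unfolding rm by simp
  also have "(\<Sum>a\<in>{1..c}. mon (below \<Delta> v) (X(v := a)) / c) = mon (below \<Delta> v) X"
    using c_ge_2 by (simp add: mono_upd_notin[OF notin_below])
  finally show ?thesis by (simp only: diff_self mult_zero_right)
qed (auto simp: mart_def)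

lemma sum_dev_upd:
  assumes "\<Delta> \<in> TS" "X \<in> colourings"
  shows "(\<Sum>a\<in>{1..c}. dev \<Delta> v (X(v := a))) = 0"
proof (cases "v \<in> \<Delta>")
  case True
  have ne: "\<Delta> - {v} \<noteq> {}"
  proof
    assume "\<Delta> - {v} = {}"
    then have "\<Delta> = {v}" using True by blast
    then show False using TS[OF assms(1)] by simp
  qed
  have "(\<Sum>a\<in>{1..c}. dev \<Delta> v (X(v := a))) = 
     (\<Sum>a\<in>{1..c}. mon \<Delta> (X(v := a))) - (\<Sum>a\<in>{1..c}. mon (\<Delta> - {v}) (X(v := a)) / c)"
  proof -
    have "dev \<Delta> v (X(v := a)) = mon \<Delta> (X(v := a)) - mon (\<Delta> - {v}) (X(v := a)) / c" for a
      unfolding dev_def by (rule if_P[OF True])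
    then show ?thesis by (simp only: sum_subtractf)
  qed
  also have "(\<Sum>a\<in>{1..c}. mon \<Delta> (X(v := a))) = mon (\<Delta> - {v}) X"
    using TS[OF assms(1)] by (intro sum_mono_upd[OF assms(2) _ True ne]) (rule conjunct1)
  also have "(\<Sum>a\<in>{1..c}. mon (\<Delta> - {v}) (X(v := a)) / c) = mon (\<Delta> - {v}) X"
    using c_ge_2 by (simp add: mono_upd_notin)
  finally show ?thesis by (simp only: diff_self)
qed (auto simp: dev_def)

lemma avg_mart: "\<Delta> \<in> TS \<Longrightarrow> v \<in> V \<Longrightarrow> avg (mart \<Delta> v) = 0"
  using avg_zero[of v "mart \<Delta> v"] sum_mart_upd by auto

lemma avg_dev: "\<Delta> \<in> TS \<Longrightarrow> v \<in> V \<Longrightarrow> avg (dev \<Delta> v) = 0"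
  using avg_zero[of v "dev \<Delta> v"] sum_dev_upd by auto

lemma abs_mart_le: "\<bar>mart \<Delta> v X\<bar> \<le> 1"
proof (cases "v \<in> \<Delta> \<and> below \<Delta> v \<noteq> {}")
  case True
  have "(1 / real c) ^ (2 - card (below \<Delta> v)) \<le> 1" using c_ge_2 by (intro power_le_one) auto
  moreover have "\<bar>mon (insert v (below \<Delta> v)) X - mon (below \<Delta> v) X / c\<bar> \<le> 1"
    by (rule abs_mono_diff_le) auto
  ultimately show ?thesis using True by (simp add: mart_def abs_mult mult_le_one)
qed (auto simp: mart_def)

lemma abs_dev_le: "\<bar>dev \<Delta> v X\<bar> \<le> 1"
  using abs_mono_diff_le[of "\<Delta> - {v}" \<Delta> X] by (auto simp: dev_def)

text \<open>All vertices of the support other than \<open>v\<close> precede \<open>v\<close>, which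
  is why \<open>Q\<close> rather than \<open>R\<close> bounds the increments below.\<close>

lemma Span_mart: "Span (insert v (below \<Delta> v) \<times> insert v (below \<Delta> v)) (mart \<Delta> v)"
proof (cases "v \<in> \<Delta> \<and> below \<Delta> v \<noteq> {}")
  case True
  have "Span (insert v (below \<Delta> v) \<times> insert v (below \<Delta> v)) 
    (\<lambda>X. (1 / c) ^ (2 - card (below \<Delta> v)) * (mon (insert v (below \<Delta> v)) X - (1 / c) * mon (below \<Delta> v) X))"
    by (intro Span_cmult Span_diff Span_mono_set) auto
  then show ?thesis using True unfolding mart_def by simp
next
  case False
  then have "mart \<Delta> v = (\<lambda>X. 0)" by (intro ext) (auto simp: mart_def)
  then show ?thesis by (simp add: Span_const)
qed

lemma Span_mart': "Span (\<Delta> \<times> \<Delta>) (mart \<Delta> v)"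
proof (cases "v \<in> \<Delta>")
  case True
  then have "insert v (below \<Delta> v) \<subseteq> \<Delta>" using below_subset by auto
  then show ?thesis by (intro Span_mono[OF Span_mart]) auto
next
  case False
  then have "mart \<Delta> v = (\<lambda>X. 0)" by (intro ext) (auto simp: mart_def)
  then show ?thesis by (simp add: Span_const)
qed

lemma Span_dev: "Span (\<Delta> \<times> \<Delta>) (dev \<Delta> v)"
proof (cases "v \<in> \<Delta>")
  case True
  have "Span (\<Delta> \<times> \<Delta>) (\<lambda>X. mon \<Delta> X - (1 / c) * mon (\<Delta> - {v}) X)"
    by (intro Span_cmult Span_diff Span_mono_set) auto
  then show ?thesis using True unfolding dev_def by simp
next
  case False
  then have "dev \<Delta> v = (\<lambda>X. 0)" by (intro ext) (auto simp: dev_def)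
  then show ?thesis by (simp add: Span_const)
qed

lemma sum_mart:
  assumes "\<Delta> \<in> TS"
  shows "(\<Sum>v\<in>V. mart \<Delta> v X) = J \<Delta> X"
proof -
  have "\<exists>x y z. \<Delta> = {x, y, z} \<and> prec x y \<and> prec y z"
  proof -
    obtain x y z where L: "\<Delta> = {x, y, z}" "x \<noteq> y" "x \<noteq> z" "y \<noteq> z" using TS[OF assms] card_3_iff by metis
    consider "prec x y" "prec y z" | "prec x z" "prec z y" | "prec y x" "prec x z" | "prec y z" "prec z x" | "prec z x" "prec x y" | "prec z y" "prec y x"
      using prec_total[OF L(2)] prec_total[OF L(3)] prec_total[OF L(4)] by argo
    then show ?thesis
    proof cases
      case 1 then show ?thesis unfolding L(1) by (intro exI[of _ x] exI[of _ y] exI[of _ z]) auto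
    next
      case 2 then show ?thesis unfolding L(1) by (intro exI[of _ x] exI[of _ z] exI[of _ y]) auto
    next
      case 3 then show ?thesis unfolding L(1) by (intro exI[of _ y] exI[of _ x] exI[of _ z]) auto
    next
      case 4 then show ?thesis unfolding L(1) by (intro exI[of _ y] exI[of _ z] exI[of _ x]) auto
    next
      case 5 then show ?thesis unfolding L(1) by (intro exI[of _ z] exI[of _ x] exI[of _ y]) auto
    next
      case 6 then show ?thesis unfolding L(1) by (intro exI[of _ z] exI[of _ y] exI[of _ x]) auto
    qed
  qed
  then obtain x y z where L: "\<Delta> = {x, y, z}" "prec x y" "prec y z" by blast
  then have L': "prec x z" "x \<noteq> y" "x \<noteq> z" "y \<noteq> z" using prec_trans prec_irrefl by blast+
  have V: "x \<in> V" "y \<in> V" "z \<in> V" using TS[OF assms] L(1) by auto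
  have bel: "below \<Delta> x = {}" "below \<Delta> y = {x}" "below \<Delta> z = {x, y}"
    using L L' prec_asym prec_irrefl unfolding below_def by blast+
  have "(\<Sum>v\<in>V. mart \<Delta> v X) = (\<Sum>v\<in>\<Delta>. mart \<Delta> v X)"
    using TS[OF assms] finite_V by (intro sum.mono_neutral_right) (auto simp: mart_def)
  also have "\<dots> = mart \<Delta> x X + mart \<Delta> y X + mart \<Delta> z X"
    using L' by (subst (2) L(1)) simp
  \<comment> \<open>The other two terms telescope: the conditional probability
    \<open>mon {x, y} X / c\<close> cancels.\<close>
  also have "mart \<Delta> x X = 0" by (simp add: mart_def bel)
  also have "mart \<Delta> y X = (1 / c) * (mon {x, y} X - 1 / c)"
  proof -
    have "insert y {x} = {x, y}" "y \<in> \<Delta>" "card {x} = 1" using L(1) by auto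
    then show ?thesis by (simp only: mart_def bel mon_singleton) simp
  qed
  also have "mart \<Delta> z X = mon \<Delta> X - mon {x, y} X / c"
  proof -
    have "insert z {x, y} = \<Delta>" "z \<in> \<Delta>" "card {x, y} = 2" using L(1) L' by auto
    then show ?thesis by (simp only: mart_def bel) simp
  qed
  also have "0 + (1 / c) * (mon {x, y} X - 1 / c) + (mon \<Delta> X - mon {x, y} X / c) = J \<Delta> X"
    by (simp add: J_def p_def power2_eq_square right_diff_distrib)
  finally show ?thesis .
qed

end

context colouring
begin

lemma avg_mult_meet_le_1:
  assumes "Span (S \<times> S) f" "Span (T \<times> T) g" "S \<subseteq> V" "T \<subseteq> V" "avg f = 0" "S \<inter> T \<subseteq> {v}"
  shows "avg (\<lambda>X. f X * g X) = 0"
proof -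
  have sub: "S \<times> S \<subseteq> V \<times> V" "T \<times> T \<subseteq> V \<times> V" using assms(3,4) by auto
  have "finite (T \<times> T)" using finite_subset[OF assms(4) finite_V] by (intro finite_cartesian_product)
  then have "indep (S \<times> S) (T \<times> T)" by (rule indep_meet_le_1[OF _ sub order_refl order_refl assms(6)])
  then have "avg (\<lambda>X. f X * g X) = avg f * avg g" by (intro avg_indep[OF assms(1,2)] sub)
  then show ?thesis using assms(5) by simp
qed

lemma abs_avg_mult_le_1:
  assumes "\<And>X. \<bar>f X\<bar> \<le> (1::real)" "\<And>X. \<bar>g X\<bar> \<le> 1"
  shows "\<bar>avg (\<lambda>X. f X * g X)\<bar> \<le> 1"
  by (rule abs_avg_le_1) (simp add: abs_mult mult_le_one assms)

end

context triple_system
begin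

abbreviation sum4 :: "('v set \<Rightarrow> 'v set \<Rightarrow> 'v set \<Rightarrow> 'v set \<Rightarrow> real) \<Rightarrow> real" where
  "sum4 f \<equiv> \<Sum>a\<in>TS. \<Sum>b\<in>TS. \<Sum>d\<in>TS. \<Sum>e\<in>TS. f a b d e"

abbreviation joint :: "'v set \<Rightarrow> 'v \<Rightarrow> 'v \<Rightarrow> real" where
  "joint a u v \<equiv> of_bool (u \<in> a \<and> v \<in> a)"

lemma TS_subset: "a \<in> TS \<Longrightarrow> a \<subseteq> V"
  using TS[of a] by blast

lemma sum_joint: "(\<Sum>a\<in>TS. joint a u v) = deg u v"
  by (simp add: deg_def Collect_conj_eq Int_commute Int_assoc)

text \<open>Double counting: there are \<open>deg u v\<close> squared pairs of triangles that both
  contain \<open>u\<close> and \<open>v\<close>.\<close>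

lemma sum_pairs_le:
  assumes "\<And>a b. a \<in> TS \<Longrightarrow> b \<in> TS \<Longrightarrow> f a b \<le> (\<Sum>u\<in>W. joint a u v * joint b u v)"
  shows "(\<Sum>a\<in>TS. \<Sum>b\<in>TS. f a b) \<le> (\<Sum>u\<in>W. (real (deg u v))\<^sup>2)"
proof -
  have "(\<Sum>a\<in>TS. \<Sum>b\<in>TS. f a b) \<le> (\<Sum>a\<in>TS. \<Sum>b\<in>TS. \<Sum>u\<in>W. joint a u v * joint b u v)"
    by (intro sum_mono assms)
  also have "\<dots> = (\<Sum>a\<in>TS. \<Sum>u\<in>W. \<Sum>b\<in>TS. joint a u v * joint b u v)"
    by (rule sum.cong[OF refl], rule sum.swap)
  also have "\<dots> = (\<Sum>u\<in>W. \<Sum>a\<in>TS. \<Sum>b\<in>TS. joint a u v * joint b u v)" by (rule sum.swap)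
  also have "\<dots> = (\<Sum>u\<in>W. (real (deg u v))\<^sup>2)"
    by (simp only: power2_eq_square sum_joint[symmetric] sum_product)
  finally show ?thesis .
qed

lemma one_le_sum_joint:
  assumes "finite W" "u \<in> W" "u \<in> a" "v \<in> a" "u \<in> b" "v \<in> b"
  shows "1 \<le> (\<Sum>u\<in>W. joint a u v * joint b u v)"
proof -
  have "(\<lambda>u. joint a u v * joint b u v) u \<le> (\<Sum>u\<in>W. joint a u v * joint b u v)"
    by (rule member_le_sum[OF assms(2)]) (auto simp: assms(1))
  then show ?thesis using assms by simp
qed

lemma finite_prec: "finite {u\<in>V. prec u v}"
  using finite_V by simp

lemma mart_notin: "v \<notin> a \<Longrightarrow> mart a v X = 0"
  by (simp add: mart_def)

lemma dev_notin: "v \<notin> a \<Longrightarrow> dev a v X = 0"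
  by (simp add: dev_def)

text \<open>If the two triangles share no vertex of \<open>W\<close> besides \<open>v\<close>, then \<open>f\<close> and \<open>g\<close> are independent.\<close>

lemma abs_avg_mult_le_joint:
  assumes f: "Span (S \<times> S) f" "avg f = 0" "\<And>X. \<bar>f X\<bar> \<le> 1" and g: "Span (T \<times> T) g" "\<And>X. \<bar>g X\<bar> \<le> 1"
    and V: "S \<subseteq> V" "T \<subseteq> V" and W: "finite W"
    and meet: "\<And>u. u \<in> S \<Longrightarrow> u \<in> T \<Longrightarrow> u \<noteq> v \<Longrightarrow> v \<in> a \<Longrightarrow> v \<in> b \<Longrightarrow> u \<in> W \<and> u \<in> a \<and> u \<in> b"
    and notin: "\<And>X. v \<notin> a \<Longrightarrow> f X = 0" "\<And>X. v \<notin> b \<Longrightarrow> g X = 0"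
  shows "\<bar>avg (\<lambda>X. f X * g X)\<bar> \<le> (\<Sum>u\<in>W. joint a u v * joint b u v)"
proof -
  consider "v \<notin> a" | "v \<notin> b" | "S \<inter> T \<subseteq> {v}" | u where "v \<in> a" "v \<in> b" "u \<in> S" "u \<in> T" "u \<noteq> v" by blast
  then show ?thesis
  proof cases
    case 3
    then have "avg (\<lambda>X. f X * g X) = 0" by (intro avg_mult_meet_le_1[OF f(1) g(1) V f(2)])
    then show ?thesis by (simp add: sum_nonneg)
  next
    case 4
    then have "u \<in> W" "u \<in> a" "u \<in> b" using meet by blast+
    from one_le_sum_joint[OF W this(1,2) 4(1) this(3) 4(2)] abs_avg_mult_le_1[of f g, OF f(3) g(2)]
    show ?thesis by linarith
  qed (simp_all add: notin sum_nonneg)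
qed

lemma mart_support_subset: "a \<in> TS \<Longrightarrow> v \<in> V \<Longrightarrow> insert v (below a v) \<subseteq> V"
  using TS_subset[of a] below_subset[of a v] by blast

lemma avg_mart_mart_le:
  assumes "a \<in> TS" "b \<in> TS" "v \<in> V"
  shows "\<bar>avg (\<lambda>X. mart a v X * mart b v X)\<bar> \<le> (\<Sum>u\<in>{u\<in>V. prec u v}. joint a u v * joint b u v)"
  using TS_subset[OF assms(1)]
  by (intro abs_avg_mult_le_joint[OF Span_mart avg_mart abs_mart_le Span_mart abs_mart_le] mart_support_subset assms finite_prec mart_notin)
    (auto simp: below_def)

text \<open>One martingale factor suffices to restrict to predecessors: a common vertex other than
  \<open>v\<close> lies in its support.\<close>

lemma avg_mart_dev_le:
  assumes "a \<in> TS" "b \<in> TS" "v \<in> V"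
  shows "\<bar>avg (\<lambda>X. mart a v X * dev b v X)\<bar> \<le> (\<Sum>u\<in>{u\<in>V. prec u v}. joint a u v * joint b u v)"
  using TS_subset[OF assms(1)]
  by (intro abs_avg_mult_le_joint[OF Span_mart avg_mart abs_mart_le Span_dev abs_dev_le] mart_support_subset TS_subset assms
      finite_prec mart_notin dev_notin) (auto simp: below_def)

lemma avg_dev_dev_le:
  assumes "a \<in> TS" "b \<in> TS" "v \<in> V"
  shows "\<bar>avg (\<lambda>X. dev a v X * dev b v X)\<bar> \<le> (\<Sum>u\<in>V - {v}. joint a u v * joint b u v)"
  using TS_subset[OF assms(1)] finite_V
  by (intro abs_avg_mult_le_joint[OF Span_dev avg_dev abs_dev_le Span_dev abs_dev_le] TS_subset assms dev_notin) auto

text \<open>Recolouring \<open>v'\<close> leaves \<open>mart a v\<close> unchanged, as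
  \<open>v'\<close> does not precede \<open>v\<close>, and averages \<open>dev b v'\<close> to
  zero.\<close>

lemma avg_mart_dev_eq_0:
  assumes "b \<in> TS" "v' \<in> V" "v' \<noteq> v" "\<not> prec v' v"
  shows "avg (\<lambda>X. mart a v X * dev b v' X) = 0"
proof (rule avg_zero[OF assms(2)])
  fix X assume X: "X \<in> colourings"
  show "(\<Sum>k\<in>{1..c}. mart a v (X(v' := k)) * dev b v' (X(v' := k))) = 0"
    by (simp only: mart_upd_notin[OF assms(3,4)] sum_distrib_left[symmetric] sum_dev_upd[OF assms(1) X] mult_zero_right)
qed

lemma avg_mart_mart_eq_0':
  assumes "b \<in> TS" "v' \<in> V" "v' \<noteq> v" "\<not> prec v' v"
  shows "avg (\<lambda>X. mart a v X * mart b v' X) = 0"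
proof (rule avg_zero[OF assms(2)])
  fix X assume X: "X \<in> colourings"
  show "(\<Sum>k\<in>{1..c}. mart a v (X(v' := k)) * mart b v' (X(v' := k))) = 0"
    by (simp only: mart_upd_notin[OF assms(3,4)] sum_distrib_left[symmetric] sum_mart_upd[OF assms(1) X] mult_zero_right)
qed

lemma avg_mart_mart_eq_0:
  assumes "a \<in> TS" "b \<in> TS" "v \<in> V" "v' \<in> V" "v \<noteq> v'"
  shows "avg (\<lambda>X. mart a v X * mart b v' X) = 0"
proof (cases "prec v' v")
  case False
  then show ?thesis using assms by (intro avg_mart_mart_eq_0') auto
next
  case True
  then have "avg (\<lambda>X. mart b v' X * mart a v X) = 0" using assms prec_asym by (intro avg_mart_mart_eq_0') auto
  then show ?thesis by (simp only: mult.commute)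
qed

definition mart_mart where "mart_mart v v' = (\<Sum>a\<in>TS. \<Sum>b\<in>TS. \<bar>avg (\<lambda>X. mart a v X * mart b v' X)\<bar>)"
definition mart_dev where "mart_dev v v' = (\<Sum>a\<in>TS. \<Sum>b\<in>TS. \<bar>avg (\<lambda>X. mart a v X * dev b v' X)\<bar>)"
definition dev_dev where "dev_dev v v' = (\<Sum>a\<in>TS. \<Sum>b\<in>TS. \<bar>avg (\<lambda>X. dev a v X * dev b v' X)\<bar>)"

lemma mart_mart_le: "v \<in> V \<Longrightarrow> mart_mart v v \<le> Q v"
  unfolding mart_mart_def Q_def by (intro sum_pairs_le avg_mart_mart_le)
lemma mart_dev_le: "v \<in> V \<Longrightarrow> mart_dev v v \<le> Q v"
  unfolding mart_dev_def Q_def by (intro sum_pairs_le avg_mart_dev_le)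
lemma dev_dev_le: "v \<in> V \<Longrightarrow> dev_dev v v \<le> R v"
  unfolding dev_dev_def R_def by (intro sum_pairs_le avg_dev_dev_le)
lemma mart_mart_eq_0: "v \<in> V \<Longrightarrow> v' \<in> V \<Longrightarrow> v \<noteq> v' \<Longrightarrow> mart_mart v v' = 0"
  unfolding mart_mart_def by (simp add: avg_mart_mart_eq_0)
text \<open>Two vertices cannot precede each other, so one factor vanishes. Together with
  \<open>mart_mart_eq_0\<close> this removes the crossed pairings off the diagonal.\<close>

lemma mart_dev_mult_eq_0: "v \<in> V \<Longrightarrow> v' \<in> V \<Longrightarrow> v \<noteq> v' \<Longrightarrow> mart_dev v v' * mart_dev v' v = 0"
  using prec_asym[of v' v] avg_mart_dev_eq_0[of _ v' v] avg_mart_dev_eq_0[of _ v v'] unfolding mart_dev_def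
  by (cases "prec v' v") simp_all

lemma nonneg: "mart_mart v v' \<ge> 0" "mart_dev v v' \<ge> 0" "dev_dev v v' \<ge> 0" "Q v \<ge> 0" "R v \<ge> 0" "F \<ge> 0" "S4 \<ge> 0" "nconn \<ge> 0"
  unfolding mart_mart_def mart_dev_def dev_dev_def Q_def R_def F_def S4_def nconn_def by (simp_all add: sum_nonneg)

lemma Q_le_R: "Q v \<le> R v"
  unfolding Q_def R_def using finite_V prec_irrefl by (intro sum_mono2) auto

definition QR :: real where "QR = (\<Sum>v\<in>V. Q v * R v)"

abbreviation conn :: "'v set \<Rightarrow> 'v set \<Rightarrow> 'v set \<Rightarrow> 'v set \<Rightarrow> real" where
  "conn a b d e \<equiv> of_bool (conn4 (a \<times> a) (b \<times> b) (d \<times> d) (e \<times> e))"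

lemma sum_nconn_le:
  assumes "\<And>a b d e. a \<in> TS \<Longrightarrow> b \<in> TS \<Longrightarrow> d \<in> TS \<Longrightarrow> e \<in> TS \<Longrightarrow> f a b d e \<le> k * conn a b d e"
  shows "sum4 (\<lambda>a b d e. f a b d e) \<le> k * nconn"
  unfolding nconn_def sum_distrib_left by (intro sum_mono assms)

definition pair_cov where
  "pair_cov v v' a b d e = avg (\<lambda>X. mart a v X * dev b v X * mart d v' X * dev e v' X)
     - avg (\<lambda>X. mart a v X * dev b v X) * avg (\<lambda>X. mart d v' X * dev e v' X)"

text \<open>The martingale factors vanish unless \<open>v \<in> a\<close> and
  \<open>v' \<in> d\<close>. Keeping this indicator makes the later sum over both vertices cost a
  factor 9 instead of the squared number of vertices.\<close>

lemma pair_sum_le: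
  assumes v: "v \<in> V" "v' \<in> V"
  shows "sum4 (\<lambda>a b d e.
      \<bar>pair_cov v v' a b d e\<bar>)
    \<le> sum4 (\<lambda>a b d e. 2 * (of_bool (v \<in> a \<and> v' \<in> d) * conn a b d e)) + mart_mart v v' * dev_dev v v' + mart_dev v v' * mart_dev v' v"
proof -
  have "\<bar>pair_cov v v' a b d e\<bar>
    \<le> 2 * (of_bool (v \<in> a \<and> v' \<in> d) * conn a b d e) + \<bar>avg (\<lambda>X. mart a v X * mart d v' X)\<bar> * \<bar>avg (\<lambda>X. dev b v X * dev e v' X)\<bar>
      + \<bar>avg (\<lambda>X. mart a v X * dev e v' X)\<bar> * \<bar>avg (\<lambda>X. mart d v' X * dev b v X)\<bar>"
    if T: "a \<in> TS" "b \<in> TS" "d \<in> TS" "e \<in> TS" for a b d e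
  proof (cases "v \<in> a \<and> v' \<in> d")
    case True
    show ?thesis
      using abs_avg_mult4_le[OF Span_mart'[of a v] Span_dev[of b v] Span_mart'[of d v'] Span_dev[of e v']
        avg_mart[OF T(1) v(1)] avg_dev[OF T(2) v(1)] avg_mart[OF T(3) v(2)] avg_dev[OF T(4) v(2)]
        sq_subset[OF T(1)] sq_subset[OF T(2)] sq_subset[OF T(3)] sq_subset[OF T(4)] abs_mart_le abs_dev_le abs_mart_le abs_dev_le]
        True by (simp add: pair_cov_def mult.commute[of "dev b v _"])
  next
    case False
    have "pair_cov v v' a b d e = 0"
      unfolding pair_cov_def using False mart_notin[of v a] mart_notin[of v' d] by auto
    then show ?thesis by (simp only: abs_zero) (intro add_nonneg_nonneg mult_nonneg_nonneg abs_ge_zero; simp)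
  qed
  then have "sum4 (\<lambda>a b d e.
      \<bar>pair_cov v v' a b d e\<bar>)
    \<le> sum4 (\<lambda>a b d e. 2 * (of_bool (v \<in> a \<and> v' \<in> d) * conn a b d e) + \<bar>avg (\<lambda>X. mart a v X * mart d v' X)\<bar> * \<bar>avg (\<lambda>X. dev b v X * dev e v' X)\<bar>
      + \<bar>avg (\<lambda>X. mart a v X * dev e v' X)\<bar> * \<bar>avg (\<lambda>X. mart d v' X * dev b v X)\<bar>)"
    by (intro sum_mono)
  also have "\<dots> = sum4 (\<lambda>a b d e. 2 * (of_bool (v \<in> a \<and> v' \<in> d) * conn a b d e)) 
    + sum4 (\<lambda>a b d e. \<bar>avg (\<lambda>X. mart a v X * mart d v' X)\<bar> * \<bar>avg (\<lambda>X. dev b v X * dev e v' X)\<bar>)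
    + sum4 (\<lambda>a b d e. \<bar>avg (\<lambda>X. mart a v X * dev e v' X)\<bar> * \<bar>avg (\<lambda>X. mart d v' X * dev b v X)\<bar>)"
    by (simp only: sum.distrib)
  also have "sum4 (\<lambda>a b d e. \<bar>avg (\<lambda>X. mart a v X * mart d v' X)\<bar> * \<bar>avg (\<lambda>X. dev b v X * dev e v' X)\<bar>) = mart_mart v v' * dev_dev v v'"
    unfolding mart_mart_def dev_dev_def by (rule sum_mult_cross(1))
  also have "sum4 (\<lambda>a b d e. \<bar>avg (\<lambda>X. mart a v X * dev e v' X)\<bar> * \<bar>avg (\<lambda>X. mart d v' X * dev b v X)\<bar>) 
     = mart_dev v v' * (\<Sum>b\<in>TS. \<Sum>d\<in>TS. \<bar>avg (\<lambda>X. mart d v' X * dev b v X)\<bar>)"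
    unfolding mart_dev_def by (rule sum_mult_cross(2))
  also have "(\<Sum>b\<in>TS. \<Sum>d\<in>TS. \<bar>avg (\<lambda>X. mart d v' X * dev b v X)\<bar>) = mart_dev v' v"
    unfolding mart_dev_def by (rule sum.swap)
  finally show ?thesis .
qed

definition M :: "'v \<Rightarrow> ('v \<Rightarrow> nat) \<Rightarrow> real" where "M v X = (\<Sum>a\<in>TS. mart a v X)"
definition D :: "'v \<Rightarrow> ('v \<Rightarrow> nat) \<Rightarrow> real" where "D v X = (\<Sum>a\<in>TS. dev a v X)"
text \<open>Plays the role of the Stein kernel: its average is the variance
  (\<open>avg_\<Gamma>\<close>), and its fluctuation about that value enters the normal
  approximation error.\<close>

definition \<Gamma> :: "('v \<Rightarrow> nat) \<Rightarrow> real" where "\<Gamma> X = (\<Sum>v\<in>V. M v X * D v X)"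

lemma cross_le: "v \<in> V \<Longrightarrow> mart_mart v v * dev_dev v v + mart_dev v v * mart_dev v v \<le> 2 * (Q v * R v)"
proof -
  assume v: "v \<in> V"
  have "mart_mart v v * dev_dev v v \<le> Q v * R v" by (intro mult_mono mart_mart_le dev_dev_le v nonneg)
  moreover have "mart_dev v v * mart_dev v v \<le> Q v * R v"
    by (intro mult_mono mart_dev_le order_trans[OF mart_dev_le Q_le_R] v nonneg)
  ultimately show ?thesis by simp
qed

lemma sum_mem_TS: "a \<in> TS \<Longrightarrow> (\<Sum>v\<in>V. of_bool (v \<in> a)) = (3::real)"
  using TS[of a] finite_V by (simp add: Int_absorb1)

lemma avg_mult_MD: "avg (\<lambda>X. M v X * D v X) = (\<Sum>a\<in>TS. \<Sum>b\<in>TS. avg (\<lambda>X. mart a v X * dev b v X))"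
  unfolding M_def D_def by (rule avg_mult2)

text \<open>Expanding the square leaves covariances. A connected quadruple costs
  \<open>2 * 3 * 3 = 18\<close>, three vertices for each of two triangles, and the crossed pairings
  survive only for \<open>v = v'\<close>, where \<open>cross_le\<close> applies.\<close>

lemma avg_\<Gamma>_var:
  "avg (\<lambda>X. (\<Gamma> X)\<^sup>2) - (avg \<Gamma>)\<^sup>2 \<le> 18 * nconn + 2 * QR"
proof -
  have 1: "avg (\<lambda>X. (\<Gamma> X)\<^sup>2) = (\<Sum>v\<in>V. \<Sum>v'\<in>V. avg (\<lambda>X. (M v X * D v X) * (M v' X * D v' X)))"
    unfolding \<Gamma>_def power2_eq_square by (rule avg_mult2)
  have 2: "(avg \<Gamma>)\<^sup>2 = (\<Sum>v\<in>V. \<Sum>v'\<in>V. avg (\<lambda>X. M v X * D v X) * avg (\<lambda>X. M v' X * D v' X))"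
    unfolding \<Gamma>_def[abs_def] avg_sum power2_eq_square sum_product ..
  have "avg (\<lambda>X. (\<Gamma> X)\<^sup>2) - (avg \<Gamma>)\<^sup>2 = (\<Sum>v\<in>V. \<Sum>v'\<in>V. avg (\<lambda>X. (M v X * D v X) * (M v' X * D v' X)) 
      - avg (\<lambda>X. M v X * D v X) * avg (\<lambda>X. M v' X * D v' X))"
    unfolding 1 2 by (simp only: sum_subtractf)
  also have "\<dots> = (\<Sum>v\<in>V. \<Sum>v'\<in>V. \<Sum>a\<in>TS. \<Sum>b\<in>TS. \<Sum>d\<in>TS. \<Sum>e\<in>TS. pair_cov v v' a b d e)"
  proof (intro sum.cong refl)
    fix v v'
    have "avg (\<lambda>X. (M v X * D v X) * (M v' X * D v' X)) = avg (\<lambda>X. M v X * D v X * M v' X * D v' X)"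
      by (simp only: mult.assoc)
    also have "\<dots> = 
       sum4 (\<lambda>a b d e. avg (\<lambda>X. mart a v X * dev b v X * mart d v' X * dev e v' X))"
      unfolding M_def D_def by (rule avg_mult4)
    finally have "avg (\<lambda>X. (M v X * D v X) * (M v' X * D v' X)) = 
       sum4 (\<lambda>a b d e. avg (\<lambda>X. mart a v X * dev b v X * mart d v' X * dev e v' X))" .
    moreover have "avg (\<lambda>X. M v X * D v X) * avg (\<lambda>X. M v' X * D v' X) = 
       sum4 (\<lambda>a b d e. avg (\<lambda>X. mart a v X * dev b v X) * avg (\<lambda>X. mart d v' X * dev e v' X))"
      unfolding avg_mult_MD by (rule sum_mult_cross(3)[symmetric])
    ultimately show "avg (\<lambda>X. (M v X * D v X) * (M v' X * D v' X)) - avg (\<lambda>X. M v X * D v X) * avg (\<lambda>X. M v' X * D v' X)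
       = sum4 (\<lambda>a b d e. pair_cov v v' a b d e)" by (simp only: sum_subtractf pair_cov_def)
  qed
  also have "\<dots> \<le> (\<Sum>v\<in>V. \<Sum>v'\<in>V. \<Sum>a\<in>TS. \<Sum>b\<in>TS. \<Sum>d\<in>TS. \<Sum>e\<in>TS. \<bar>pair_cov v v' a b d e\<bar>)"
    by (intro sum_mono abs_ge_self)
  also have "\<dots> \<le> (\<Sum>v\<in>V. \<Sum>v'\<in>V. sum4 (\<lambda>a b d e. 2 * (of_bool (v \<in> a \<and> v' \<in> d) * conn a b d e)) + (mart_mart v v' * dev_dev v v' + mart_dev v v' * mart_dev v' v))"
    by (intro sum_mono) (use pair_sum_le in \<open>simp only: add.assoc\<close>)
  also have "\<dots> = (\<Sum>v\<in>V. \<Sum>v'\<in>V. \<Sum>a\<in>TS. \<Sum>b\<in>TS. \<Sum>d\<in>TS. \<Sum>e\<in>TS. 2 * (of_bool (v \<in> a \<and> v' \<in> d) * conn a b d e)) 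
     + (\<Sum>v\<in>V. \<Sum>v'\<in>V. mart_mart v v' * dev_dev v v' + mart_dev v v' * mart_dev v' v)"
    by (simp only: sum.distrib)
  also have "(\<Sum>v\<in>V. \<Sum>v'\<in>V. mart_mart v v' * dev_dev v v' + mart_dev v v' * mart_dev v' v) = (\<Sum>v\<in>V. mart_mart v v * dev_dev v v + mart_dev v v * mart_dev v v)"
  proof (intro sum.cong refl)
    fix v assume v: "v \<in> V"
    have "(\<Sum>v'\<in>V. mart_mart v v' * dev_dev v v' + mart_dev v v' * mart_dev v' v) = (\<Sum>v'\<in>{v}. mart_mart v v' * dev_dev v v' + mart_dev v v' * mart_dev v' v)"
    proof (rule sum.mono_neutral_right)
      show "\<forall>i\<in>V - {v}. mart_mart v i * dev_dev v i + mart_dev v i * mart_dev i v = 0"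
      proof
        fix i assume "i \<in> V - {v}"
        then have i: "i \<in> V" "v \<noteq> i" by auto
        then show "mart_mart v i * dev_dev v i + mart_dev v i * mart_dev i v = 0"
          by (simp only: mart_mart_eq_0[OF v i] mart_dev_mult_eq_0[OF v i] mult_zero_left add_0_left)
      qed
    qed (use v finite_V in auto)
    then show "(\<Sum>v'\<in>V. mart_mart v v' * dev_dev v v' + mart_dev v v' * mart_dev v' v) = mart_mart v v * dev_dev v v + mart_dev v v * mart_dev v v" by simp
  qed
  also have "\<dots> \<le> 2 * QR"
    unfolding QR_def sum_distrib_left by (intro sum_mono cross_le)
  also have "(\<Sum>v\<in>V. \<Sum>v'\<in>V. \<Sum>a\<in>TS. \<Sum>b\<in>TS. \<Sum>d\<in>TS. \<Sum>e\<in>TS. 2 * (of_bool (v \<in> a \<and> v' \<in> d) * conn a b d e)) 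
     = sum4 (\<lambda>a b d e. \<Sum>v\<in>V. \<Sum>v'\<in>V. 2 * (of_bool (v \<in> a \<and> v' \<in> d) * conn a b d e))"
    by (simp only: sum.swap[of _ TS V])
  also have "\<dots> \<le> 18 * nconn"
  proof (rule sum_nconn_le)
    fix a b d e assume T: "a \<in> TS" "d \<in> TS"
    have "(\<Sum>v\<in>V. \<Sum>v'\<in>V. 2 * (of_bool (v \<in> a \<and> v' \<in> d) * conn a b d e)) = 
      (\<Sum>v\<in>V. \<Sum>v'\<in>V. of_bool (v \<in> a) * of_bool (v' \<in> d)) * (2 * conn a b d e)"
      by (simp only: sum_distrib_right of_bool_conj mult.assoc mult.left_commute[of 2])
    also have "(\<Sum>v\<in>V. \<Sum>v'\<in>V. of_bool (v \<in> a) * of_bool (v' \<in> d)) = (9::real)"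
      unfolding sum_product[symmetric] by (simp add: sum_mem_TS T)
    finally show "(\<Sum>v\<in>V. \<Sum>v'\<in>V. 2 * (of_bool (v \<in> a \<and> v' \<in> d) * conn a b d e)) \<le> 18 * conn a b d e" by simp
  qed
  finally show ?thesis by simp
qed

text \<open>The diagonal version: a quadruple is counted for at most three vertices, whence
  \<open>6 = 2 * 3\<close>. Two of the three \<open>QR\<close> come from the crossed pairings and
  one from the squared mean.\<close>

lemma sum_avg_MD_square_le: "(\<Sum>v\<in>V. avg (\<lambda>X. (M v X * D v X)\<^sup>2)) \<le> 6 * nconn + 3 * QR"
proof -
  have "avg (\<lambda>X. (M v X * D v X)\<^sup>2) \<le> sum4 (\<lambda>a b d e. 2 * (of_bool (v \<in> a \<and> v \<in> d) * conn a b d e)) + 3 * (Q v * R v)"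
    if v: "v \<in> V" for v
  proof -
    have "avg (\<lambda>X. (M v X * D v X)\<^sup>2) = avg (\<lambda>X. M v X * D v X * M v X * D v X)"
      by (simp only: power2_eq_square mult.assoc)
    also have "\<dots> = sum4 (\<lambda>a b d e. avg (\<lambda>X. mart a v X * dev b v X * mart d v X * dev e v X))"
      unfolding M_def D_def by (rule avg_mult4)
    also have "\<dots> = sum4 (\<lambda>a b d e. pair_cov v v a b d e + avg (\<lambda>X. mart a v X * dev b v X) * avg (\<lambda>X. mart d v X * dev e v X))"
      by (simp add: pair_cov_def)
    also have "\<dots> = sum4 (\<lambda>a b d e. pair_cov v v a b d e) 
       + (\<Sum>a\<in>TS. \<Sum>b\<in>TS. avg (\<lambda>X. mart a v X * dev b v X)) * (\<Sum>d\<in>TS. \<Sum>e\<in>TS. avg (\<lambda>X. mart d v X * dev e v X))"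
      unfolding sum_mult_cross(3)[symmetric] by (simp only: sum.distrib)
    also have "\<dots> \<le> sum4 (\<lambda>a b d e. \<bar>pair_cov v v a b d e\<bar>) + mart_dev v v * mart_dev v v"
    proof (rule add_mono)
      have "\<bar>\<Sum>a\<in>TS. \<Sum>b\<in>TS. avg (\<lambda>X. mart a v X * dev b v X)\<bar> \<le> mart_dev v v"
        unfolding mart_dev_def by (rule order_trans[OF sum_abs]) (intro sum_mono sum_abs)
      then show "(\<Sum>a\<in>TS. \<Sum>b\<in>TS. avg (\<lambda>X. mart a v X * dev b v X)) * (\<Sum>d\<in>TS. \<Sum>e\<in>TS. avg (\<lambda>X. mart d v X * dev e v X)) \<le> mart_dev v v * mart_dev v v"
        using mult_mono[of "\<bar>\<Sum>a\<in>TS. \<Sum>b\<in>TS. avg (\<lambda>X. mart a v X * dev b v X)\<bar>" "mart_dev v v" "\<bar>\<Sum>a\<in>TS. \<Sum>b\<in>TS. avg (\<lambda>X. mart a v X * dev b v X)\<bar>" "mart_dev v v"]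
        nonneg(2)[of v v] by (simp only: abs_mult_self abs_ge_zero simp_thms)
    qed (intro sum_mono abs_ge_self)
    also have "\<dots> \<le> (sum4 (\<lambda>a b d e. 2 * (of_bool (v \<in> a \<and> v \<in> d) * conn a b d e)) + mart_mart v v * dev_dev v v + mart_dev v v * mart_dev v v) + Q v * R v"
      by (intro add_mono pair_sum_le v mult_mono mart_dev_le order_trans[OF mart_dev_le Q_le_R] nonneg)
    finally show ?thesis using cross_le[OF v] by linarith
  qed
  then have "(\<Sum>v\<in>V. avg (\<lambda>X. (M v X * D v X)\<^sup>2)) \<le> (\<Sum>v\<in>V. sum4 (\<lambda>a b d e. 2 * (of_bool (v \<in> a \<and> v \<in> d) * conn a b d e)) + 3 * (Q v * R v))"
    by (rule sum_mono)
  also have "\<dots> = (\<Sum>v\<in>V. \<Sum>a\<in>TS. \<Sum>b\<in>TS. \<Sum>d\<in>TS. \<Sum>e\<in>TS. 2 * (of_bool (v \<in> a \<and> v \<in> d) * conn a b d e)) + 3 * QR"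
    by (simp only: sum.distrib QR_def sum_distrib_left)
  also have "(\<Sum>v\<in>V. \<Sum>a\<in>TS. \<Sum>b\<in>TS. \<Sum>d\<in>TS. \<Sum>e\<in>TS. 2 * (of_bool (v \<in> a \<and> v \<in> d) * conn a b d e)) 
     = sum4 (\<lambda>a b d e. \<Sum>v\<in>V. 2 * (of_bool (v \<in> a \<and> v \<in> d) * conn a b d e))"
    by (simp only: sum.swap[of _ TS V])
  also have "\<dots> \<le> 6 * nconn"
  proof (rule sum_nconn_le)
    fix a b d e assume T: "a \<in> TS"
    have "(\<Sum>v\<in>V. 2 * (of_bool (v \<in> a \<and> v \<in> d) * conn a b d e)) \<le> (\<Sum>v\<in>V. of_bool (v \<in> a) * (2 * conn a b d e))"
      by (intro sum_mono) simp
    also have "\<dots> = 3 * (2 * conn a b d e)" by (simp only: sum_distrib_right[symmetric] sum_mem_TS[OF T])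
    finally show "(\<Sum>v\<in>V. 2 * (of_bool (v \<in> a \<and> v \<in> d) * conn a b d e)) \<le> 6 * conn a b d e" by simp
  qed
  finally show ?thesis by simp
qed

lemma sum_avg_D_square_le: "(\<Sum>v\<in>V. avg (\<lambda>X. (D v X)\<^sup>2)) \<le> F"
  unfolding F_def
proof (rule sum_mono)
  fix v assume v: "v \<in> V"
  have "avg (\<lambda>X. (D v X)\<^sup>2) = (\<Sum>a\<in>TS. \<Sum>b\<in>TS. avg (\<lambda>X. dev a v X * dev b v X))"
    unfolding D_def power2_eq_square by (rule avg_mult2)
  also have "\<dots> \<le> dev_dev v v" unfolding dev_dev_def by (intro sum_mono abs_ge_self)
  also have "\<dots> \<le> R v" by (rule dev_dev_le[OF v])
  finally show "avg (\<lambda>X. (D v X)\<^sup>2) \<le> R v" .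
qed

end

section \<open>Variance, fourth cumulant and connected quadruples\<close>

lemma abs_mult_le_AM:
  fixes x y l :: real
  assumes "l > 0"
  shows "\<bar>x * y\<bar> \<le> (l * x\<^sup>2 + y\<^sup>2 / l) / 2"
proof -
  have "0 \<le> (l * \<bar>x\<bar> - \<bar>y\<bar>)\<^sup>2" by simp
  also have "\<dots> = l * (l * x\<^sup>2) + y\<^sup>2 - 2 * l * \<bar>x * y\<bar>" by (simp add: power2_diff abs_mult power2_eq_square algebra_simps)
  finally have "2 * l * \<bar>x * y\<bar> \<le> l * (l * x\<^sup>2 + y\<^sup>2 / l)" using assms by (simp add: algebra_simps)
  then have "l * (2 * \<bar>x * y\<bar>) \<le> l * (l * x\<^sup>2 + y\<^sup>2 / l)" by (simp add: algebra_simps)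
  then show ?thesis using assms by simp
qed

context triple_system
begin

lemma prb_TS: "a \<in> TS \<Longrightarrow> prb (a \<times> a) = p"
  using rk_triple[of a] TS[of a] prb_eq_rk[OF sq_subset[of a]] by (simp add: p_def)

lemma avg_J: "a \<in> TS \<Longrightarrow> avg (J a) = 0"
  unfolding J_def[abs_def] avg_diff using prb_TS by (simp add: mon_def[abs_def] prb_def)

lemma Span_J: "Span (a \<times> a) (J a)"
  unfolding J_def[abs_def] by (intro Span_diff Span_const Span_mono_set order_refl)

lemma avg_JJ:
  assumes "a \<in> TS" "b \<in> TS"
  shows "avg (\<lambda>X. J a X * J b X) = prb (a \<times> a \<union> b \<times> b) - p\<^sup>2"
proof -
  have "(\<lambda>X. J a X * J b X) = (\<lambda>X. of_bool (Mon (a \<times> a \<union> b \<times> b) X) - p * mon a X - p * mon b X + p\<^sup>2)"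
    unfolding J_def mon_def by (simp only: Mon_Un of_bool_conj power2_eq_square left_diff_distrib right_diff_distrib) (simp add: algebra_simps)
  then have "avg (\<lambda>X. J a X * J b X) = prb (a \<times> a \<union> b \<times> b) - p * avg (mon a) - p * avg (mon b) + p\<^sup>2"
    by (simp only: avg_add avg_diff avg_cmult avg_const prb_def)
  moreover have "avg (mon a) = p" "avg (mon b) = p" using assms[THEN prb_TS] by (simp_all add: mon_def[abs_def] prb_def)
  ultimately show ?thesis by (simp add: power2_eq_square)
qed

text \<open>Ordered pairs, so that each triangle contains six of them; hence the 6 in
  \<open>var_ge\<close> and \<open>S4_le\<close>.\<close>

definition P :: "('v \<times> 'v) set" where "P = (SIGMA v:V. V - {v})"

lemma finite_P: "finite P"
  unfolding P_def using finite_V by (intro finite_SigmaI) auto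

lemma F_eq_P: "F = (\<Sum>(v, u)\<in>P. (real (deg u v))\<^sup>2)"
  unfolding F_def R_def P_def using finite_V by (subst sum.Sigma) auto

lemma S4_eq_P: "S4 = (\<Sum>(v, u)\<in>P. (real (deg u v)) ^ 4)"
  unfolding S4_def P_def using finite_V by (subst sum.Sigma) auto

lemma sum_joint_P:
  assumes "a \<in> TS"
  shows "(\<Sum>(v, u)\<in>P. joint a u v) = 6"
proof -
  have "(\<Sum>u\<in>V - {v}. joint a u v) = 2 * of_bool (v \<in> a)" for v
  proof (cases "v \<in> a")
    case True
    have "(V - {v}) \<inter> a = a - {v}" using TS_subset[OF assms] by blast
    then show ?thesis using True TS[OF assms] finite_V by simp
  qed simp
  then have "(\<Sum>v\<in>V. \<Sum>u\<in>V - {v}. joint a u v) = 2 * (\<Sum>v\<in>V. of_bool (v \<in> a))"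
    by (simp only: sum_distrib_left)
  also have "\<dots> = 6" by (simp only: sum_mem_TS[OF assms])
  finally show ?thesis unfolding P_def using finite_V by (subst (asm) sum.Sigma) auto
qed

lemma F_eq: "F = (\<Sum>a\<in>TS. \<Sum>b\<in>TS. \<Sum>(v, u)\<in>P. joint a u v * joint b u v)"
proof -
  have "F = (\<Sum>e\<in>P. \<Sum>a\<in>TS. \<Sum>b\<in>TS. joint a (snd e) (fst e) * joint b (snd e) (fst e))"
    unfolding F_eq_P case_prod_unfold by (simp only: power2_eq_square sum_joint[symmetric] sum_product)
  also have "\<dots> = (\<Sum>a\<in>TS. \<Sum>b\<in>TS. \<Sum>e\<in>P. joint a (snd e) (fst e) * joint b (snd e) (fst e))"
    by (simp only: sum.swap[of _ TS P])
  finally show ?thesis by (simp only: case_prod_unfold)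
qed

lemma rk_pair_bounds:
  assumes "a \<in> TS" "b \<in> TS"
  shows "rk (a \<times> a \<union> b \<times> b) \<le> 4"
    and "u \<in> a \<Longrightarrow> v \<in> a \<Longrightarrow> u \<in> b \<Longrightarrow> v \<in> b \<Longrightarrow> u \<noteq> v \<Longrightarrow> rk (a \<times> a \<union> b \<times> b) \<le> 3"
proof -
  have r: "rk (a \<times> a) = 2" "rk (b \<times> b) = 2" using assms TS by (auto intro!: rk_triple)
  show "rk (a \<times> a \<union> b \<times> b) \<le> 4"
    using rk_Un_le[OF sq_subset[OF assms(1)] sq_subset[OF assms(2)]] r by simp
  show "rk (a \<times> a \<union> b \<times> b) \<le> 3" if "u \<in> a" "v \<in> a" "u \<in> b" "v \<in> b" "u \<noteq> v"
  proof -
    have "rk {(u, v)} = 1" using that TS_subset[OF assms(1)] by (intro rk_singleton) auto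
    then show ?thesis
      using rk_Un_Int_le[OF sq_subset[OF assms(1)] sq_subset[OF assms(2)], of "{(u, v)}"] that r by simp
  qed
qed

lemma sum_P_joint_le_6: "a \<in> TS \<Longrightarrow> (\<Sum>(v, u)\<in>P. joint a u v * joint b u v) \<le> 6"
proof -
  assume a: "a \<in> TS"
  have "(\<Sum>(v, u)\<in>P. joint a u v * joint b u v) \<le> (\<Sum>(v, u)\<in>P. joint a u v)" by (intro sum_mono) auto
  then show ?thesis using sum_joint_P[OF a] by simp
qed

text \<open>A common edge lowers the rank of the union to at most 3, and
  \<open>c^-3 - c^-4 >= c^-4\<close> since \<open>c >= 2\<close>; the division by 6 allows for up to
  six common ordered pairs. Covariances are never negative, so nothing cancels in the
  variance.\<close>

lemma avg_JJ_ge: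
  assumes "a \<in> TS" "b \<in> TS"
  shows "(1 / c) ^ 4 / 6 * (\<Sum>(v, u)\<in>P. joint a u v * joint b u v) \<le> avg (\<lambda>X. J a X * J b X)"
proof -
  have sub: "a \<times> a \<union> b \<times> b \<subseteq> V \<times> V" using sq_subset[OF assms(1)] sq_subset[OF assms(2)] by simp
  have c: "0 < 1 / real c" "1 / real c \<le> 1 / 2" using c_ge_2 by (auto simp: field_simps)
  have mono: "(1 / real c) ^ k \<le> prb (a \<times> a \<union> b \<times> b)" if "rk (a \<times> a \<union> b \<times> b) \<le> k" for k
    unfolding prb_eq_rk[OF sub] using that c by (intro power_decreasing) auto
  show ?thesis
  proof (cases "\<exists>u v. u \<in> a \<and> v \<in> a \<and> u \<in> b \<and> v \<in> b \<and> u \<noteq> v")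
    case True
    then have "(1 / real c) ^ 3 \<le> prb (a \<times> a \<union> b \<times> b)" using rk_pair_bounds(2)[OF assms] mono by blast
    moreover have "2 * (1 / real c) ^ 4 \<le> (1 / real c) ^ 3"
      using c mult_right_mono[of "1 / real c" "1 / 2" "(1 / real c) ^ 3"] by (simp add: power_numeral_reduce)
    moreover have "p\<^sup>2 = (1 / real c) ^ 4" by (simp add: p_def power_divide)
    ultimately have "(1 / c) ^ 4 \<le> avg (\<lambda>X. J a X * J b X)" unfolding avg_JJ[OF assms] by linarith
    moreover have "(1 / c) ^ 4 / 6 * (\<Sum>(v, u)\<in>P. joint a u v * joint b u v) \<le> (1 / c) ^ 4 / 6 * 6"
      by (intro mult_left_mono sum_P_joint_le_6 assms) auto
    ultimately show ?thesis by simp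
  next
    case False
    then have "(\<Sum>(v, u)\<in>P. joint a u v * joint b u v) = 0"
      unfolding P_def by (intro sum.neutral) auto
    moreover have "(1 / real c) ^ 4 \<le> prb (a \<times> a \<union> b \<times> b)" by (rule mono[OF rk_pair_bounds(1)[OF assms]])
    moreover have "p\<^sup>2 = (1 / real c) ^ 4" by (simp add: p_def power_divide)
    ultimately show ?thesis unfolding avg_JJ[OF assms] by simp
  qed
qed

text \<open>Triangles with at most one common vertex are uncorrelated; otherwise the right side is
  at least 1.\<close>

lemma avg_JJ_le:
  assumes "a \<in> TS" "b \<in> TS"
  shows "avg (\<lambda>X. J a X * J b X) \<le> (\<Sum>(v, u)\<in>P. joint a u v * joint b u v)"
proof (cases "\<exists>u v. u \<in> a \<and> v \<in> a \<and> u \<in> b \<and> v \<in> b \<and> u \<noteq> v")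
  case True
  then obtain u v where uv: "u \<in> a" "v \<in> a" "u \<in> b" "v \<in> b" "u \<noteq> v" by blast
  then have "(v, u) \<in> P" using TS_subset[OF assms(1)] unfolding P_def by auto
  then have "(\<lambda>(v, u). joint a u v * joint b u v) (v, u) \<le> (\<Sum>(v, u)\<in>P. joint a u v * joint b u v)"
    by (intro member_le_sum finite_P) auto
  then have "1 \<le> (\<Sum>(v, u)\<in>P. joint a u v * joint b u v)" using uv by simp
  moreover have "\<bar>J a X\<bar> \<le> 1" for a X
  proof -
    have "0 \<le> p" "p \<le> 1" unfolding p_def using c_ge_2 by (auto intro!: power_le_one)
    then show ?thesis by (cases "Mon (a \<times> a) X") (simp_all add: J_def mon_def)
  qed
  then have "\<bar>avg (\<lambda>X. J a X * J b X)\<bar> \<le> 1" by (intro abs_avg_mult_le_1)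
  ultimately show ?thesis by linarith
next
  case False
  have "\<exists>w. a \<inter> b \<subseteq> {w}" using False by blast
  then obtain w where "a \<inter> b \<subseteq> {w}" ..
  then have "avg (\<lambda>X. J a X * J b X) = 0"
    using assms by (intro avg_mult_meet_le_1[OF Span_J Span_J] TS_subset avg_J)
  moreover have "(\<Sum>(v, u)\<in>P. joint a u v * joint b u v) \<ge> 0" by (intro sum_nonneg) auto
  ultimately show ?thesis by simp
qed

lemma var_eq: "var = (\<Sum>a\<in>TS. \<Sum>b\<in>TS. avg (\<lambda>X. J a X * J b X))"
  unfolding var_def U_def power2_eq_square by (rule avg_mult2)

lemma var_ge: "F \<le> 6 * c ^ 4 * var"
proof -
  have "(1 / c) ^ 4 / 6 * F \<le> var"
    unfolding F_eq var_eq sum_distrib_left[of _ _ TS] by (intro sum_mono avg_JJ_ge)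
  then have "(6 * c ^ 4) * ((1 / c) ^ 4 / 6 * F) \<le> 6 * c ^ 4 * var" by (intro mult_left_mono) auto
  then show ?thesis using c_ge_2 by (simp add: power_divide)
qed

lemma var_le: "var \<le> F"
  unfolding F_eq var_eq by (intro sum_mono avg_JJ_le)

lemma not_indep_common:
  assumes "(u, v) \<in> S" "(u, v) \<in> T" "S \<subseteq> V \<times> V" "T \<subseteq> V \<times> V" "u \<noteq> v"
  shows "\<not> indep S T"
proof -
  have "rk {(u, v)} = 1" using assms by (intro rk_singleton) auto
  then show ?thesis using rk_Un_Int_le[OF assms(3,4), of "{(u, v)}"] assms by (simp add: indep_def)
qed

lemma conn4_common:
  assumes T: "a \<in> TS" "b \<in> TS" "d \<in> TS" "e \<in> TS" and u: "u \<in> a" "u \<in> b" "u \<in> d" "u \<in> e"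
    and v: "v \<in> a" "v \<in> b" "v \<in> d" "v \<in> e" and "u \<noteq> v"
  shows "conn4 (a \<times> a) (b \<times> b) (d \<times> d) (e \<times> e)"
  unfolding conn4_def using T[THEN sq_subset] u v \<open>u \<noteq> v\<close>
  by (intro conjI not_indep_common[of u v]) simp_all

text \<open>Four triangles on a common edge form a connected quadruple, and a quadruple arises from
  at most six ordered pairs.\<close>

lemma S4_le: "S4 \<le> 6 * nconn"
proof -
  have "S4 = (\<Sum>e\<in>P. \<Sum>a\<in>TS. \<Sum>b\<in>TS. \<Sum>d\<in>TS. \<Sum>f\<in>TS. joint a (snd e) (fst e) * joint b (snd e) (fst e) * joint d (snd e) (fst e) * joint f (snd e) (fst e))"
    unfolding S4_eq_P case_prod_unfold sum_mult4[symmetric] sum_joint by (simp only: power4_eq_xxxx)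
  also have "\<dots> = (\<Sum>a\<in>TS. \<Sum>b\<in>TS. \<Sum>d\<in>TS. \<Sum>f\<in>TS. \<Sum>e\<in>P. joint a (snd e) (fst e) * joint b (snd e) (fst e) * joint d (snd e) (fst e) * joint f (snd e) (fst e))"
    by (simp only: sum.swap[of _ TS P])
  also have "\<dots> \<le> 6 * nconn"
  proof (rule sum_nconn_le)
    fix a b d f assume T: "a \<in> TS" "b \<in> TS" "d \<in> TS" "f \<in> TS"
    show "(\<Sum>e\<in>P. joint a (snd e) (fst e) * joint b (snd e) (fst e) * joint d (snd e) (fst e) * joint f (snd e) (fst e)) \<le> 6 * conn a b d f"
    proof (cases "conn4 (a \<times> a) (b \<times> b) (d \<times> d) (f \<times> f)")
      case True
      have "(\<Sum>e\<in>P. joint a (snd e) (fst e) * joint b (snd e) (fst e) * joint d (snd e) (fst e) * joint f (snd e) (fst e))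
        \<le> (\<Sum>e\<in>P. joint a (snd e) (fst e))" by (intro sum_mono) auto
      also have "\<dots> = 6" using sum_joint_P[OF T(1)] by (simp only: case_prod_unfold)
      finally show ?thesis using True by simp
    next
      case False
      have "(\<Sum>e\<in>P. joint a (snd e) (fst e) * joint b (snd e) (fst e) * joint d (snd e) (fst e) * joint f (snd e) (fst e)) = 0"
      proof (rule sum.neutral, rule ballI)
        fix e assume "e \<in> P"
        then have "snd e \<noteq> fst e" by (auto simp: P_def)
        then show "joint a (snd e) (fst e) * joint b (snd e) (fst e) * joint d (snd e) (fst e) * joint f (snd e) (fst e) = 0"
          using conn4_common[OF T, of "snd e" "fst e"] False by auto
      qed
      then show ?thesis by simp
    qed
  qed
  finally show ?thesis .
qed

text \<open>A triangle repeated four times is a connected quadruple. This makes the excess strictly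
  positive in \<open>excess_pos\<close>.\<close>

lemma nconn_ge_1:
  assumes "TS \<noteq> {}"
  shows "nconn \<ge> 1"
proof -
  obtain a where a: "a \<in> TS" using assms by blast
  then obtain u v where uv: "u \<in> a" "v \<in> a" "u \<noteq> v" using TS[OF a] card_le_Suc0_iff_eq[of a] card.infinite[of a] by force
  have *: "f a \<le> (\<Sum>x\<in>TS. f x)" if "\<And>x. 0 \<le> f x" for f :: "_ \<Rightarrow> real"
    by (rule member_le_sum[OF a]) (auto simp: that)
  have "1 = conn a a a a" using conn4_common[OF a a a a uv(1) uv(1) uv(1) uv(1) uv(2) uv(2) uv(2) uv(2) uv(3)] by simp
  also have "\<dots> \<le> (\<Sum>e\<in>TS. conn a a a e)" by (rule *) simp
  also have "\<dots> \<le> (\<Sum>d\<in>TS. \<Sum>e\<in>TS. conn a a d e)" by (rule *) (simp add: sum_nonneg)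
  also have "\<dots> \<le> (\<Sum>b\<in>TS. \<Sum>d\<in>TS. \<Sum>e\<in>TS. conn a b d e)" by (rule *) (simp add: sum_nonneg)
  also have "\<dots> \<le> nconn" unfolding nconn_def by (rule *) (simp add: sum_nonneg)
  finally show ?thesis .
qed

lemma cum4_J_ge:
  assumes "c \<ge> 5" and T: "a \<in> TS" "b \<in> TS" "d \<in> TS" "e \<in> TS"
  shows "(1 / c) ^ 8 * conn a b d e \<le> cum4 (J a) (J b) (J d) (J e)"
proof (cases "conn4 (a \<times> a) (b \<times> b) (d \<times> d) (e \<times> e)")
  case True
  have r: "rk (x \<times> x) = 2" if "x \<in> TS" for x using TS[OF that] by (intro rk_triple) auto
  have "cum4 (J a) (J b) (J d) (J e) = cum4 (\<lambda>X. of_bool (Mon (a \<times> a) X) - p) (\<lambda>X. of_bool (Mon (b \<times> b) X) - p)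
     (\<lambda>X. of_bool (Mon (d \<times> d) X) - p) (\<lambda>X. of_bool (Mon (e \<times> e) X) - p)"
    unfolding J_def[abs_def] mon_def ..
  also have "\<dots> \<ge> (1 / c) ^ 8"
    by (rule cum4_ge[OF assms(1) T[THEN sq_subset] T[THEN r] True p_def])
  finally show ?thesis using True by simp
next
  case False
  have "cum4 (J a) (J b) (J d) (J e) = 0"
    by (rule cum4_eq_0[OF Span_J Span_J Span_J Span_J T[THEN avg_J] T[THEN sq_subset] False])
  then show ?thesis using False by simp
qed

lemma fourth_cumulant_ge:
  assumes "c \<ge> 5"
  shows "(1 / c) ^ 8 * nconn \<le> avg (\<lambda>X. U X ^ 4) - 3 * var\<^sup>2"
proof -
  have 1: "avg (\<lambda>X. U X ^ 4) = sum4 (\<lambda>a b d e. avg (\<lambda>X. J a X * J b X * J d X * J e X))"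
    unfolding U_def power4_eq_xxxx by (rule avg_mult4)
  \<comment> \<open>Each copy of the squared variance matches one of the three pairings subtracted
    in \<open>cum4\<close>.\<close>
  have "3 * var\<^sup>2 = var * var + var * var + var * var" by (simp add: power2_eq_square)
  also have "\<dots> = sum4 (\<lambda>a b d e. avg (\<lambda>X. J a X * J b X) * avg (\<lambda>X. J d X * J e X))
     + sum4 (\<lambda>a b d e. avg (\<lambda>X. J a X * J d X) * avg (\<lambda>X. J b X * J e X))
     + sum4 (\<lambda>a b d e. avg (\<lambda>X. J a X * J e X) * avg (\<lambda>X. J b X * J d X))"
    unfolding sum_mult_cross var_eq ..
  finally have "avg (\<lambda>X. U X ^ 4) - 3 * var\<^sup>2 = sum4 (\<lambda>a b d e. cum4 (J a) (J b) (J d) (J e))"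
    unfolding 1 cum4_def sum_subtractf by simp
  also have "\<dots> \<ge> (1 / c) ^ 8 * nconn"
    unfolding nconn_def sum_distrib_left by (intro sum_mono cum4_J_ge assms)
  finally show ?thesis .
qed

text \<open>Every neighbour preceding \<open>v\<close> carries at least the weight \<open>R v \<ge> Q v\<close>, so there are at most
  \<open>F / Q v\<close> of them, and the Cauchy-Schwarz inequality applies.\<close>

lemma Q_cubed_le:
  assumes v: "v \<in> V"
  shows "Q v ^ 3 \<le> F * S4"
proof -
  let ?N = "{u\<in>V. prec u v}"
  have "(\<Sum>u\<in>?N. 1 * (real (deg u v))\<^sup>2)\<^sup>2 \<le> (\<Sum>u\<in>?N. 1\<^sup>2) * (\<Sum>u\<in>?N. ((real (deg u v))\<^sup>2)\<^sup>2)"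
    by (rule Cauchy_Schwarz_ineq_sum)
  then have 1: "(Q v)\<^sup>2 \<le> real (card ?N) * (\<Sum>u\<in>?N. (real (deg u v)) ^ 4)"
    unfolding Q_def by (simp flip: power_mult)
  have "(\<Sum>u\<in>?N. (real (deg u v)) ^ 4) \<le> (\<Sum>u\<in>V - {v}. (real (deg u v)) ^ 4)"
    using finite_V prec_irrefl by (intro sum_mono2) auto
  also have "\<dots> \<le> S4"
    unfolding S4_def using finite_V v by (intro member_le_sum) (auto simp: sum_nonneg)
  finally have 2: "(\<Sum>u\<in>?N. (real (deg u v)) ^ 4) \<le> S4" .
  have "real (card ?N) * Q v = (\<Sum>u\<in>?N. Q v)" by simp
  also have "\<dots> \<le> (\<Sum>u\<in>?N. R u)"
  proof (rule sum_mono)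
    fix u assume "u \<in> ?N"
    then have "R v \<le> R u" by (auto simp: prec_def)
    then show "Q v \<le> R u" using Q_le_R[of v] by linarith
  qed
  also have "\<dots> \<le> F" unfolding F_def using finite_V nonneg(5) by (intro sum_mono2) auto
  finally have 3: "real (card ?N) * Q v \<le> F" .
  have "Q v ^ 3 = (Q v)\<^sup>2 * Q v" by (simp add: power_numeral_reduce)
  also have "\<dots> \<le> (real (card ?N) * S4) * Q v"
    by (intro mult_right_mono order_trans[OF 1] mult_left_mono 2 nonneg) auto
  also have "\<dots> = (real (card ?N) * Q v) * S4" by simp
  also have "\<dots> \<le> F * S4" by (intro mult_right_mono 3 nonneg)
  finally show ?thesis .
qed

text \<open>\<open>Q_cubed_le\<close> and \<open>S4_le\<close> bound the cube of \<open>Q v\<close>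
  by a multiple of \<open>s^20 * F^3\<close>; weakening \<open>s^20\<close> to \<open>s^18\<close>
  gives an integral cube root.\<close>

lemma Q_le:
  assumes v: "v \<in> V" and n: "nconn \<le> B * s ^ 20 * F\<^sup>2" and B: "B \<ge> 1" and s: "0 \<le> s" "s \<le> 1"
  shows "Q v \<le> 6 * B * s ^ 6 * F"
proof -
  have "Q v ^ 3 \<le> F * (6 * (B * s ^ 20 * F\<^sup>2))"
    by (intro order_trans[OF Q_cubed_le[OF v]] mult_left_mono order_trans[OF S4_le] n nonneg) auto
  also have "\<dots> = (6 * B) * (s ^ 20 * F ^ 3)" by (simp add: power_numeral_reduce)
  also have "\<dots> \<le> (6 * B) ^ 3 * (s ^ 18 * F ^ 3)"
  proof (intro mult_mono mult_right_mono)
    show "6 * B \<le> (6 * B) ^ 3" using B self_le_power[of "6 * B" 3] by simp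
    show "s ^ 20 \<le> s ^ 18" using s by (intro power_decreasing) auto
  qed (use B s nonneg in auto)
  also have "\<dots> = (6 * B * s ^ 6 * F) ^ 3" by (simp add: power_mult_distrib flip: power_mult)
  finally have "Q v ^ Suc 2 \<le> (6 * B * s ^ 6 * F) ^ Suc 2" by (simp only: numeral_2_eq_2 numeral_3_eq_3)
  moreover have "0 \<le> 6 * B * s ^ 6 * F" using B s by (intro mult_nonneg_nonneg nonneg) auto
  ultimately show ?thesis by (rule power_le_imp_le_base)
qed

lemma QR_le:
  assumes n: "nconn \<le> B * s ^ 20 * F\<^sup>2" and B: "B \<ge> 1" and s: "0 \<le> s" "s \<le> 1"
  shows "QR \<le> 6 * B * s ^ 6 * F\<^sup>2"
proof -
  have "QR \<le> (\<Sum>v\<in>V. (6 * B * s ^ 6 * F) * R v)"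
    unfolding QR_def by (intro sum_mono mult_right_mono Q_le n B s nonneg)
  also have "\<dots> = 6 * B * s ^ 6 * F\<^sup>2" unfolding sum_distrib_left[symmetric] F_def[symmetric] by (simp only: power2_eq_square mult.assoc)
  finally show ?thesis .
qed

lemma U_eq_sum_M: "U X = (\<Sum>v\<in>V. M v X)"
proof -
  have "U X = (\<Sum>a\<in>TS. \<Sum>v\<in>V. mart a v X)" unfolding U_def by (intro sum.cong refl) (simp add: sum_mart)
  also have "\<dots> = (\<Sum>v\<in>V. M v X)" unfolding M_def by (rule sum.swap)
  finally show ?thesis .
qed

lemma U_minus_D_upd: "U (X(v := k)) - D v (X(v := k)) = U X - D v X"
proof -
  have "J a (X(v := k)) - dev a v (X(v := k)) = J a X - dev a v X" for a
    by (cases "v \<in> a") (simp_all add: J_def dev_def mono_upd_notin)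
  then show ?thesis unfolding U_def D_def sum_subtractf[symmetric] by (simp only:)
qed

lemma sum_M_upd:
  assumes "X \<in> colourings"
  shows "(\<Sum>k\<in>{1..c}. M v (X(v := k))) = 0"
proof -
  have "(\<Sum>k\<in>{1..c}. M v (X(v := k))) = (\<Sum>a\<in>TS. \<Sum>k\<in>{1..c}. mart a v (X(v := k)))"
    unfolding M_def by (rule sum.swap)
  also have "\<dots> = 0" by (intro sum.neutral ballI sum_mart_upd assms)
  finally show ?thesis .
qed

text \<open>The argument \<open>U - D v\<close> ignores the colour of \<open>v\<close>, over which
  \<open>M v\<close> averages to zero.\<close>

lemma avg_M_scaleR_eq_0:
  fixes h :: "real \<Rightarrow> 'b::real_vector"
  assumes "v \<in> V"
  shows "avg (\<lambda>X. M v X *\<^sub>R h (U X - D v X)) = 0"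
proof (rule avg_zero[OF assms])
  fix X assume "X \<in> colourings"
  then show "(\<Sum>k\<in>{1..c}. M v (X(v := k)) *\<^sub>R h (U (X(v := k)) - D v (X(v := k)))) = 0"
    by (simp only: U_minus_D_upd scaleR_left.sum[symmetric] sum_M_upd scaleR_zero_left)
qed

text \<open>Discrete integration by parts: \<open>U\<close> is the sum of its martingale increments,
  and each may be tested against the change of \<open>h\<close> caused by its own vertex. With the
  identity as \<open>h\<close> this gives \<open>avg_\<Gamma>\<close>.\<close>

lemma avg_U_scaleR:
  fixes h :: "real \<Rightarrow> 'b::real_vector"
  shows "avg (\<lambda>X. U X *\<^sub>R h (U X)) = (\<Sum>v\<in>V. avg (\<lambda>X. M v X *\<^sub>R (h (U X) - h (U X - D v X))))"
proof -
  have "avg (\<lambda>X. U X *\<^sub>R h (U X)) = avg (\<lambda>X. \<Sum>v\<in>V. M v X *\<^sub>R h (U X))"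
    by (subst (1) U_eq_sum_M) (simp only: scaleR_left.sum)
  also have "\<dots> = (\<Sum>v\<in>V. avg (\<lambda>X. M v X *\<^sub>R h (U X)))" by (rule avg_sum)
  also have "\<dots> = (\<Sum>v\<in>V. avg (\<lambda>X. M v X *\<^sub>R (h (U X) - h (U X - D v X))))"
    by (intro sum.cong refl) (simp add: scaleR_diff_right avg_diff avg_M_scaleR_eq_0)
  finally show ?thesis .
qed

lemma avg_\<Gamma>: "avg \<Gamma> = var"
  using avg_U_scaleR[of "\<lambda>x. x"] by (simp add: var_def \<Gamma>_def[abs_def] avg_sum power2_eq_square)

end

section \<open>Stein's method\<close>

lemma cmod_iexp_minus_linear_le: "cmod (iexp x - 1 - \<i> * x) \<le> x\<^sup>2 / 2"
  using iexp_approx1[of x 1] by (simp add: diff_diff_eq numeral_2_eq_2)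

lemma has_vector_derivative_iexp_scaled:
  "((\<lambda>t. iexp (t * x)) has_vector_derivative (\<i> * x) * iexp (t * x)) (at t)"
proof -
  have "((\<lambda>s. exp (s * (\<i> * x))) has_field_derivative (\<i> * x) * exp (of_real t * (\<i> * x))) (at (complex_of_real t))"
    by (auto intro!: derivative_eq_intros)
  from has_vector_derivative_real_field[OF this] show ?thesis by (simp add: ac_simps)
qed

lemma stein_split:
  fixes z w q A B C :: complex
  assumes "z * w = - q"
  shows "z * A + q * (B - C) = z * (A - w * B) - q * C"
proof -
  have "z * (A - w * B) = z * A - (z * w) * B" by (simp only: right_diff_distrib mult.assoc)
  then show ?thesis unfolding assms by (simp add: right_diff_distrib)
qed

lemma half_sum_le: "a \<le> (x + y) / 2 \<Longrightarrow> y \<le> x \<Longrightarrow> a \<le> (x :: real)"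
  by (simp add: field_simps)

context colouring
begin

lemma avg_mult_left: "avg (\<lambda>X. z * f X) = z * (avg f :: 'b::real_algebra)"
  by (simp add: avg_def sum_distrib_left[symmetric])

lemma has_vector_derivative_avg:
  assumes "\<And>X. ((\<lambda>t. f t X) has_vector_derivative f' X) (at t)"
  shows "((\<lambda>t. avg (f t)) has_vector_derivative avg f') (at t)"
  unfolding avg_def
  by (rule bounded_linear.has_vector_derivative[OF bounded_linear_scaleR_right])
     (rule has_vector_derivative_sum, rule assms)

end

context triple_system
begin

text \<open>Integration by parts for the exponential, expanded to first order in \<open>D v\<close>:
  the linear terms add up to \<open>\<Gamma>\<close>, and the remainder is quadratic in
  \<open>D v\<close>.\<close>

lemma avg_U_iexp:
  "cmod (avg (\<lambda>X. U X *\<^sub>R iexp (\<tau> * U X)) - \<i> * \<tau> * avg (\<lambda>X. \<Gamma> X *\<^sub>R iexp (\<tau> * U X)))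
    \<le> \<tau>\<^sup>2 / 2 * (\<Sum>v\<in>V. avg (\<lambda>X. \<bar>M v X * D v X * D v X\<bar>))"
proof -
  let ?h = "\<lambda>x. iexp (\<tau> * x)"
  let ?e = "\<lambda>v X. M v X *\<^sub>R (?h (U X) - ?h (U X - D v X)) - (\<i> * \<tau>) * ((M v X * D v X) *\<^sub>R ?h (U X))"
  have "\<i> * \<tau> * avg (\<lambda>X. \<Gamma> X *\<^sub>R ?h (U X)) = \<i> * \<tau> * (\<Sum>v\<in>V. avg (\<lambda>X. (M v X * D v X) *\<^sub>R ?h (U X)))"
    unfolding \<Gamma>_def scaleR_left.sum avg_sum ..
  also have "\<dots> = (\<Sum>v\<in>V. avg (\<lambda>X. (\<i> * \<tau>) * ((M v X * D v X) *\<^sub>R ?h (U X))))"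
    by (simp only: sum_distrib_left avg_mult_left)
  finally have eq: "avg (\<lambda>X. U X *\<^sub>R ?h (U X)) - \<i> * \<tau> * avg (\<lambda>X. \<Gamma> X *\<^sub>R ?h (U X)) = (\<Sum>v\<in>V. avg (?e v))"
    by (simp only: avg_U_scaleR[of ?h] avg_diff sum_subtractf)
  have "cmod (\<Sum>v\<in>V. avg (?e v)) \<le> (\<Sum>v\<in>V. avg (\<lambda>X. \<tau>\<^sup>2 / 2 * \<bar>M v X * D v X * D v X\<bar>))"
  proof (rule sum_norm_le)
    fix v assume "v \<in> V"
    have "cmod (?e v X) \<le> \<tau>\<^sup>2 / 2 * \<bar>M v X * D v X * D v X\<bar>" for X
    proof -
      let ?y = "- (\<tau> * D v X)"
      have "?h (U X - D v X) = ?h (U X) * iexp ?y"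
        by (simp add: exp_add[symmetric] algebra_simps)
      then have "?e v X = M v X *\<^sub>R (?h (U X) * - (iexp ?y - 1 - \<i> * ?y))"
        by (simp add: scaleR_conv_of_real algebra_simps)
      then have "cmod (?e v X) = \<bar>M v X\<bar> * cmod (iexp ?y - 1 - \<i> * ?y)"
        by (simp only: norm_scaleR norm_mult norm_minus_cancel norm_exp_i_times mult_1_left)
      also have "\<dots> \<le> \<bar>M v X\<bar> * (?y\<^sup>2 / 2)" by (intro mult_left_mono cmod_iexp_minus_linear_le) auto
      also have "\<dots> = \<tau>\<^sup>2 / 2 * \<bar>M v X * D v X * D v X\<bar>"
        by (simp add: abs_mult power2_eq_square algebra_simps)
      finally show ?thesis .
    qed
    then show "cmod (avg (?e v)) \<le> avg (\<lambda>X. \<tau>\<^sup>2 / 2 * \<bar>M v X * D v X * D v X\<bar>)"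
      by (intro order_trans[OF norm_avg_le] avg_mono)
  qed
  also have "\<dots> = \<tau>\<^sup>2 / 2 * (\<Sum>v\<in>V. avg (\<lambda>X. \<bar>M v X * D v X * D v X\<bar>))"
    unfolding sum_distrib_left by (intro sum.cong refl avg_cmult)
  finally show ?thesis unfolding eq .
qed

lemma F_pos: "TS \<noteq> {} \<Longrightarrow> F > 0"
proof -
  assume "TS \<noteq> {}"
  then obtain a where a: "a \<in> TS" by blast
  have "6 = (\<Sum>(v, u)\<in>P. joint a u v * joint a u v)" using sum_joint_P[OF a] by (simp flip: of_bool_conj)
  also have "\<dots> \<le> (\<Sum>b\<in>TS. \<Sum>(v, u)\<in>P. joint a u v * joint b u v)"
    by (rule member_le_sum[OF a]) (auto intro!: sum_nonneg)
  also have "\<dots> \<le> F" unfolding F_eq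
    by (rule member_le_sum[OF a]) (auto intro!: sum_nonneg)
  finally show ?thesis by simp
qed

lemma var_pos:
  assumes "TS \<noteq> {}"
  shows "var > 0"
proof -
  have "0 < 6 * c ^ 4 * var" using F_pos[OF assms] var_ge by linarith
  then show ?thesis using c_ge_2 by (simp add: zero_less_mult_iff)
qed

lemma excess_pos:
  assumes "c \<ge> 5" "TS \<noteq> {}"
  shows "avg (\<lambda>X. U X ^ 4) / var\<^sup>2 - 3 > 0"
proof -
  have "0 < (1 / real c) ^ 8 * nconn" using assms nconn_ge_1 by simp
  also have "\<dots> \<le> avg (\<lambda>X. U X ^ 4) - 3 * var\<^sup>2" by (rule fourth_cumulant_ge[OF assms(1)])
  finally show ?thesis using var_pos[OF assms(2)] by (simp add: field_simps)
qed

lemma char_normalised_bound: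
  fixes s t :: real
  assumes c: "c \<ge> 5" and ne: "TS \<noteq> {}" and s: "0 < s" "s \<le> 1"
    and s20: "s ^ 20 = avg (\<lambda>X. U X ^ 4) / var\<^sup>2 - 3"
  shows "cmod (avg (\<lambda>X. iexp (t * (U X / sqrt var))) - of_real (exp (- t\<^sup>2 / 2))) \<le> 2000 * real c ^ 16 * s ^ 3 * \<bar>t\<bar>"
proof -
  \<comment> \<open>The factor 1000 covers \<open>18 + 2 * 216 = 450\<close> and
    \<open>6 + 3 * 216 = 654\<close>, the coefficients arising below. The power \<open>c^16\<close>
    joins \<open>c^8\<close> from the cumulant bound and \<open>c^8\<close> from comparing
    \<open>F^2\<close> with the squared variance.\<close>
  define K where "K = 1000 * real c ^ 16"
  define \<sigma> where "\<sigma> = sqrt var"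
  have v: "var > 0" by (rule var_pos[OF ne])
  have \<sigma>: "\<sigma> > 0" "\<sigma>\<^sup>2 = var" using v by (simp_all add: \<sigma>_def)
  have c1: "real c ^ 8 \<le> real c ^ 16" "real c ^ 4 \<le> real c ^ 16" "real c ^ 8 \<ge> 1" "real c ^ 16 \<ge> 1"
    using c by (auto intro!: power_increasing one_le_power)
  have s6: "s ^ 20 \<le> s ^ 6" using s by (intro power_decreasing) auto
  have s20': "s ^ 20 * var\<^sup>2 = avg (\<lambda>X. U X ^ 4) - 3 * var\<^sup>2" using v unfolding s20 by (simp add: left_diff_distrib)
  have n: "nconn \<le> real c ^ 8 * (s ^ 20 * var\<^sup>2)"
  proof -
    have "real c ^ 8 * ((1 / real c) ^ 8 * nconn) \<le> real c ^ 8 * (s ^ 20 * var\<^sup>2)"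
      unfolding s20' by (intro mult_left_mono fourth_cumulant_ge c) simp
    moreover have "real c ^ 8 * (1 / real c) ^ 8 = 1" using c by (simp add: power_divide)
    ultimately show ?thesis by (simp only: mult.assoc[symmetric] mult_1_left)
  qed
  have "real c ^ 8 * (s ^ 20 * var\<^sup>2) \<le> real c ^ 8 * (s ^ 20 * F\<^sup>2)"
    using v var_le s by (intro mult_left_mono power_mono) simp_all
  with n have nF: "nconn \<le> real c ^ 8 * s ^ 20 * F\<^sup>2" by (simp only: mult.assoc)
  have c8: "real c ^ 8 * real c ^ 8 = real c ^ 16" "real c ^ 4 * real c ^ 4 = real c ^ 8"
    by (simp_all flip: power_add)
  have F2: "F\<^sup>2 \<le> 36 * real c ^ 8 * var\<^sup>2"
  proof -
    have "F \<le> 6 * real c ^ 4 * var" using var_ge by simp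
    then have "F\<^sup>2 \<le> (6 * real c ^ 4 * var)\<^sup>2" using nonneg(6) by (rule power_mono)
    also have "\<dots> = 36 * (real c ^ 4 * real c ^ 4) * var\<^sup>2" by (simp add: power2_eq_square)
    finally show ?thesis unfolding c8 .
  qed
  have "QR \<le> 6 * real c ^ 8 * s ^ 6 * F\<^sup>2" using QR_le[OF nF c1(3)] s by simp
  also have "\<dots> \<le> 6 * real c ^ 8 * s ^ 6 * (36 * real c ^ 8 * var\<^sup>2)" using F2 s by (intro mult_left_mono) simp_all
  also have "\<dots> = 216 * ((real c ^ 8 * real c ^ 8) * s ^ 6 * var\<^sup>2)" by simp
  finally have qr: "QR \<le> 216 * (real c ^ 16 * s ^ 6 * var\<^sup>2)" unfolding c8 .
  have n': "nconn \<le> real c ^ 16 * s ^ 6 * var\<^sup>2"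
  proof -
    have "real c ^ 8 * s ^ 20 \<le> real c ^ 16 * s ^ 6" using c1 s6 s by (intro mult_mono) auto
    then have "real c ^ 8 * s ^ 20 * var\<^sup>2 \<le> real c ^ 16 * s ^ 6 * var\<^sup>2" by (rule mult_right_mono) simp
    with n show ?thesis unfolding mult.assoc by (rule order_trans)
  qed
  have pos: "real c ^ 16 * s ^ 6 * var\<^sup>2 \<ge> 0" using s by simp
  have V\<Gamma>: "avg (\<lambda>X. (\<Gamma> X - var)\<^sup>2) \<le> K * s ^ 6 * var\<^sup>2"
  proof -
    have "(\<lambda>X. (\<Gamma> X - var)\<^sup>2) = (\<lambda>X. (\<Gamma> X)\<^sup>2 - (2 * var) * \<Gamma> X + var\<^sup>2)"
      by (simp add: power2_diff algebra_simps)
    then have "avg (\<lambda>X. (\<Gamma> X - var)\<^sup>2) = avg (\<lambda>X. (\<Gamma> X)\<^sup>2) - (2 * var) * avg \<Gamma> + var\<^sup>2"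
      by (simp only: avg_add avg_diff avg_cmult avg_const)
    also have "\<dots> = avg (\<lambda>X. (\<Gamma> X)\<^sup>2) - (avg \<Gamma>)\<^sup>2" by (simp add: avg_\<Gamma> power2_eq_square)
    also have "\<dots> \<le> 18 * nconn + 2 * QR" by (rule avg_\<Gamma>_var)
    finally show ?thesis using n' qr pos unfolding K_def mult.assoc by linarith
  qed
  have T: "(\<Sum>v\<in>V. avg (\<lambda>X. (M v X * D v X)\<^sup>2)) \<le> K * s ^ 6 * var\<^sup>2"
    using sum_avg_MD_square_le n' qr pos unfolding K_def mult.assoc by linarith
  have A: "avg (\<lambda>X. \<bar>\<Gamma> X - var\<bar>) \<le> K * s ^ 3 * var"
  proof -
    \<comment> \<open>This weight balances the inequality of means: both terms become of order
      \<open>s^3 * var\<close>.\<close>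
    define l where "l = 1 / (s ^ 3 * var)"
    have l: "l > 0" using s v by (simp add: l_def)
    have "avg (\<lambda>X. \<bar>\<Gamma> X - var\<bar>) \<le> avg (\<lambda>X. (l * (\<Gamma> X - var)\<^sup>2 + 1 / l) / 2)"
      using abs_mult_le_AM[OF l, of _ 1] by (intro avg_mono) simp
    also have "\<dots> = (l * avg (\<lambda>X. (\<Gamma> X - var)\<^sup>2) + 1 / l) / 2"
      by (simp only: avg_cdiv avg_add avg_cmult avg_const)
    also have "\<dots> \<le> (l * (K * s ^ 6 * var\<^sup>2) + 1 / l) / 2"
      using V\<Gamma> l by (intro divide_right_mono add_right_mono mult_left_mono) auto
    also have "l * (K * s ^ 6 * var\<^sup>2) = K * s ^ 3 * var"
      using s v by (simp add: l_def power_numeral_reduce)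
    also have "1 / l = s ^ 3 * var" by (simp add: l_def)
    finally have *: "avg (\<lambda>X. \<bar>\<Gamma> X - var\<bar>) \<le> (K * s ^ 3 * var + s ^ 3 * var) / 2" .
    have "s ^ 3 * var \<le> K * s ^ 3 * var"
    proof -
      have "1 * (s ^ 3 * var) \<le> K * (s ^ 3 * var)" using s v c1 by (intro mult_right_mono) (auto simp: K_def)
      then show ?thesis by (simp add: mult.assoc)
    qed
    then show ?thesis by (rule half_sum_le[OF *])
  qed
  have B: "(\<Sum>v\<in>V. avg (\<lambda>X. \<bar>M v X * D v X * D v X\<bar>)) \<le> K * s ^ 3 * \<sigma> ^ 3"
  proof -
    \<comment> \<open>Again balanced, so that the sums over \<open>M v * D v\<close> and over
      \<open>D v\<close> both contribute order \<open>s^3 * \<sigma>^3\<close>.\<close>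
    define l where "l = 1 / (s ^ 3 * \<sigma>)"
    have l: "l > 0" using s \<sigma> by (simp add: l_def)
    have "(\<Sum>v\<in>V. avg (\<lambda>X. \<bar>M v X * D v X * D v X\<bar>)) \<le> (\<Sum>v\<in>V. avg (\<lambda>X. (l * (M v X * D v X)\<^sup>2 + (D v X)\<^sup>2 / l) / 2))"
      by (intro sum_mono avg_mono abs_mult_le_AM l)
    also have "\<dots> = (l * (\<Sum>v\<in>V. avg (\<lambda>X. (M v X * D v X)\<^sup>2)) + (\<Sum>v\<in>V. avg (\<lambda>X. (D v X)\<^sup>2)) / l) / 2"
      by (simp only: avg_cdiv avg_add avg_cmult sum.distrib sum_distrib_left[symmetric] sum_divide_distrib[symmetric])
    also have "\<dots> \<le> (l * (K * s ^ 6 * var\<^sup>2) + (6 * c ^ 4 * var) / l) / 2"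
      using l by (intro divide_right_mono add_mono mult_left_mono T order_trans[OF sum_avg_D_square_le var_ge]) auto
    also have "l * (K * s ^ 6 * var\<^sup>2) = K * s ^ 3 * \<sigma> ^ 3"
      using s \<sigma>(1) unfolding \<sigma>(2)[symmetric] by (simp add: l_def power_numeral_reduce)
    also have "(6 * c ^ 4 * var) / l = 6 * real c ^ 4 * (s ^ 3 * \<sigma> ^ 3)"
      unfolding \<sigma>(2)[symmetric] by (simp add: l_def power_numeral_reduce)
    finally have *: "(\<Sum>v\<in>V. avg (\<lambda>X. \<bar>M v X * D v X * D v X\<bar>)) \<le> (K * s ^ 3 * \<sigma> ^ 3 + 6 * real c ^ 4 * (s ^ 3 * \<sigma> ^ 3)) / 2" .
    have "6 * real c ^ 4 * (s ^ 3 * \<sigma> ^ 3) \<le> K * (s ^ 3 * \<sigma> ^ 3)"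
      using s \<sigma> c1 by (intro mult_right_mono) (auto simp: K_def)
    then show ?thesis using half_sum_le[OF *] by (simp only: mult.assoc)
  qed
  define \<phi> where "\<phi> = (\<lambda>t. avg (\<lambda>X. iexp (t * (U X / \<sigma>))))"
  define \<phi>' where "\<phi>' = (\<lambda>t. avg (\<lambda>X. (\<i> * (U X / \<sigma>)) * iexp (t * (U X / \<sigma>))))"
  have d: "(\<phi> has_vector_derivative \<phi>' t) (at t)" for t
    unfolding \<phi>_def \<phi>'_def by (intro has_vector_derivative_avg has_vector_derivative_iexp_scaled)
  have ode: "cmod (\<phi>' t + t * \<phi> t) \<le> (K * s ^ 3) * \<bar>t\<bar> + (K * s ^ 3) * t\<^sup>2" for t
  proof -
    define \<tau> where "\<tau> = t / \<sigma>"
    let ?G = "\<lambda>X. iexp (\<tau> * U X)"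
    have G: "iexp (t * (U X / \<sigma>)) = ?G X" for X by (simp add: \<tau>_def)
    have 1: "\<phi>' t = (\<i> / \<sigma>) * avg (\<lambda>X. U X *\<^sub>R ?G X)"
      unfolding \<phi>'_def avg_mult_left[symmetric] G by (intro avg_cong) (simp add: scaleR_conv_of_real)
    have 2: "t * \<phi> t = of_real (t / var) * avg (\<lambda>X. var *\<^sub>R ?G X)"
      unfolding \<phi>_def G avg_scaleR using v by (simp add: scaleR_conv_of_real)
    have 3: "avg (\<lambda>X. var *\<^sub>R ?G X) = avg (\<lambda>X. \<Gamma> X *\<^sub>R ?G X) - avg (\<lambda>X. (\<Gamma> X - var) *\<^sub>R ?G X)"
      by (simp add: avg_diff[symmetric] scaleR_diff_left)
    have 4: "(\<i> / \<sigma>) * (\<i> * \<tau>) = - of_real (t / var)"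
      unfolding \<tau>_def \<sigma>(2)[symmetric] by (simp add: power2_eq_square)
    \<comment> \<open>The main terms cancel, leaving the Taylor remainder and the fluctuation of
      \<open>\<Gamma>\<close> about its mean.\<close>
    have "\<phi>' t + t * \<phi> t = (\<i> / \<sigma>) * (avg (\<lambda>X. U X *\<^sub>R ?G X) - \<i> * \<tau> * avg (\<lambda>X. \<Gamma> X *\<^sub>R ?G X))
        - of_real (t / var) * avg (\<lambda>X. (\<Gamma> X - var) *\<^sub>R ?G X)"
      unfolding 1 2 3 by (rule stein_split[OF 4])
    then have "cmod (\<phi>' t + t * \<phi> t) \<le> cmod ((\<i> / \<sigma>) * (avg (\<lambda>X. U X *\<^sub>R ?G X) - \<i> * \<tau> * avg (\<lambda>X. \<Gamma> X *\<^sub>R ?G X)))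
       + cmod (of_real (t / var) * avg (\<lambda>X. (\<Gamma> X - var) *\<^sub>R ?G X))" by (simp only: norm_triangle_ineq4)
    also have "\<dots> = cmod (avg (\<lambda>X. U X *\<^sub>R ?G X) - \<i> * \<tau> * avg (\<lambda>X. \<Gamma> X *\<^sub>R ?G X)) / \<sigma>
       + \<bar>t\<bar> / var * cmod (avg (\<lambda>X. (\<Gamma> X - var) *\<^sub>R ?G X))"
      using v \<sigma> by (simp add: norm_mult norm_divide)
    also have "\<dots> \<le> (\<tau>\<^sup>2 / 2 * (K * s ^ 3 * \<sigma> ^ 3)) / \<sigma> + \<bar>t\<bar> / var * (K * s ^ 3 * var)"
    proof (intro add_mono divide_right_mono mult_left_mono)
      show "cmod (avg (\<lambda>X. U X *\<^sub>R ?G X) - \<i> * \<tau> * avg (\<lambda>X. \<Gamma> X *\<^sub>R ?G X)) \<le> \<tau>\<^sup>2 / 2 * (K * s ^ 3 * \<sigma> ^ 3)"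
        by (rule order_trans[OF avg_U_iexp]) (intro mult_left_mono B, simp)
      have "cmod (avg (\<lambda>X. (\<Gamma> X - var) *\<^sub>R ?G X)) \<le> avg (\<lambda>X. cmod ((\<Gamma> X - var) *\<^sub>R ?G X))" by (rule norm_avg_le)
      also have "\<dots> = avg (\<lambda>X. \<bar>\<Gamma> X - var\<bar>)" by (simp only: norm_scaleR norm_exp_i_times mult_1_right)
      also note A
      finally show "cmod (avg (\<lambda>X. (\<Gamma> X - var) *\<^sub>R ?G X)) \<le> K * s ^ 3 * var" .
    qed (use v \<sigma> in auto)
    also have "(\<tau>\<^sup>2 / 2 * (K * s ^ 3 * \<sigma> ^ 3)) / \<sigma> = (K * s ^ 3) * (t\<^sup>2 / 2)"
      using \<sigma>(1) by (simp add: \<tau>_def power_divide power2_eq_square power3_eq_cube)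
    also have "\<bar>t\<bar> / var * (K * s ^ 3 * var) = (K * s ^ 3) * \<bar>t\<bar>" using v by simp
    finally have *: "cmod (\<phi>' t + t * \<phi> t) \<le> (K * s ^ 3) * (t\<^sup>2 / 2) + (K * s ^ 3) * \<bar>t\<bar>" .
    have "(K * s ^ 3) * (t\<^sup>2 / 2) \<le> (K * s ^ 3) * t\<^sup>2" using s by (intro mult_left_mono) (auto simp: K_def)
    with * show ?thesis by linarith
  qed
  have "cmod (\<phi> t - of_real (exp (- t\<^sup>2 / 2))) \<le> (K * s ^ 3 + K * s ^ 3) * \<bar>t\<bar>"
  proof (rule char_ode_bound[OF d _ _ _ ode])
    show "\<phi> 0 = 1" by (simp add: \<phi>_def)
  qed (use s in \<open>auto simp: K_def\<close>)
  also have "(K * s ^ 3 + K * s ^ 3) * \<bar>t\<bar> = 2000 * real c ^ 16 * s ^ 3 * \<bar>t\<bar>" by (simp add: K_def)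
  finally show ?thesis unfolding \<phi>_def \<sigma>_def .
qed

end

section \<open>Graphs as families of triples, and the bound for at least five colours\<close>

definition triangles :: "nat pair_pre_digraph \<Rightarrow> nat set set" where
  "triangles G = {S. S \<subseteq> pverts G \<and> card S = 3 \<and> (\<forall>u\<in>S. \<forall>v\<in>S. u \<noteq> v \<longrightarrow> (u, v) \<in> parcs G)}"

lemma num_triangles_eq: "num_triangles G = card (triangles G)"
  by (simp add: num_triangles_def triangles_def)

lemma labelled_graphD:
  assumes "labelled_graph G"
  shows "finite (pverts G)" "pverts G = {1..card (pverts G)}"
    and "(u, v) \<in> parcs G \<Longrightarrow> (v, u) \<in> parcs G" and "(u, v) \<in> parcs G \<Longrightarrow> u \<in> pverts G \<and> v \<in> pverts G"
proof -
  interpret pair_graph G using assms by (simp add: labelled_graph_def)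
  show "finite (pverts G)" by (rule pair_finite_verts)
  show "pverts G = {1..card (pverts G)}" using assms by (simp add: labelled_graph_def)
  show "(u, v) \<in> parcs G \<Longrightarrow> (v, u) \<in> parcs G" by (rule arcs_symmetric)
  show "(u, v) \<in> parcs G \<Longrightarrow> u \<in> pverts G \<and> v \<in> pverts G" using in_arcsD1 in_arcsD2 by blast
qed

lemma triple_system_triangles:
  assumes "labelled_graph G" "c \<ge> 2"
  shows "triple_system (pverts G) c (triangles G)"
  using labelled_graphD(1)[OF assms(1)] assms(2) by unfold_locales (auto simp: triangles_def)

context colouring
begin

lemma expectation_eq_avg:
  fixes f :: "_ \<Rightarrow> 'b::{banach, second_countable_topology}"
  shows "measure_pmf.expectation (Pi_pmf V 0 (\<lambda>_. pmf_of_set {1..c})) f = avg f"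
proof -
  have "Pi_pmf V 0 (\<lambda>_. pmf_of_set {1..c}) = pmf_of_set colourings"
    unfolding colourings_def using finite_V c_ge_2 by (intro Pi_pmf_of_set) auto
  moreover have "measure_pmf.expectation (pmf_of_set colourings) f = (\<Sum>X\<in>colourings. pmf (pmf_of_set colourings) X *\<^sub>R f X)"
    by (rule integral_measure_pmf) (auto simp: set_pmf_of_set[OF colourings_nonempty])
  moreover have "\<dots> = (\<Sum>X\<in>colourings. (1 / real (card colourings)) *\<^sub>R f X)"
    by (intro sum.cong refl) (simp add: pmf_of_set[OF colourings_nonempty])
  ultimately show ?thesis by (simp add: avg_def scaleR_sum_right)
qed

end

lemma sorted_triple:
  fixes S :: "'a::linorder set"
  assumes "card S = 3"
  shows "\<exists>a b d. S = {a, b, d} \<and> a < b \<and> b < d"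
proof -
  obtain x y z where xyz: "S = {x, y, z}" "x \<noteq> y" "x \<noteq> z" "y \<noteq> z" using assms by (metis card_3_iff)
  consider "x < y" "y < z" | "x < z" "z < y" | "y < x" "x < z" | "y < z" "z < x" | "z < x" "x < y" | "z < y" "y < x"
    using xyz by (metis linorder_neqE)
  then show ?thesis
  proof cases
    case 1 then show ?thesis unfolding xyz(1) by (intro exI[of _ x] exI[of _ y] exI[of _ z]) auto
  next
    case 2 then show ?thesis unfolding xyz(1) by (intro exI[of _ x] exI[of _ z] exI[of _ y]) auto
  next
    case 3 then show ?thesis unfolding xyz(1) by (intro exI[of _ y] exI[of _ x] exI[of _ z]) auto
  next
    case 4 then show ?thesis unfolding xyz(1) by (intro exI[of _ y] exI[of _ z] exI[of _ x]) auto
  next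
    case 5 then show ?thesis unfolding xyz(1) by (intro exI[of _ z] exI[of _ x] exI[of _ y]) auto
  next
    case 6 then show ?thesis unfolding xyz(1) by (intro exI[of _ z] exI[of _ y] exI[of _ x]) auto
  qed
qed

lemma sorted_triple_unique:
  fixes a b d a' b' d' :: "'a::linorder"
  assumes o: "a < b" "b < d" "a' < b'" "b' < d'" and e: "{a, b, d} = {a', b', d'}"
  shows "a = a' \<and> b = b' \<and> d = d'"
proof -
  have "Min {a, b, d} = a" "Max {a, b, d} = d" "Min {a', b', d'} = a'" "Max {a', b', d'} = d'"
    using o by (auto simp: min_def max_def)
  then have *: "a = a'" "d = d'" using e by metis+
  moreover have "b \<in> {a', b', d'}" using e by blast
  ultimately show ?thesis using o by auto
qed

text \<open>Every triangle has exactly one increasing enumeration, so the ordered triples correspond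
  to three-element sets.\<close>

lemma T3_eq_sum_triangles:
  assumes G: "labelled_graph G"
  shows "T3 G X = (\<Sum>S\<in>triangles G. of_bool (\<forall>u\<in>S. \<forall>v\<in>S. X u = X v))"
proof -
  let ?N = "card (pverts G)"
  let ?A = "{(s1, s2, s3). 1 \<le> s1 \<and> s1 < s2 \<and> s2 < s3 \<and> s3 \<le> ?N}"
  let ?B = "{(s1, s2, s3). 1 \<le> s1 \<and> s1 < s2 \<and> s2 < s3 \<and> s3 \<le> ?N \<and> (s1, s2) \<in> parcs G \<and> (s2, s3) \<in> parcs G \<and> (s1, s3) \<in> parcs G}"
  let ?h = "\<lambda>(s1, s2, s3). {s1, s2, s3 :: nat}"
  note sym = labelled_graphD(3)[OF G]
  have V: "pverts G = {1..?N}" by (rule labelled_graphD(2)[OF G])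
  have "finite ?A" by (rule finite_subset[of _ "{1..?N} \<times> {1..?N} \<times> {1..?N}"]) auto
  then have "T3 G X = (\<Sum>(s1, s2, s3)\<in>?B. adj G s1 s2 * adj G s2 s3 * adj G s1 s3 * of_bool (X s1 = X s2 \<and> X s2 = X s3))"
    unfolding T3_def by (intro sum.mono_neutral_right) (auto simp: adj_def)
  also have "\<dots> = (\<Sum>s\<in>?B. of_bool (\<forall>u\<in>?h s. \<forall>v\<in>?h s. X u = X v))"
  proof (intro sum.cong refl)
    fix s assume "s \<in> ?B"
    then obtain a b d where s: "s = (a, b, d)" "(a, b) \<in> parcs G" "(b, d) \<in> parcs G" "(a, d) \<in> parcs G" by blast
    have "(\<forall>u\<in>{a, b, d}. \<forall>v\<in>{a, b, d}. X u = X v) \<longleftrightarrow> X a = X b \<and> X b = X d"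
    proof
      assume "\<forall>u\<in>{a, b, d}. \<forall>v\<in>{a, b, d}. X u = X v"
      then show "X a = X b \<and> X b = X d" by blast
    next
      assume "X a = X b \<and> X b = X d"
      then have "X u = X b" if "u \<in> {a, b, d}" for u using that by (elim insertE emptyE) simp_all
      then show "\<forall>u\<in>{a, b, d}. \<forall>v\<in>{a, b, d}. X u = X v" by metis
    qed
    then show "(case s of (s1, s2, s3) \<Rightarrow> adj G s1 s2 * adj G s2 s3 * adj G s1 s3 * of_bool (X s1 = X s2 \<and> X s2 = X s3))
      = of_bool (\<forall>u\<in>?h s. \<forall>v\<in>?h s. X u = X v)"
      unfolding s(1) prod.case by (simp only: adj_def s(2-4)) simp
  qed
  also have "\<dots> = (\<Sum>S\<in>?h ` ?B. of_bool (\<forall>u\<in>S. \<forall>v\<in>S. X u = X v))"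
  proof (subst sum.reindex)
    show "inj_on ?h ?B"
    proof (rule inj_onI)
      fix s s' assume "s \<in> ?B" "s' \<in> ?B" and e: "?h s = ?h s'"
      then obtain a b d a' b' d' where s: "s = (a, b, d)" "s' = (a', b', d')" and o: "a < b" "b < d" "a' < b'" "b' < d'"
        by blast
      have e': "{a, b, d} = {a', b', d'}" using e unfolding s by simp
      show "s = s'" using sorted_triple_unique[OF o e'] unfolding s by simp
    qed
  qed simp
  also have "?h ` ?B = triangles G"
  proof (intro equalityI subsetI)
    fix S assume "S \<in> ?h ` ?B"
    then obtain a b d where S: "S = {a, b, d}" "1 \<le> a" "a < b" "b < d" "d \<le> ?N" "(a, b) \<in> parcs G" "(b, d) \<in> parcs G" "(a, d) \<in> parcs G"
      by auto
    then have "S \<subseteq> pverts G" by (subst V) auto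
    then show "S \<in> triangles G" using S sym by (auto simp: triangles_def)
  next
    fix S assume S: "S \<in> triangles G"
    then have "card S = 3" by (simp add: triangles_def)
    then have "\<exists>a b d. S = {a, b, d} \<and> a < b \<and> b < d" by (rule sorted_triple)
    then obtain a b d where abd: "S = {a, b, d}" "a < b" "b < d" by blast
    moreover have "a \<in> pverts G" "d \<in> pverts G" using S abd(1) by (auto simp: triangles_def)
    then have "1 \<le> a" "d \<le> ?N" using V by (metis atLeastAtMost_iff)+
    moreover have "(a, b) \<in> parcs G" "(b, d) \<in> parcs G" "(a, d) \<in> parcs G"
      using S abd by (auto simp: triangles_def)
    ultimately have "(a, b, d) \<in> ?B" by simp
    then have "?h (a, b, d) \<in> ?h ` ?B" by (rule imageI)
    then show "S \<in> ?h ` ?B" using abd(1) by simp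
  qed
  finally show ?thesis .
qed

locale coloured_graph =
  fixes G :: "nat pair_pre_digraph" and c :: nat
  assumes G: "labelled_graph G" and c: "c \<ge> 2"
begin

sublocale triple_system "pverts G" c "triangles G"
  by (rule triple_system_triangles[OF G c])

lemma T3_eq: "T3 G X = (\<Sum>S\<in>triangles G. mon S X)"
  unfolding T3_eq_sum_triangles[OF G] mon_def Mon_def by (intro sum.cong refl) simp

lemma expectation_coloring:
  fixes f :: "_ \<Rightarrow> 'b::{banach, second_countable_topology}"
  shows "measure_pmf.expectation (coloring_pmf c G) f = avg f"
  unfolding coloring_pmf_def by (rule expectation_eq_avg)

lemma T3_centred: "T3 G X - avg (T3 G) = U X"
proof -
  have U: "U X = T3 G X - card (triangles G) * p" for X
    unfolding U_def J_def T3_eq by (simp add: sum_subtractf)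
  have "avg U = (\<Sum>a\<in>triangles G. avg (J a))" unfolding U_def[abs_def] by (rule avg_sum)
  also have "\<dots> = 0" by (simp add: avg_J)
  finally have "avg (\<lambda>X. T3 G X - card (triangles G) * p) = 0" by (simp add: U[abs_def])
  then have "avg (T3 G) = card (triangles G) * p" by (simp add: avg_diff)
  then show ?thesis by (simp add: U)
qed

lemma Z3_eq: "Z3 c G X = U X / sqrt var"
  unfolding Z3_def expectation_coloring T3_centred var_def ..

lemma Z3_fourth_moment_eq: "Z3_fourth_moment c G = avg (\<lambda>X. U X ^ 4) / var\<^sup>2"
proof -
  have "var \<ge> 0" unfolding var_def by (intro avg_nonneg) simp
  then have "(sqrt var) ^ 4 = var\<^sup>2" by (simp add: power4_eq_xxxx power2_eq_square)
  then show ?thesis unfolding Z3_fourth_moment_def expectation_coloring Z3_eq power_divide by (simp add: avg_cdiv)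
qed

lemma real_distribution_Z3: "real_distribution (Z3_distr c G)"
  unfolding Z3_distr_def by (intro prob_space.real_distribution_distr[OF measure_pmf.prob_space_axioms]) simp

lemma cdf_Z3: "cdf (Z3_distr c G) x = measure_pmf.prob (coloring_pmf c G) {X. Z3 c G X \<le> x}"
  unfolding Z3_distr_def cdf_def2 by (subst measure_distr) (auto simp: vimage_def)

lemma char_Z3: "char (Z3_distr c G) t = avg (\<lambda>X. iexp (t * (U X / sqrt var)))"
  unfolding Z3_distr_def char_def by (subst integral_distr) (simp_all add: expectation_coloring Z3_eq)

lemma kolmogorov_le_1: "kolmogorov_dist c G \<le> 1"
  unfolding kolmogorov_dist_def
proof (rule cSUP_least)
  fix x
  interpret N: real_distribution std_normal_distribution by (rule real_dist_normal_dist)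
  have "0 \<le> \<Phi> x" "\<Phi> x \<le> 1" unfolding std_normal_cdf_def by (simp_all add: N.cdf_nonneg N.cdf_bounded_prob)
  moreover have "0 \<le> measure_pmf.prob (coloring_pmf c G) {X. Z3 c G X \<le> x}" "measure_pmf.prob (coloring_pmf c G) {X. Z3 c G X \<le> x} \<le> 1"
    by simp_all
  ultimately show "\<bar>measure_pmf.prob (coloring_pmf c G) {X. Z3 c G X \<le> x} - \<Phi> x\<bar> \<le> 1" by linarith
qed simp

lemma kolmogorov_le_root:
  assumes c5: "c \<ge> 5" and ne: "num_triangles G \<ge> 1"
  shows "kolmogorov_dist c G \<le> (4 + 2000 * real c ^ 16) * root 20 (Z3_fourth_moment c G - 3)"
proof -
  have ne': "triangles G \<noteq> {}" using ne by (auto simp: num_triangles_eq)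
  define s where "s = root 20 (Z3_fourth_moment c G - 3)"
  \<comment> \<open>Strict positivity makes \<open>s\<close> positive and lets its 20th power give
    the excess back.\<close>
  have k: "Z3_fourth_moment c G - 3 > 0" unfolding Z3_fourth_moment_eq by (rule excess_pos[OF c5 ne'])
  then have s: "s > 0" and s20: "s ^ 20 = Z3_fourth_moment c G - 3" by (simp_all add: s_def)
  show ?thesis
  proof (cases "s \<le> 1")
    case False
    \<comment> \<open>The distance never exceeds 1, so large \<open>s\<close> is trivial.\<close>
    have "1 * 1 \<le> (4 + 2000 * real c ^ 16) * s" using False by (intro mult_mono) auto
    then show ?thesis using kolmogorov_le_1 by (simp add: s_def)
  next
    case True
    interpret Z: real_distribution "Z3_distr c G" by (rule real_distribution_Z3)
    have "\<bar>measure_pmf.prob (coloring_pmf c G) {X. Z3 c G X \<le> x} - \<Phi> x\<bar> \<le> (4 + 2000 * real c ^ 16) * s" for x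
    proof -
      \<comment> \<open>Smoothing scale \<open>s^2\<close> and shift \<open>s\<close>: the tails
        become \<open>2 * s^2\<close>, and the error of order \<open>s^3\<close> becomes of order
        \<open>s\<close>.\<close>
      have "\<bar>cdf (Z3_distr c G) x - cdf std_normal_distribution x\<bar> 
        \<le> 2 * s + 2 * ((s\<^sup>2)\<^sup>2 / s\<^sup>2) + (2000 * real c ^ 16 * s ^ 3) / s\<^sup>2"
      proof (rule Z.cdf_normal_approx)
        show "cmod (char (Z3_distr c G) t - of_real (exp (- t\<^sup>2 / 2))) \<le> 2000 * real c ^ 16 * s ^ 3 * \<bar>t\<bar>" for t
          unfolding char_Z3 using s20 by (intro char_normalised_bound c5 ne' s True) (simp add: Z3_fourth_moment_eq)
      qed (use s in auto)
      also have "\<dots> = 2 * s + 2 * s\<^sup>2 + 2000 * real c ^ 16 * s"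
        using s by (simp add: power2_eq_square power3_eq_cube)
      also have "\<dots> \<le> (4 + 2000 * real c ^ 16) * s"
      proof -
        have "s\<^sup>2 \<le> s" using s True by (simp add: power2_eq_square mult_left_le)
        then show ?thesis by (simp add: algebra_simps)
      qed
      finally show ?thesis unfolding cdf_Z3 std_normal_cdf_def .
    qed
    then show ?thesis unfolding kolmogorov_dist_def s_def by (intro cSUP_least) auto
  qed
qed

end

theorem fourth_moment_bound:
  assumes "c \<ge> 5"
  shows "\<exists>C::real. C > 0 \<and>
          (\<forall>G :: nat \<Rightarrow> nat pair_pre_digraph.
             (\<forall>n\<ge>1. labelled_graph (G n) \<and> num_triangles (G n) \<ge> 1) \<longrightarrow>
             (\<forall>\<^sub>F n in sequentially.
                kolmogorov_dist c (G n) \<le> C * root 20 (Z3_fourth_moment c (G n) - 3)))"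
proof (intro exI conjI allI impI)
  show "0 < 4 + 2000 * real c ^ 16" by (simp add: add_pos_nonneg)
  fix G :: "nat \<Rightarrow> nat pair_pre_digraph"
  assume Gs: "\<forall>n\<ge>1. labelled_graph (G n) \<and> num_triangles (G n) \<ge> 1"
  show "\<forall>\<^sub>F n in sequentially. kolmogorov_dist c (G n) \<le> (4 + 2000 * real c ^ 16) * root 20 (Z3_fourth_moment c (G n) - 3)"
    using eventually_ge_at_top[of 1]
  proof eventually_elim
    case (elim n)
    interpret coloured_graph "G n" c using Gs elim assms by unfold_locales auto
    have "num_triangles (G n) \<ge> 1" using Gs elim by blast
    then show ?case using assms by (intro kolmogorov_le_root)
  qed
qed

section \<open>The counterexample with at most four colours\<close>

context colouring
begin

definition edge_dev :: "'v \<Rightarrow> 'v \<Rightarrow> ('v \<Rightarrow> nat) \<Rightarrow> real" where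
  "edge_dev u v X = of_bool (X u = X v) - 1 / c"

lemma avg_resample_real:
  fixes f :: "_ \<Rightarrow> real"
  shows "v \<in> V \<Longrightarrow> avg f = avg (\<lambda>X. (\<Sum>a\<in>{1..c}. f (X(v := a))) / c)"
  using avg_resample[of v f] by simp

text \<open>Whatever the other colours are, a fresh colour of \<open>v\<close> agrees with that of
  \<open>u\<close> with probability \<open>1 / c\<close>; so the edge is independent of any
  \<open>f\<close> that ignores \<open>v\<close>.\<close>

lemma avg_leaf:
  fixes \<phi> :: "real \<Rightarrow> real"
  assumes V: "u \<in> V" "v \<in> V" "u \<noteq> v" and f: "\<And>X a. f (X(v := a)) = f X"
  shows "avg (\<lambda>X. f X * \<phi> (edge_dev u v X)) = avg f * ((\<phi> (1 - 1 / c) + (c - 1) * \<phi> (- 1 / c)) / c)"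
proof -
  have "avg (\<lambda>X. f X * \<phi> (edge_dev u v X)) =
     avg (\<lambda>X. (\<Sum>a\<in>{1..c}. f (X(v := a)) * \<phi> (edge_dev u v (X(v := a)))) / c)"
    by (rule avg_resample_real[OF V(2)])
  also have "\<dots> = avg (\<lambda>X. f X * ((\<phi> (1 - 1 / c) + (c - 1) * \<phi> (- 1 / c)) / c))"
  proof (rule avg_cong)
    fix X assume X: "X \<in> colourings"
    have xu: "X u \<in> {1..c}" by (rule colourings_D[OF X V(1)])
    have "(\<Sum>a\<in>{1..c}. f (X(v := a)) * \<phi> (edge_dev u v (X(v := a)))) = f X * (\<Sum>a\<in>{1..c}. \<phi> (of_bool (X u = a) - 1 / c))"
      using V(3) by (simp only: f edge_dev_def fun_upd_same fun_upd_other[OF V(3)] sum_distrib_left)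
    also have "(\<Sum>a\<in>{1..c}. \<phi> (of_bool (X u = a) - 1 / c)) = \<phi> (1 - 1 / c) + (\<Sum>a\<in>{1..c} - {X u}. \<phi> (- 1 / c))"
      by (subst sum.remove[OF _ xu]) (auto intro!: sum.cong)
    also have "(\<Sum>a\<in>{1..c} - {X u}. \<phi> (- 1 / c)) = (c - 1) * \<phi> (- 1 / c)" using xu by simp
    finally have E: "(\<Sum>a\<in>{1..c}. f (X(v := a)) * \<phi> (edge_dev u v (X(v := a)))) = f X * (\<phi> (1 - 1 / c) + (c - 1) * \<phi> (- 1 / c))" .
    show "(\<Sum>a\<in>{1..c}. f (X(v := a)) * \<phi> (edge_dev u v (X(v := a)))) / c = f X * ((\<phi> (1 - 1 / c) + (c - 1) * \<phi> (- 1 / c)) / c)"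
      unfolding E by (rule times_divide_eq_right[symmetric])
  qed
  also have "\<dots> = avg f * ((\<phi> (1 - 1 / c) + (c - 1) * \<phi> (- 1 / c)) / c)" by (rule avg_cmult_right)
  finally show ?thesis .
qed

text \<open>This and \<open>edge_m4\<close> are moments of a centred Bernoulli variable with
  parameter \<open>1 / c\<close>.\<close>

definition edge_m2 :: real where "edge_m2 = (real c - 1) / real c ^ 2"
definition edge_m4 :: real where "edge_m4 = ((real c - 1) ^ 4 + (real c - 1)) / real c ^ 5"

text \<open>A pendant edge is an independent centred summand, so the odd cross terms vanish and the
  fourth cumulant grows by \<open>edge_m4 - 3 * edge_m2^2\<close>.\<close>

lemma avg_add_leaf:
  assumes V: "u \<in> V" "v \<in> V" "u \<noteq> v" and f: "\<And>X a. f (X(v := a)) = f X" and z: "avg f = 0"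
  shows "avg (\<lambda>X. f X + edge_dev u v X) = 0"
    and "avg (\<lambda>X. (f X + edge_dev u v X) ^ 2) = avg (\<lambda>X. f X ^ 2) + edge_m2"
    and "avg (\<lambda>X. (f X + edge_dev u v X) ^ 4) = avg (\<lambda>X. f X ^ 4) + 6 * edge_m2 * avg (\<lambda>X. f X ^ 2) + edge_m4"
proof -
  have c: "real c > 0" "real (c - 1) = real c - 1" using c_ge_2 by auto
  let ?m = "\<lambda>\<phi>. (\<phi> (1 - 1 / real c) + real (c - 1) * \<phi> (- 1 / real c)) / real c"
  have m1: "?m (\<lambda>x. x) = 0" using c by (simp add: field_simps)
  have edge_m2: "?m (\<lambda>x. x ^ 2) = edge_m2"
  proof -
    have "1 - 1 / real c = (real c - 1) / c" using c by (simp add: field_simps)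
    then have "?m (\<lambda>x. x ^ 2) = ((real c - 1) ^ 2 + (real c - 1)) / real c ^ 3"
      using c by (simp add: power_divide add_divide_distrib power_numeral_reduce)
    also have "(real c - 1) ^ 2 + (real c - 1) = real c * (real c - 1)" by (simp add: power2_eq_square algebra_simps)
    finally show ?thesis using c by (simp add: edge_m2_def power_numeral_reduce)
  qed
  have edge_m4: "?m (\<lambda>x. x ^ 4) = edge_m4"
  proof -
    have "1 - 1 / real c = (real c - 1) / c" using c by (simp add: field_simps)
    then show ?thesis using c by (simp add: edge_m4_def power_divide add_divide_distrib power_numeral_reduce)
  qed
  note leaf = avg_leaf[OF V]
  show "avg (\<lambda>X. f X + edge_dev u v X) = 0"
    using leaf[of "\<lambda>_. 1" "\<lambda>x. x"] m1 z by (simp add: avg_add)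
  have "(\<lambda>X. (f X + edge_dev u v X) ^ 2) = (\<lambda>X. f X ^ 2 + 2 * (f X * edge_dev u v X) + 1 * edge_dev u v X ^ 2)"
    by (simp add: power2_eq_square algebra_simps)
  then have "avg (\<lambda>X. (f X + edge_dev u v X) ^ 2) = avg (\<lambda>X. f X ^ 2) + 2 * avg (\<lambda>X. f X * edge_dev u v X) + avg (\<lambda>X. 1 * edge_dev u v X ^ 2)"
    by (simp only: avg_add avg_cmult)
  also have "avg (\<lambda>X. f X * edge_dev u v X) = 0" using leaf[of f "\<lambda>x. x"] z f by simp
  also have "avg (\<lambda>X. 1 * edge_dev u v X ^ 2) = edge_m2" using leaf[of "\<lambda>_. 1" "\<lambda>x. x ^ 2"] edge_m2 by simp
  finally show "avg (\<lambda>X. (f X + edge_dev u v X) ^ 2) = avg (\<lambda>X. f X ^ 2) + edge_m2" by simp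
  have "(\<lambda>X. (f X + edge_dev u v X) ^ 4) = (\<lambda>X. f X ^ 4 + 4 * (f X ^ 3 * edge_dev u v X) + 6 * (f X ^ 2 * edge_dev u v X ^ 2)
     + 4 * (f X * edge_dev u v X ^ 3) + 1 * edge_dev u v X ^ 4)"
    by (rule ext) algebra
  then have "avg (\<lambda>X. (f X + edge_dev u v X) ^ 4) = avg (\<lambda>X. f X ^ 4) + 4 * avg (\<lambda>X. f X ^ 3 * edge_dev u v X)
     + 6 * avg (\<lambda>X. f X ^ 2 * edge_dev u v X ^ 2) + 4 * avg (\<lambda>X. f X * edge_dev u v X ^ 3) + avg (\<lambda>X. 1 * edge_dev u v X ^ 4)"
    by (simp only: avg_add avg_cmult)
  also have "avg (\<lambda>X. f X ^ 3 * edge_dev u v X) = 0" using leaf[of "\<lambda>X. f X ^ 3" "\<lambda>x. x"] m1 f by simp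
  also have "avg (\<lambda>X. f X ^ 2 * edge_dev u v X ^ 2) = avg (\<lambda>X. f X ^ 2) * edge_m2"
    unfolding edge_m2[symmetric] by (rule leaf) (simp only: f)
  also have "avg (\<lambda>X. f X * edge_dev u v X ^ 3) = 0" using leaf[of f "\<lambda>x. x ^ 3"] z f by simp
  also have "avg (\<lambda>X. 1 * edge_dev u v X ^ 4) = edge_m4" using leaf[of "\<lambda>_. 1" "\<lambda>x. x ^ 4"] edge_m4 by simp
  finally show "avg (\<lambda>X. (f X + edge_dev u v X) ^ 4) = avg (\<lambda>X. f X ^ 4) + 6 * edge_m2 * avg (\<lambda>X. f X ^ 2) + edge_m4"
    by simp
qed

lemma avg_four_vertices:
  fixes h :: "nat \<Rightarrow> nat \<Rightarrow> nat \<Rightarrow> nat \<Rightarrow> real"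
  assumes V: "v1 \<in> V" "v2 \<in> V" "v3 \<in> V" "v4 \<in> V" and d: "distinct [v1, v2, v3, v4]"
  shows "avg (\<lambda>X. h (X v1) (X v2) (X v3) (X v4)) = (\<Sum>x1\<in>{1..c}. \<Sum>x2\<in>{1..c}. \<Sum>x3\<in>{1..c}. \<Sum>x4\<in>{1..c}. h x1 x2 x3 x4) / c ^ 4"
proof -
  have "avg (\<lambda>X. h (X v1) (X v2) (X v3) (X v4)) = avg (\<lambda>X. (\<Sum>x4\<in>{1..c}. h (X v1) (X v2) (X v3) x4) / c)"
    using d by (subst avg_resample_real[OF V(4)]) simp
  also have "\<dots> = avg (\<lambda>X. (\<Sum>x3\<in>{1..c}. (\<Sum>x4\<in>{1..c}. h (X v1) (X v2) x3 x4) / c) / c)"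
    using d by (subst avg_resample_real[OF V(3)]) simp
  also have "\<dots> = avg (\<lambda>X. (\<Sum>x2\<in>{1..c}. (\<Sum>x3\<in>{1..c}. (\<Sum>x4\<in>{1..c}. h (X v1) x2 x3 x4) / c) / c) / c)"
    using d by (subst avg_resample_real[OF V(2)]) simp
  also have "\<dots> = avg (\<lambda>X. (\<Sum>x1\<in>{1..c}. (\<Sum>x2\<in>{1..c}. (\<Sum>x3\<in>{1..c}. (\<Sum>x4\<in>{1..c}. h x1 x2 x3 x4) / c) / c) / c) / c)"
    using d by (subst avg_resample_real[OF V(1)]) simp
  also have "\<dots> = (\<Sum>x1\<in>{1..c}. \<Sum>x2\<in>{1..c}. \<Sum>x3\<in>{1..c}. \<Sum>x4\<in>{1..c}. h x1 x2 x3 x4) / c ^ 4"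
    by (simp add: sum_divide_distrib[symmetric] power_numeral_reduce)
  finally show ?thesis .
qed

end

text \<open>The number of monochromatic edges of a 4-cycle has mean \<open>4 / c\<close>; this is
  its deviation multiplied by \<open>c\<close>, an integer that can be evaluated.\<close>

definition cycle4_int :: "nat \<Rightarrow> nat \<Rightarrow> nat \<Rightarrow> nat \<Rightarrow> nat \<Rightarrow> int" where
  "cycle4_int c x1 x2 x3 x4 = int c * (of_bool (x1 = x2) + of_bool (x2 = x3) + of_bool (x3 = x4) + of_bool (x1 = x4)) - 4"

text \<open>Lists instead of finite sets, for the evaluation in \<open>cycle4_sums\<close>. Division
  by \<open>c^k * c^4\<close> gives the moments.\<close>

definition cycle4_sum :: "nat \<Rightarrow> nat \<Rightarrow> int" where
  "cycle4_sum c k = (\<Sum>x1\<leftarrow>[1..<Suc c]. \<Sum>x2\<leftarrow>[1..<Suc c]. \<Sum>x3\<leftarrow>[1..<Suc c]. \<Sum>x4\<leftarrow>[1..<Suc c]. cycle4_int c x1 x2 x3 x4 ^ k)"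

lemma cycle4_sums:
  "cycle4_sum 2 1 = 0" "cycle4_sum 3 1 = 0" "cycle4_sum 4 1 = 0"
  "cycle4_sum 2 2 = 64" "cycle4_sum 3 2 = 648" "cycle4_sum 4 2 = 3072"
  "cycle4_sum 2 4 = 1024" "cycle4_sum 3 4 = 17496" "cycle4_sum 4 4 = 122880"
  by code_simp+

text \<open>Up to the factor \<open>(c-1)/c^4\<close>, an edge contributes \<open>c^2 - 6c + 6\<close> to the fourth cumulant of the
  number of monochromatic edges and the 4-cycle contributes \<open>24\<close> more. With \<open>4 + q\<close> edges the total
  vanishes for \<open>q = 8\<close> if \<open>c = 2\<close> or \<open>c = 4\<close>, and for \<open>q = 4\<close> if \<open>c = 3\<close>.\<close>

definition base_edges :: "nat \<Rightarrow> (nat \<times> nat) set" where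
  "base_edges q = {(1, 2), (2, 3), (3, 4), (1, 4)} \<union> {1} \<times> {5..4 + q}"

definition pages :: "nat \<Rightarrow> nat \<Rightarrow> nat set" where
  "pages q n = {5 + q..4 + q + n}"

definition fan_arcs :: "nat \<Rightarrow> nat \<Rightarrow> (nat \<times> nat) set" where
  "fan_arcs q n = base_edges q \<union> {1..4 + q} \<times> pages q n"

text \<open>The pages carry the largest labels and are joined to base vertices alone, so every arc
  of \<open>fan_arcs\<close> ascends and a page can only be the last vertex of a triangle.\<close>

definition fan :: "nat \<Rightarrow> nat \<Rightarrow> nat pair_pre_digraph" where
  "fan q n = \<lparr>pverts = {1..4 + q + n}, parcs = fan_arcs q n \<union> (fan_arcs q n)\<inverse>\<rparr>"

lemma base_edges_iff:
  "(u, w) \<in> base_edges q \<longleftrightarrow> u = 1 \<and> (w = 2 \<or> w = 4 \<or> 5 \<le> w \<and> w \<le> 4 + q) \<or> u = 2 \<and> w = 3 \<or> u = 3 \<and> w = 4"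
  unfolding base_edges_def Un_iff insert_iff mem_Sigma_iff atLeastAtMost_iff prod.inject singleton_iff by blast

lemma base_edges_bounds: "(u, w) \<in> base_edges q \<Longrightarrow> 1 \<le> u \<and> u < w \<and> w \<le> 4 + q"
  by (auto simp: base_edges_def)

lemma base_edges_0: "base_edges 0 = {(1, 2), (2, 3), (3, 4), (1, 4)}"
  by (auto simp: base_edges_def)

lemma base_edges_Suc: "base_edges (Suc q) = insert (1, 5 + q) (base_edges q)"
  by (auto simp: base_edges_def)

lemma finite_base_edges: "finite (base_edges q)"
  by (induction q) (simp_all add: base_edges_0 base_edges_Suc)

lemma card_base_edges: "card (base_edges q) = 4 + q"
proof (induction q)
  case (Suc q)
  have "(1, 5 + q) \<notin> base_edges q" using base_edges_bounds[of 1 "5 + q" q] by auto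
  then show ?case using Suc finite_base_edges by (simp add: base_edges_Suc)
qed (simp add: base_edges_0)

lemma base_edges_triangle_free: "(a, b) \<in> base_edges q \<Longrightarrow> (b, d) \<in> base_edges q \<Longrightarrow> (a, d) \<notin> base_edges q"
  unfolding base_edges_iff by presburger

lemma card_pages: "card (pages q n) = n"
  by (simp add: pages_def)

lemma finite_pages: "finite (pages q n)"
  by (simp add: pages_def)

lemma pages_gt: "r \<in> pages q n \<Longrightarrow> r > 4 + q"
  by (simp add: pages_def)

lemma fan_arcs_bounds: "(u, w) \<in> fan_arcs q n \<Longrightarrow> 1 \<le> u \<and> u < w \<and> w \<le> 4 + q + n"
  using base_edges_bounds[of u w q] by (auto simp: fan_arcs_def pages_def)

lemma labelled_graph_fan: "labelled_graph (fan q n)"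
proof -
  have "pair_graph (fan q n)"
  proof
    show "finite (parcs (fan q n))"
      by (simp add: fan_def fan_arcs_def finite_base_edges finite_pages)
    show "symmetric (with_proj (fan q n))"
      by (auto simp: symmetric_def fan_def intro!: symI)
  qed (use fan_arcs_bounds in \<open>force simp: fan_def\<close>)+
  then show ?thesis by (simp add: labelled_graph_def fan_def)
qed

text \<open>The middle vertex of a triangle has a later neighbour, so it is no page; the last vertex
  must be one, as the base graph has no triangle.\<close>

lemma triangles_fan: "triangles (fan q n) = (\<lambda>((u, w), r). {u, w, r}) ` (base_edges q \<times> pages q n)"
proof (intro equalityI subsetI)
  fix S assume S: "S \<in> triangles (fan q n)"
  then have "card S = 3" by (simp add: triangles_def)
  then obtain a b d where abd: "S = {a, b, d}" "a < b" "b < d" using sorted_triple by blast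
  have arc: "(u, w) \<in> fan_arcs q n" if "(u, w) \<in> parcs (fan q n)" "u < w" for u w
    using that fan_arcs_bounds[of w u q n] by (auto simp: fan_def)
  have arcs: "(a, b) \<in> fan_arcs q n" "(b, d) \<in> fan_arcs q n" "(a, d) \<in> fan_arcs q n"
    using S abd by (auto simp: triangles_def intro!: arc)
  have b: "(x, b) \<in> base_edges q" if "(x, b) \<in> fan_arcs q n" "b \<le> 4 + q" for x
    using that by (auto simp: fan_arcs_def pages_def)
  have b4: "b \<le> 4 + q" using arcs(2) base_edges_bounds[of b d q] by (auto simp: fan_arcs_def)
  then have ab: "(a, b) \<in> base_edges q" using arcs(1) b by blast
  have "d \<in> pages q n"
  proof (rule ccontr)
    assume "d \<notin> pages q n"
    then have "(b, d) \<in> base_edges q" "(a, d) \<in> base_edges q" using arcs by (auto simp: fan_arcs_def)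
    then show False using base_edges_triangle_free[OF ab] by blast
  qed
  then show "S \<in> (\<lambda>((u, w), r). {u, w, r}) ` (base_edges q \<times> pages q n)"
    using ab abd(1) by (intro image_eqI[of _ _ "((a, b), d)"]) auto
next
  fix S assume "S \<in> (\<lambda>((u, w), r). {u, w, r}) ` (base_edges q \<times> pages q n)"
  then obtain u w r where S: "S = {u, w, r}" "(u, w) \<in> base_edges q" "r \<in> pages q n" by auto
  note bd = base_edges_bounds[OF S(2)] pages_gt[OF S(3)]
  have "(u, w) \<in> fan_arcs q n" "(u, r) \<in> fan_arcs q n" "(w, r) \<in> fan_arcs q n"
    using S bd by (auto simp: fan_arcs_def)
  moreover have "r \<le> 4 + q + n" using S(3) by (simp add: pages_def)
  ultimately show "S \<in> triangles (fan q n)" using bd unfolding S(1)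
    by (auto simp: triangles_def fan_def)
qed

lemma inj_triangles_fan: "inj_on (\<lambda>((u, w), r). {u, w, r}) (base_edges q \<times> pages q n)"
proof (rule inj_onI)
  fix x y assume x: "x \<in> base_edges q \<times> pages q n" and y: "y \<in> base_edges q \<times> pages q n"
    and e: "(\<lambda>((u, w), r). {u, w, r}) x = (\<lambda>((u, w), r). {u, w, r}) y"
  obtain u w r u' w' r' where xy: "x = ((u, w), r)" "y = ((u', w'), r')" by (metis surj_pair)
  have "u < w" "w < r" "u' < w'" "w' < r'"
    using x y base_edges_bounds[of u w q] base_edges_bounds[of u' w' q] pages_gt[of r q n] pages_gt[of r' q n]
    unfolding xy by auto
  from sorted_triple_unique[OF this] e show "x = y" unfolding xy by simp
qed

lemma num_triangles_fan: "num_triangles (fan q n) = (4 + q) * n"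
  unfolding num_triangles_eq triangles_fan card_image[OF inj_triangles_fan]
  by (simp add: card_cartesian_product card_base_edges card_pages)

section \<open>Moments of the base graph\<close>

locale nat_colouring = colouring V c for V :: "nat set" and c

context nat_colouring
begin

definition base_dev :: "nat \<Rightarrow> (nat \<Rightarrow> nat) \<Rightarrow> real" where
  "base_dev q X = (\<Sum>e\<in>base_edges q. edge_dev (fst e) (snd e) X)"

lemma base_dev_Suc: "base_dev (Suc q) X = base_dev q X + edge_dev 1 (5 + q) X"
proof -
  have "(1, 5 + q) \<notin> base_edges q" using base_edges_bounds[of 1 "5 + q" q] by auto
  then show ?thesis using finite_base_edges by (simp add: base_dev_def base_edges_Suc)
qed

lemma base_dev_upd: "v > 4 + q \<Longrightarrow> base_dev q (X(v := a)) = base_dev q X"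
  unfolding base_dev_def
proof (rule sum.cong[OF refl])
  fix e assume "e \<in> base_edges q" "v > 4 + q"
  then have "fst e \<noteq> v" "snd e \<noteq> v" using base_edges_bounds[of "fst e" "snd e" q] by auto
  then show "edge_dev (fst e) (snd e) (X(v := a)) = edge_dev (fst e) (snd e) X" by (simp add: edge_dev_def)
qed

lemma base_dev_0_moment:
  assumes "{1..4} \<subseteq> V"
  shows "avg (\<lambda>X. base_dev 0 X ^ k) = of_int (cycle4_sum c k) / real c ^ k / real c ^ 4"
proof -
  have "base_dev 0 X = of_int (cycle4_int c (X 1) (X 2) (X 3) (X 4)) / c" for X
    using c_ge_2 by (simp add: base_dev_def base_edges_0 edge_dev_def cycle4_int_def field_simps)
  then have "avg (\<lambda>X. base_dev 0 X ^ k) = avg (\<lambda>X. (of_int (cycle4_int c (X 1) (X 2) (X 3) (X 4)) / c) ^ k)"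
    by (simp only:)
  also have "\<dots> = (\<Sum>x1\<in>{1..c}. \<Sum>x2\<in>{1..c}. \<Sum>x3\<in>{1..c}. \<Sum>x4\<in>{1..c}. (of_int (cycle4_int c x1 x2 x3 x4) / c) ^ k) / c ^ 4"
    by (rule avg_four_vertices[where ?v1.0 = 1 and ?v2.0 = 2 and ?v3.0 = 3 and ?v4.0 = 4 and h = "\<lambda>a b d e. (of_int (cycle4_int c a b d e) / c) ^ k"])
      (use assms in auto)
  also have "(\<Sum>x1\<in>{1..c}. \<Sum>x2\<in>{1..c}. \<Sum>x3\<in>{1..c}. \<Sum>x4\<in>{1..c}. (of_int (cycle4_int c x1 x2 x3 x4) / c) ^ k)
     = of_int (cycle4_sum c k) / real c ^ k"
    unfolding cycle4_sum_def interv_sum_list_conv_sum_set_nat set_upt atLeastLessThanSuc_atLeastAtMost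
    by (simp only: of_int_sum of_int_power power_divide sum_divide_distrib)
  finally show ?thesis by simp
qed

text \<open>Fourth cumulants, unlike fourth moments, are additive over the pendant edges, so the
  induction runs on them.\<close>

lemma base_dev_moments:
  assumes "{1..4 + q} \<subseteq> V" and z: "avg (base_dev 0) = 0"
  shows "avg (base_dev q) = 0 \<and> avg (\<lambda>X. base_dev q X ^ 2) = avg (\<lambda>X. base_dev 0 X ^ 2) + q * edge_m2 \<and>
    avg (\<lambda>X. base_dev q X ^ 4) - 3 * (avg (\<lambda>X. base_dev q X ^ 2))\<^sup>2
      = avg (\<lambda>X. base_dev 0 X ^ 4) - 3 * (avg (\<lambda>X. base_dev 0 X ^ 2))\<^sup>2 + q * (edge_m4 - 3 * edge_m2\<^sup>2)"
  using assms(1)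
proof (induction q)
  case 0
  show ?case using z by simp
next
  case (Suc q)
  have V: "1 \<in> V" "5 + q \<in> V" "1 \<noteq> 5 + q" using Suc.prems by auto
  have "{1..4 + q} \<subseteq> V" using Suc.prems by auto
  note IH = Suc.IH[OF this]
  note leaf = avg_add_leaf[OF V base_dev_upd conjunct1[OF IH], folded base_dev_Suc]
  have l: "avg (base_dev (Suc q)) = 0"
    "avg (\<lambda>X. base_dev (Suc q) X ^ 2) = avg (\<lambda>X. base_dev q X ^ 2) + edge_m2"
    "avg (\<lambda>X. base_dev (Suc q) X ^ 4) = avg (\<lambda>X. base_dev q X ^ 4) + 6 * edge_m2 * avg (\<lambda>X. base_dev q X ^ 2) + edge_m4"
    using leaf by simp_all
  show ?case unfolding l using IH by (simp add: power2_eq_square algebra_simps)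
qed

text \<open>For these three pairs the negative cumulants of the edges cancel the surplus of the
  cycle, which leaves the fourth moment of a Gaussian. The variance is additive because distinct
  edges are pairwise independent, even on the cycle.\<close>

lemma base_dev_fourth_moment:
  assumes V: "{1..4 + q} \<subseteq> V" and cq: "(c, q) \<in> {(2, 8), (3, 4), (4, 8)}"
  shows "avg (\<lambda>X. base_dev q X ^ 2) = (4 + real q) * edge_m2" 
    and "avg (\<lambda>X. base_dev q X ^ 4) = 3 * ((4 + real q) * edge_m2)\<^sup>2"
proof -
  have V4: "{1..4} \<subseteq> V" using V by auto
  have "avg (base_dev 0) = 0" using base_dev_0_moment[OF V4, of 1] cq by (auto simp: cycle4_sums cycle4_sums[unfolded One_nat_def])
  note bm = base_dev_moments[OF V this]
  show 2: "avg (\<lambda>X. base_dev q X ^ 2) = (4 + real q) * edge_m2"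
    using bm base_dev_0_moment[OF V4, of 2] cq by (auto simp: cycle4_sums edge_m2_def)
  show "avg (\<lambda>X. base_dev q X ^ 4) = 3 * ((4 + real q) * edge_m2)\<^sup>2"
    using conjunct2[OF conjunct2[OF bm]] unfolding 2 unfolding base_dev_0_moment[OF V4]
    using cq by (auto simp: cycle4_sums edge_m2_def edge_m4_def power_divide)
qed

lemma abs_base_dev_le: "\<bar>base_dev q X\<bar> \<le> 4 + real q"
proof -
  have "\<bar>edge_dev u w X\<bar> \<le> 1" for u w using c_ge_2 by (simp add: edge_dev_def field_simps abs_le_iff)
  then have "\<bar>base_dev q X\<bar> \<le> (\<Sum>e\<in>base_edges q. 1)"
    unfolding base_dev_def by (intro order_trans[OF sum_abs] sum_mono)
  then show ?thesis by (simp add: card_base_edges)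
qed

end

lemma abs_power_diff_le:
  fixes x y B :: real
  assumes "\<bar>x\<bar> \<le> B" "\<bar>y\<bar> \<le> B"
  shows "\<bar>x ^ 2 - y ^ 2\<bar> \<le> 2 * B * \<bar>x - y\<bar>" and "\<bar>x ^ 4 - y ^ 4\<bar> \<le> 4 * B ^ 3 * \<bar>x - y\<bar>"
proof -
  have B: "B \<ge> 0" using assms by linarith
  have "\<bar>x ^ 2 - y ^ 2\<bar> = \<bar>x + y\<bar> * \<bar>x - y\<bar>" by (simp add: power2_eq_square algebra_simps flip: abs_mult)
  also have "\<dots> \<le> (2 * B) * \<bar>x - y\<bar>" using assms by (intro mult_right_mono) linarith+
  finally show 2: "\<bar>x ^ 2 - y ^ 2\<bar> \<le> 2 * B * \<bar>x - y\<bar>" .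
  have sq: "x ^ 2 \<le> B ^ 2" "y ^ 2 \<le> B ^ 2" using power_mono[OF assms(1), of 2] power_mono[OF assms(2), of 2] by simp_all
  have "x ^ 4 - y ^ 4 = (x ^ 2 + y ^ 2) * (x ^ 2 - y ^ 2)" by algebra
  then have "\<bar>x ^ 4 - y ^ 4\<bar> = (x ^ 2 + y ^ 2) * \<bar>x ^ 2 - y ^ 2\<bar>" by (simp add: abs_mult)
  also have "\<dots> \<le> (2 * B ^ 2) * (2 * B * \<bar>x - y\<bar>)" using sq B by (intro mult_mono 2) auto
  also have "\<dots> = 4 * B ^ 3 * \<bar>x - y\<bar>" by (simp add: power2_eq_square power3_eq_cube)
  finally show "\<bar>x ^ 4 - y ^ 4\<bar> \<le> 4 * B ^ 3 * \<bar>x - y\<bar>" .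
qed

section \<open>The fan: averaging over the pages\<close>

locale coloured_fan =
  fixes q n c :: nat
  assumes n: "n \<ge> 1" and c_ge: "c \<ge> 2"
begin

sublocale coloured_graph "fan q n" c
  using labelled_graph_fan c_ge by unfold_locales

sublocale nat_colouring "pverts (fan q n)" c ..

lemma pverts_fan: "pverts (fan q n) = {1..4 + q + n}"
  by (simp add: fan_def)

text \<open>The number of monochromatic triangles at the page \<open>r\<close>, minus its
  conditional mean given the base colours.\<close>

definition page_dev :: "nat \<Rightarrow> (nat \<Rightarrow> nat) \<Rightarrow> real" where
  "page_dev r X = (\<Sum>e\<in>base_edges q. mon {fst e, snd e, r} X - mon {fst e, snd e} X / c)"

lemma mon_pair: "mon {u, w} X = of_bool (X u = X w)"
  by (auto simp: mon_def Mon_def)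

text \<open>Conditioning on the base colours separates noise of order \<open>sqrt n\<close> from the
  pages and a dominant term of order \<open>n\<close> from the base graph.\<close>

lemma U_fan: "U X = (\<Sum>r\<in>pages q n. page_dev r X) + n * (base_dev q X / c)"
proof -
  have "U X = (\<Sum>x\<in>base_edges q \<times> pages q n. J ((\<lambda>((u, w), r). {u, w, r}) x) X)"
  proof -
    have "U X = sum (\<lambda>a. J a X) ((\<lambda>((u, w), r). {u, w, r}) ` (base_edges q \<times> pages q n))"
      unfolding U_def by (rule sum.cong[OF triangles_fan refl])
    then show ?thesis unfolding sum.reindex[OF inj_triangles_fan] o_def .
  qed
  also have "\<dots> = (\<Sum>e\<in>base_edges q. \<Sum>r\<in>pages q n. J {fst e, snd e, r} X)"
    by (simp add: sum.cartesian_product split_beta)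
  also have "\<dots> = (\<Sum>r\<in>pages q n. \<Sum>e\<in>base_edges q. J {fst e, snd e, r} X)"
    by (rule sum.swap)
  also have "\<dots> = (\<Sum>r\<in>pages q n. page_dev r X + base_dev q X / c)"
  proof (intro sum.cong refl)
    fix r
    have "J {fst e, snd e, r} X = (mon {fst e, snd e, r} X - mon {fst e, snd e} X / c) + edge_dev (fst e) (snd e) X / c" for e
      unfolding J_def p_def edge_dev_def mon_pair by (simp add: power2_eq_square diff_divide_distrib)
    then show "(\<Sum>e\<in>base_edges q. J {fst e, snd e, r} X) = page_dev r X + base_dev q X / c"
      by (simp only: page_dev_def base_dev_def sum.distrib sum_divide_distrib)
  qed
  finally show ?thesis by (simp add: sum.distrib card_pages)
qed

lemma abs_page_dev_le: "\<bar>page_dev r X\<bar> \<le> 4 + real q"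
proof -
  have "\<bar>page_dev r X\<bar> \<le> (\<Sum>e\<in>base_edges q. 1)"
    unfolding page_dev_def by (intro order_trans[OF sum_abs] sum_mono abs_mono_diff_le) auto
  then show ?thesis by (simp add: card_base_edges)
qed

lemma page_dev_upd:
  assumes "r' \<in> pages q n" "r \<noteq> r'"
  shows "page_dev r (X(r' := a)) = page_dev r X"
  unfolding page_dev_def
proof (rule sum.cong[OF refl])
  fix e assume "e \<in> base_edges q"
  then have "r' \<notin> {fst e, snd e, r}" using base_edges_bounds[of "fst e" "snd e" q] pages_gt[OF assms(1)] assms(2) by auto
  then have ni: "r' \<notin> {fst e, snd e, r}" "r' \<notin> {fst e, snd e}" by auto
  show "mon {fst e, snd e, r} (X(r' := a)) - mon {fst e, snd e} (X(r' := a)) / c = mon {fst e, snd e, r} X - mon {fst e, snd e} X / c"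
    unfolding mono_upd_notin[OF ni(1)] mono_upd_notin[OF ni(2)] ..
qed

lemma sum_page_dev_upd:
  assumes "r \<in> pages q n" "X \<in> colourings"
  shows "(\<Sum>a\<in>{1..c}. page_dev r (X(r := a))) = 0"
proof -
  have "(\<Sum>a\<in>{1..c}. page_dev r (X(r := a))) = (\<Sum>e\<in>base_edges q. \<Sum>a\<in>{1..c}. mon {fst e, snd e, r} (X(r := a)) - mon {fst e, snd e} (X(r := a)) / c)"
    unfolding page_dev_def by (rule sum.swap)
  also have "\<dots> = 0"
  proof (rule sum.neutral, rule ballI)
    fix e assume "e \<in> base_edges q"
    then have e: "1 \<le> fst e" "fst e < snd e" "snd e \<le> 4 + real q" using base_edges_bounds[of "fst e" "snd e" q] by auto
    have r: "4 + q < r" "r \<le> 4 + q + n" using assms(1) by (auto simp: pages_def)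
    have ni: "r \<notin> {fst e, snd e}" using e r by auto
    have rm: "{fst e, snd e, r} - {r} = {fst e, snd e}" using ni by auto
    have "(\<Sum>a\<in>{1..c}. mon {fst e, snd e, r} (X(r := a))) = mon {fst e, snd e} X"
      by (subst sum_mono_upd[OF assms(2), unfolded pverts_fan]) (use e r rm in auto)
    moreover have "(\<Sum>a\<in>{1..c}. mon {fst e, snd e} (X(r := a)) / c) = mon {fst e, snd e} X"
      using c_ge by (simp only: mono_upd_notin[OF ni]) simp
    ultimately show "(\<Sum>a\<in>{1..c}. mon {fst e, snd e, r} (X(r := a)) - mon {fst e, snd e} (X(r := a)) / c) = 0"
      by (simp only: sum_subtractf diff_self)
  qed
  finally show ?thesis .
qed

text \<open>Given the base colours, distinct pages are independent and centred, so only the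
  \<open>n\<close> diagonal terms remain.\<close>

lemma avg_page_dev_square: "avg (\<lambda>X. (\<Sum>r\<in>pages q n. page_dev r X)\<^sup>2) \<le> n * (4 + real q)\<^sup>2"
proof -
  have "avg (\<lambda>X. (\<Sum>r\<in>pages q n. page_dev r X)\<^sup>2) = (\<Sum>r\<in>pages q n. \<Sum>r'\<in>pages q n. avg (\<lambda>X. page_dev r X * page_dev r' X))"
    unfolding power2_eq_square by (rule avg_mult2)
  also have "\<dots> = (\<Sum>r\<in>pages q n. avg (\<lambda>X. page_dev r X * page_dev r X))"
  proof (rule sum.cong[OF refl])
    fix r assume r: "r \<in> pages q n"
    have "(\<Sum>r'\<in>pages q n. avg (\<lambda>X. page_dev r X * page_dev r' X)) = (\<Sum>r'\<in>{r}. avg (\<lambda>X. page_dev r X * page_dev r' X))"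
    proof (rule sum.mono_neutral_right)
      show "\<forall>r'\<in>pages q n - {r}. avg (\<lambda>X. page_dev r X * page_dev r' X) = 0"
      proof
        fix r' assume r': "r' \<in> pages q n - {r}"
        show "avg (\<lambda>X. page_dev r X * page_dev r' X) = 0"
        proof (rule avg_zero)
          show "r' \<in> pverts (fan q n)" using r' by (auto simp: pverts_fan pages_def)
          fix X assume "X \<in> colourings"
          then show "(\<Sum>a\<in>{1..c}. page_dev r (X(r' := a)) * page_dev r' (X(r' := a))) = 0"
            using r' page_dev_upd[of r' r X] sum_page_dev_upd[of r' X] by (simp add: sum_distrib_left[symmetric])
        qed
      qed
    qed (use r finite_pages in auto)
    then show "(\<Sum>r'\<in>pages q n. avg (\<lambda>X. page_dev r X * page_dev r' X)) = avg (\<lambda>X. page_dev r X * page_dev r X)" by simp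
  qed
  also have "\<dots> \<le> (\<Sum>r\<in>pages q n. avg (\<lambda>X. (4 + real q)\<^sup>2))"
  proof (intro sum_mono avg_mono)
    fix r X
    have "\<bar>page_dev r X\<bar> * \<bar>page_dev r X\<bar> \<le> (4 + real q) * (4 + real q)"
      using abs_page_dev_le[of r X] by (intro mult_mono) auto
    then show "page_dev r X * page_dev r X \<le> (4 + real q)\<^sup>2" by (simp add: power2_eq_square)
  qed
  also have "\<dots> = n * (4 + real q)\<^sup>2" by (simp add: card_pages)
  finally show ?thesis .
qed

lemma abs_U_fan_le: "\<bar>U X / n\<bar> \<le> 4 + real q"
proof -
  have "\<bar>J a X\<bar> \<le> 1" for a
  proof -
    have "0 \<le> p" "p \<le> 1" unfolding p_def using c_ge by (auto intro!: power_le_one)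
    then show ?thesis by (cases "Mon (a \<times> a) X") (simp_all add: J_def mon_def)
  qed
  then have "\<bar>U X\<bar> \<le> (\<Sum>a\<in>triangles (fan q n). 1)"
    unfolding U_def by (intro order_trans[OF sum_abs] sum_mono)
  also have "\<dots> = (4 + real q) * n" using num_triangles_fan[of q n] by (simp add: num_triangles_eq)
  finally show ?thesis using n by (simp add: field_simps)
qed

lemma abs_base_dev_div_le: "\<bar>base_dev q X / c\<bar> \<le> 4 + real q"
proof -
  have "\<bar>base_dev q X\<bar> / c \<le> (4 + real q) / 1"
    using abs_base_dev_le[of q X] c_ge by (intro frac_le) auto
  then show ?thesis by simp
qed

text \<open>After division by \<open>n\<close> the noise has mean square of order
  \<open>1 / n\<close>; Cauchy-Schwarz passes to the mean absolute value.\<close>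

lemma avg_abs_U_diff_le: "avg (\<lambda>X. \<bar>U X / n - base_dev q X / c\<bar>) \<le> (4 + real q) / sqrt n"
proof -
  have n0: "real n > 0" using n by simp
  have eq: "U X / n - base_dev q X / c = (\<Sum>r\<in>pages q n. page_dev r X) / n" for X
    unfolding U_fan using n0 by (simp add: field_simps)
  have "(avg (\<lambda>X. \<bar>((\<Sum>r\<in>pages q n. page_dev r X) / n) * 1\<bar>))\<^sup>2 \<le> avg (\<lambda>X. ((\<Sum>r\<in>pages q n. page_dev r X) / n)\<^sup>2) * avg (\<lambda>X. 1\<^sup>2)"
    by (rule avg_square_le)
  also have "\<dots> = avg (\<lambda>X. (\<Sum>r\<in>pages q n. page_dev r X)\<^sup>2) / (real n)\<^sup>2"
    by (simp add: power_divide avg_cdiv)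
  also have "\<dots> \<le> (real n * (4 + real q)\<^sup>2) / (real n)\<^sup>2"
    using avg_page_dev_square by (intro divide_right_mono) simp_all
  also have "\<dots> = ((4 + real q) / sqrt n)\<^sup>2" using n0 by (simp add: power_divide power2_eq_square)
  finally have "(avg (\<lambda>X. \<bar>(\<Sum>r\<in>pages q n. page_dev r X) / n\<bar>))\<^sup>2 \<le> ((4 + real q) / sqrt n)\<^sup>2"
    by (simp only: mult_1_right)
  then show ?thesis unfolding eq by (rule power2_le_imp_le) simp
qed

text \<open>Both \<open>U / n\<close> and \<open>base_dev q / c\<close> are bounded by
  \<open>4 + q\<close>, a range on which powers are Lipschitz, so their moments differ by at most a
  multiple of their mean distance.\<close>

lemma moments_fan:
  assumes cq: "(c, q) \<in> {(2, 8), (3, 4), (4, 8)}"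
  shows "\<bar>var / n ^ 2 - (4 + real q) * edge_m2 / c ^ 2\<bar> \<le> 2 * (4 + real q) ^ 2 / sqrt n"
    and "\<bar>avg (\<lambda>X. U X ^ 4) / n ^ 4 - 3 * ((4 + real q) * edge_m2 / c ^ 2)\<^sup>2\<bar> \<le> 4 * (4 + real q) ^ 4 / sqrt n"
proof -
  have V: "{1..4 + q} \<subseteq> pverts (fan q n)" by (auto simp: pverts_fan)
  let ?K = "4 + real q"
  have diff: "\<bar>avg (\<lambda>X. (U X / n) ^ k) - avg (\<lambda>X. (base_dev q X / c) ^ k)\<bar> \<le> B * (?K / sqrt n)"
    if "\<And>X. \<bar>(U X / n) ^ k - (base_dev q X / c) ^ k\<bar> \<le> B * \<bar>U X / n - base_dev q X / c\<bar>" "B \<ge> 0" for k B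
  proof -
    have "\<bar>avg (\<lambda>X. (U X / n) ^ k) - avg (\<lambda>X. (base_dev q X / c) ^ k)\<bar> \<le> avg (\<lambda>X. \<bar>(U X / n) ^ k - (base_dev q X / c) ^ k\<bar>)"
      unfolding avg_diff[symmetric] using norm_avg_le[of "\<lambda>X. (U X / n) ^ k - (base_dev q X / c) ^ k"] by simp
    also have "\<dots> \<le> avg (\<lambda>X. B * \<bar>U X / n - base_dev q X / c\<bar>)" by (intro avg_mono that)
    also have "\<dots> = B * avg (\<lambda>X. \<bar>U X / n - base_dev q X / c\<bar>)" by (rule avg_cmult)
    also have "\<dots> \<le> B * (?K / sqrt n)" using avg_abs_U_diff_le that(2) by (intro mult_left_mono) simp_all
    finally show ?thesis .
  qed
  have d2: "\<bar>avg (\<lambda>X. (U X / n) ^ 2) - avg (\<lambda>X. (base_dev q X / c) ^ 2)\<bar> \<le> (2 * ?K) * (?K / sqrt n)"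
    using abs_U_fan_le abs_base_dev_div_le by (intro diff abs_power_diff_le(1)) simp_all
  have b2: "avg (\<lambda>X. (base_dev q X / c) ^ 2) = (4 + real q) * edge_m2 / c ^ 2"
    using base_dev_fourth_moment(1)[OF V cq] by (simp add: power_divide avg_cdiv)
  have e2: "(2 * ?K) * (?K / sqrt n) = 2 * ?K ^ 2 / sqrt n" by (simp add: power2_eq_square)
  have v2: "avg (\<lambda>X. (U X / n) ^ 2) = var / n ^ 2" by (simp add: var_def power_divide avg_cdiv)
  show "\<bar>var / n ^ 2 - (4 + real q) * edge_m2 / c ^ 2\<bar> \<le> 2 * (4 + real q) ^ 2 / sqrt n"
    using d2 unfolding b2 e2 v2 .
  have d4: "\<bar>avg (\<lambda>X. (U X / n) ^ 4) - avg (\<lambda>X. (base_dev q X / c) ^ 4)\<bar> \<le> (4 * ?K ^ 3) * (?K / sqrt n)"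
    using abs_U_fan_le abs_base_dev_div_le by (intro diff abs_power_diff_le(2)) simp_all
  have b4: "avg (\<lambda>X. (base_dev q X / c) ^ 4) = 3 * ((4 + real q) * edge_m2 / c ^ 2)\<^sup>2"
    using base_dev_fourth_moment(2)[OF V cq] by (simp add: power_divide avg_cdiv flip: power_mult)
  have e4: "(4 * ?K ^ 3) * (?K / sqrt n) = 4 * ?K ^ 4 / sqrt n" by (simp add: power_numeral_reduce)
  have v4: "avg (\<lambda>X. (U X / n) ^ 4) = avg (\<lambda>X. U X ^ 4) / n ^ 4" by (simp add: power_divide avg_cdiv)
  show "\<bar>avg (\<lambda>X. U X ^ 4) / n ^ 4 - 3 * ((4 + real q) * edge_m2 / c ^ 2)\<^sup>2\<bar> \<le> 4 * (4 + real q) ^ 4 / sqrt n"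
    using d4 unfolding b4 e4 v4 .
qed

text \<open>Interface to the limit: \<open>y\<close> is the variance of \<open>U\<close> over
  \<open>n^2\<close> and \<open>x\<close> its fourth moment over \<open>n^4\<close>. The existential
  form keeps constants of the locale out of the limit argument.\<close>

lemma fan_summary:
  assumes cq: "(c, q) \<in> {(2, 8), (3, 4), (4, 8)}"
  shows "\<exists>x y. Z3_fourth_moment c (fan q n) = x / y\<^sup>2 \<and> y > 0
    \<and> \<bar>y - (4 + real q) * edge_m2 / c ^ 2\<bar> \<le> 2 * (4 + real q) ^ 2 / sqrt n
    \<and> \<bar>x - 3 * ((4 + real q) * edge_m2 / c ^ 2)\<^sup>2\<bar> \<le> 4 * (4 + real q) ^ 4 / sqrt n
    \<and> (\<forall>X. \<bar>Z3 c (fan q n) X\<bar> \<le> (4 + real q) / sqrt y)"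
proof (intro exI conjI allI)
  have n0: "real n > 0" using n by simp
  have "triangles (fan q n) \<noteq> {}"
    using num_triangles_fan[of q n] n by (auto simp: num_triangles_eq)
  then have v: "var > 0" by (rule var_pos)
  show "Z3_fourth_moment c (fan q n) = (avg (\<lambda>X. U X ^ 4) / n ^ 4) / (var / n ^ 2)\<^sup>2"
    unfolding Z3_fourth_moment_eq using n0 by (simp add: power_divide flip: power_mult)
  show "var / n ^ 2 > 0" using v n0 by simp
  show "\<bar>var / n ^ 2 - (4 + real q) * edge_m2 / c ^ 2\<bar> \<le> 2 * (4 + real q) ^ 2 / sqrt n"
    and "\<bar>avg (\<lambda>X. U X ^ 4) / n ^ 4 - 3 * ((4 + real q) * edge_m2 / c ^ 2)\<^sup>2\<bar> \<le> 4 * (4 + real q) ^ 4 / sqrt n"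
    using moments_fan[OF cq] by simp_all
  fix X
  have "\<bar>Z3 c (fan q n) X\<bar> = \<bar>U X / n\<bar> / sqrt (var / n ^ 2)"
    unfolding Z3_eq using v n0 by (simp add: real_sqrt_divide)
  also have "\<dots> \<le> (4 + real q) / sqrt (var / n ^ 2)" using abs_U_fan_le v by (intro divide_right_mono) auto
  finally show "\<bar>Z3 c (fan q n) X\<bar> \<le> (4 + real q) / sqrt (var / n ^ 2)" .
qed

end

section \<open>Failure of convergence to the normal law\<close>

text \<open>The density is positive everywhere, so no upper half-line is a null set; hence uniformly
  bounded variables cannot converge to the normal law.\<close>

lemma std_normal_cdf_less_1: "cdf std_normal_distribution x < 1"
proof -
  interpret N: real_distribution std_normal_distribution by (rule real_dist_normal_dist)
  have "emeasure std_normal_distribution {x<..} \<noteq> 0"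
  proof
    assume "emeasure std_normal_distribution {x<..} = 0"
    then have "AE y in lborel. ennreal (std_normal_density y) * indicator {x<..} y = 0"
      by (subst (asm) emeasure_density) (auto simp: nn_integral_0_iff_AE)
    then have "AE y in lborel. y \<notin> {x<..}"
      by eventually_elim (auto simp: normal_density_def split: split_indicator_asm)
    then have "emeasure lborel {x<..} = 0" by (subst (asm) AE_iff_measurable[of "{x<..}"]) auto
    moreover have "emeasure lborel {x<..x + 1} \<le> emeasure lborel {x<..}" by (intro emeasure_mono) auto
    ultimately show False by simp
  qed
  then have "measure std_normal_distribution {x<..} > 0"
    by (simp add: N.emeasure_eq_measure zero_less_measure_iff)
  moreover have "measure std_normal_distribution {x<..} = 1 - measure std_normal_distribution {..x}"
    using N.prob_compl[of "{..x}"] by (simp add: Compl_eq_Diff_UNIV[symmetric])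
  ultimately show ?thesis by (simp add: cdf_def2)
qed

lemma isCont_std_normal_cdf: "isCont (cdf std_normal_distribution) x"
proof -
  interpret N: real_distribution std_normal_distribution by (rule real_dist_normal_dist)
  have "emeasure std_normal_distribution {x} = 0"
    by (subst emeasure_density) (auto simp: nn_integral_indicator_singleton)
  then show ?thesis by (simp add: N.isCont_cdf measure_def)
qed

lemma tendsto_of_abs_le_sqrt:
  fixes f :: "nat \<Rightarrow> real"
  assumes "\<And>n. n \<ge> 1 \<Longrightarrow> \<bar>f n - l\<bar> \<le> B / sqrt n"
  shows "f \<longlonglongrightarrow> l"
proof -
  have "(\<lambda>n. B / sqrt (real n)) \<longlonglongrightarrow> 0"
    by (intro tendsto_divide_0[OF tendsto_const] filterlim_at_top_imp_at_infinity
        filterlim_compose[OF sqrt_at_top filterlim_real_sequentially])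
  moreover have "\<forall>\<^sub>F n in sequentially. norm (f n - l) \<le> B / sqrt n"
    using eventually_ge_at_top[of 1] by eventually_elim (simp add: assms)
  ultimately have "(\<lambda>n. f n - l) \<longlonglongrightarrow> 0" by (rule Lim_null_comparison[rotated])
  then show ?thesis by (simp add: LIM_zero_iff)
qed

theorem fourth_moment_counterexample:
  assumes c: "2 \<le> c" "c \<le> 4"
  shows "\<exists>G :: nat \<Rightarrow> nat pair_pre_digraph.
           (\<forall>n\<ge>1. labelled_graph (G n) \<and> num_triangles (G n) \<ge> 1) \<and>
           filterlim (\<lambda>n. num_triangles (G n)) at_top sequentially \<and>
           (\<lambda>n. Z3_fourth_moment c (G n)) \<longlonglongrightarrow> 3 \<and>
           \<not> weak_conv_m (\<lambda>n. Z3_distr c (G n)) std_normal_distribution"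
proof -
  define q where "q = (if c = 3 then 4 else 8 :: nat)"
  have cq: "(c, q) \<in> {(2, 8), (3, 4), (4, 8)}"
  proof -
    have "c = 2 \<or> c = 3 \<or> c = 4" using c by linarith
    then show ?thesis by (auto simp: q_def)
  qed
  define K where "K = 4 + real q"
  \<comment> \<open>The limit of the variance of \<open>U\<close> over \<open>n^2\<close>, with
    \<open>edge_m2\<close> written out because it belongs to a locale.\<close>
  define v where "v = K * ((real c - 1) / real c ^ 2) / c ^ 2"
  have v: "v > 0" using c by (simp add: v_def K_def add_pos_nonneg)
  have fan: "coloured_fan n c" if "n \<ge> 1" for n using that c by unfold_locales
  let ?P = "\<lambda>n xy. Z3_fourth_moment c (fan q n) = fst xy / (snd xy)\<^sup>2 \<and> snd xy > 0
    \<and> \<bar>snd xy - v\<bar> \<le> 2 * K ^ 2 / sqrt (real n) \<and> \<bar>fst xy - 3 * v\<^sup>2\<bar> \<le> 4 * K ^ 4 / sqrt (real n)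
    \<and> (\<forall>X. \<bar>Z3 c (fan q n) X\<bar> \<le> K / sqrt (snd xy))"
  have "\<forall>n\<in>{1..}. \<exists>xy. ?P n xy"
  proof
    fix n :: nat assume "n \<in> {1..}"
    then interpret coloured_fan q n c using fan by simp
    show "\<exists>xy. ?P n xy"
      using fan_summary[OF cq] unfolding edge_m2_def K_def[symmetric] v_def[symmetric] by (simp only: split_paired_Ex fst_conv snd_conv)
  qed
  from bchoice[OF this] obtain xy where "\<forall>n\<in>{1..}. ?P n (xy n)" ..
  then have xy: "Z3_fourth_moment c (fan q n) = fst (xy n) / (snd (xy n))\<^sup>2" "snd (xy n) > 0"
      "\<bar>snd (xy n) - v\<bar> \<le> 2 * K ^ 2 / sqrt n" "\<bar>fst (xy n) - 3 * v\<^sup>2\<bar> \<le> 4 * K ^ 4 / sqrt n"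
      "\<bar>Z3 c (fan q n) X\<bar> \<le> K / sqrt (snd (xy n))" if "n \<ge> 1" for n X using that by simp_all
  have y: "(\<lambda>n. snd (xy n)) \<longlonglongrightarrow> v" using xy(3) by (rule tendsto_of_abs_le_sqrt)
  have x: "(\<lambda>n. fst (xy n)) \<longlonglongrightarrow> 3 * v\<^sup>2" using xy(4) by (rule tendsto_of_abs_le_sqrt)
  show ?thesis
  proof (intro exI[of _ "fan q"] conjI allI impI)
    fix n :: nat assume "n \<ge> 1"
    then show "labelled_graph (fan q n)" "num_triangles (fan q n) \<ge> 1"
      by (simp_all add: labelled_graph_fan num_triangles_fan)
  next
    show "filterlim (\<lambda>n. num_triangles (fan q n)) at_top sequentially"
    proof (rule filterlim_at_top_mono[OF filterlim_ident])
      show "\<forall>\<^sub>F n in sequentially. n \<le> num_triangles (fan q n)" by (simp add: num_triangles_fan)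
    qed
  next
    have "(\<lambda>n. fst (xy n) / (snd (xy n))\<^sup>2) \<longlonglongrightarrow> 3 * v\<^sup>2 / v\<^sup>2"
      using v by (intro tendsto_intros x y) simp
    moreover have "\<forall>\<^sub>F n in sequentially. fst (xy n) / (snd (xy n))\<^sup>2 = Z3_fourth_moment c (fan q n)"
      using eventually_ge_at_top[of 1] by eventually_elim (simp add: xy(1))
    ultimately have "(\<lambda>n. Z3_fourth_moment c (fan q n)) \<longlonglongrightarrow> 3 * v\<^sup>2 / v\<^sup>2"
      by (rule Lim_transform_eventually)
    then show "(\<lambda>n. Z3_fourth_moment c (fan q n)) \<longlonglongrightarrow> 3" using v by simp
  next
    \<comment> \<open>A common bound for \<open>Z3\<close> at all large \<open>n\<close>: the scaled
      variance tends to \<open>v > 0\<close> and so eventually exceeds \<open>v / 2\<close>.\<close>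
    define B where "B = K / sqrt (v / 2)"
    have "\<forall>\<^sub>F n in sequentially. snd (xy n) > v / 2" using y v by (intro order_tendstoD(1)) auto
    then have ev: "\<forall>\<^sub>F n in sequentially. cdf (Z3_distr c (fan q n)) B = 1"
      using eventually_ge_at_top[of 1]
    proof eventually_elim
      case (elim n)
      interpret coloured_fan q n c using elim fan by simp
      have "Z3 c (fan q n) X \<le> B" for X
      proof -
        have "Z3 c (fan q n) X \<le> K / sqrt (snd (xy n))" using xy(5)[OF elim(2), of X] by linarith
        also have "\<dots> \<le> B" unfolding B_def using elim v by (intro divide_left_mono) (auto simp: K_def)
        finally show ?thesis .
      qed
      then have "{X. Z3 c (fan q n) X \<le> B} = UNIV" by auto
      then show ?case unfolding cdf_Z3 by simp
    qed
    show "\<not> weak_conv_m (\<lambda>n. Z3_distr c (fan q n)) std_normal_distribution"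
    proof
      assume "weak_conv_m (\<lambda>n. Z3_distr c (fan q n)) std_normal_distribution"
      then have "(\<lambda>n. cdf (Z3_distr c (fan q n)) B) \<longlonglongrightarrow> cdf std_normal_distribution B"
        using isCont_std_normal_cdf unfolding weak_conv_m_def weak_conv_def by blast
      moreover have "(\<lambda>n. cdf (Z3_distr c (fan q n)) B) \<longlonglongrightarrow> 1"
        by (rule tendsto_eventually[OF ev])
      ultimately have "cdf std_normal_distribution B = 1" by (rule LIMSEQ_unique)
      then show False using std_normal_cdf_less_1[of B] by simp
    qed
  qed
qed

theorem theorem1p2:
  shows
    "(\<forall>c::nat. c \<ge> 5 \<longrightarrow>
        (\<exists>C::real. C > 0 \<and>
          (\<forall>G :: nat \<Rightarrow> nat pair_pre_digraph.
             (\<forall>n\<ge>1. labelled_graph (G n) \<and> num_triangles (G n) \<ge> 1) \<longrightarrow>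
             (\<forall>\<^sub>F n in sequentially.
                kolmogorov_dist c (G n) \<le> C * root 20 (Z3_fourth_moment c (G n) - 3)))))
     \<and>
     (\<forall>c::nat. 2 \<le> c \<and> c \<le> 4 \<longrightarrow>
        (\<exists>G :: nat \<Rightarrow> nat pair_pre_digraph.
           (\<forall>n\<ge>1. labelled_graph (G n) \<and> num_triangles (G n) \<ge> 1) \<and>
           filterlim (\<lambda>n. num_triangles (G n)) at_top sequentially \<and>
           (\<lambda>n. Z3_fourth_moment c (G n)) \<longlonglongrightarrow> 3 \<and>
           \<not> weak_conv_m (\<lambda>n. Z3_distr c (G n)) std_normal_distribution))"
  using fourth_moment_bound fourth_moment_counterexample by (intro conjI allI impI) (simp_all only:)

end
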